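(* Let $F$ be an infinite field of characteristic $p>0$ and $n\ge 1$. There exists a complete set $\{e_{\lambda,F}:\lambda\in\Lambda^+_p(n)\}$ of pairwise orthogonal primitive idempotents of the descent algebra $\mathcal{D}_n(F)$ such that $\sum_{\lambda\in\Lambda^+_p(n)}e_{\lambda,F}=1$, $c_{n,F}(e_{\lambda,F})=\mathrm{char}_{\lambda,F}$ for every $\lambda$, and \[ e_{\lambda,F}=\frac{1}{[\lambda]!}\,\Xi^\lambda+\epsilon_\lambda,\] where $\epsilon_\lambda$ is an $F$-linear combination of elements $\Xi^\xi$ with $\xi\in\Lambda(n)$ and $\xi\prec\lambda$.
   Context: Permutations in $S_n$ act on the right and are composed left to right. A composition of $n$ is a finite sequence $q=(q_1,\dots,q_k)$ of positive integers summing to $n$; $\Lambda(n)$ is the set of compositions of $n$, $\ell(q)=k$, $q^+_j=q_1+\dots+q_j$, and $m_i(q)$ is the number of parts of $q$ equal to $i$. For $\lambda$ a partition, $[\lambda]!:=\prod_i m_i(\lambda)!$. A partition $\lambda$ of $n$ is $p$-regular if $m_i(\lambda)<p$ for all $i$; $\Lambda^+_p(n)$ denotes the set of $p$-regular partitions of $n$. Write $q\approx r$ if $r$ is a rearrangement of $q$. A composition $r$ is a (strong) refinement of $q$, written $r\leqslant q$, if $r$ is the concatenation of compositions of $q_1,q_2,\dots,q_k$ in this order; $r\preccurlyeq q$ (weak refinement) if some rearrangement of $r$ is a strong refinement of $q$; $r\prec q$ means $r\preccurlyeq q$ and $r\not\approx q$. A permutation $\sigma$ has a descent at $i$ if $(i)\sigma>(i+1)\sigma$.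 For $q\in\Lambda(n)$, $\Xi^q\in FS_n$ is the sum of all $\sigma\in S_n$ whose descents all lie in $\{q^+_1,\dots,q^+_{\ell(q)}\}$. The descent algebra $\mathcal{D}_n(F)$ is the $F$-span of $\{\Xi^q:q\in\Lambda(n)\}$ (a subalgebra of $FS_n$). For $q\in\Lambda(n)$, $\varphi^{q,F}$ is the $F$-valued permutation character of $S_n$ on the right cosets of the Young subgroup $S_{q_1}\times\cdots\times S_{q_k}$; $\mathcal{C}_n(F)$ is the $F$-span of these class functions, and the Solomon epimorphism is the surjective $F$-algebra homomorphism $c_{n,F}:\mathcal{D}_n(F)\to\mathcal{C}_n(F)$, $\Xi^q\mapsto\varphi^{q,F}$. Two partitions $\lambda,\mu$ of $n$ are $p$-equivalent if the $p'$-parts of permutations of cycle types $\lambda$ and $\mu$ are conjugate in $S_n$; each $p$-equivalence class contains exactly one $p$-regular partition. For $\lambda\in\Lambda^+_p(n)$, $\mathcal{C}_{\lambda,p}$ is the set of permutations whose cycle type is $p$-equivalent to $\lambda$, and $\mathrm{char}_{\lambda,F}$ is the characteristic function of $\mathcal{C}_{\lambda,p}$. *)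

theory Defs
  imports "HOL-Combinatorics.Combinatorics" "HOL-Library.Function_Algebras" "HOL-Library.Multiset"
begin

(* Permutations of {1..n}: functions nat => nat with  s permutes {1..n}.
   The image of i under s (written (i)s in the paper) is  s i.
   Composition left to right: the product  s t  (first s, then t) is the function  t o s. *)

type_synonym 'a grpalg = "(nat \<Rightarrow> nat) \<Rightarrow> 'a"

definition perms :: "nat \<Rightarrow> (nat \<Rightarrow> nat) set" where
  "perms n = {s. s permutes {1..n}}"

(* group algebra FS_n : functions supported on perms n; addition is pointwise *)
definition smul :: "'a::field \<Rightarrow> 'a grpalg \<Rightarrow> 'a grpalg" where
  "smul c x = (\<lambda>s. c * x s)"

(* (x*y)(pi) = sum over s t with s t = pi (i.e. t o s = pi) of x s * y t *)
definition ga_mult :: "nat \<Rightarrow> 'a::field grpalg \<Rightarrow> 'a grpalg \<Rightarrow> 'a grpalg" where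
  "ga_mult n x y = (\<lambda>pi. if pi \<in> perms n
      then (\<Sum>s\<in>perms n. x s * y (pi \<circ> inv s)) else 0)"

definition ga_one :: "nat \<Rightarrow> 'a::field grpalg" where
  "ga_one n = (\<lambda>s. if s = id then 1 else 0)"

definition comps :: "nat \<Rightarrow> nat list set" where
  "comps n = {q. (\<forall>x\<in>set q. 0 < x) \<and> sum_list q = n}"

definition psums :: "nat list \<Rightarrow> nat set" where
  "psums q = {sum_list (take j q) | j. 1 \<le> j \<and> j \<le> length q}"

definition has_descent :: "(nat \<Rightarrow> nat) \<Rightarrow> nat \<Rightarrow> bool" where
  "has_descent s i \<longleftrightarrow> s i > s (Suc i)"

definition Xi :: "nat \<Rightarrow> nat list \<Rightarrow> 'a::field grpalg" where
  "Xi n q = (\<lambda>s. if s \<in> perms n \<and>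
       (\<forall>i. 1 \<le> i \<and> i < n \<and> has_descent s i \<longrightarrow> i \<in> psums q) then 1 else 0)"

definition descent_alg :: "nat \<Rightarrow> 'a::field grpalg set" where
  "descent_alg n = {x. \<exists>c. x = (\<Sum>q\<in>comps n. smul (c q) (Xi n q))}"

definition idem :: "nat \<Rightarrow> 'a::field grpalg \<Rightarrow> bool" where
  "idem n e \<longleftrightarrow> ga_mult n e e = e"

definition primitive_idem :: "nat \<Rightarrow> 'a::field grpalg \<Rightarrow> bool" where
  "primitive_idem n e \<longleftrightarrow> e \<in> descent_alg n \<and> e \<noteq> 0 \<and> idem n e \<and>
     \<not> (\<exists>f g. f \<in> descent_alg n \<and> g \<in> descent_alg n \<and> f \<noteq> 0 \<and> g \<noteq> 0 \<and>
            idem n f \<and> idem n g \<and> ga_mult n f g = 0 \<and> ga_mult n g f = 0 \<and> e = f + g)"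

definition young :: "nat \<Rightarrow> nat list \<Rightarrow> (nat \<Rightarrow> nat) set" where
  "young n q = {s \<in> perms n. \<forall>j < length q.
      s ` {sum_list (take j q) + 1 .. sum_list (take (Suc j) q)}
        = {sum_list (take j q) + 1 .. sum_list (take (Suc j) q)}}"

(* right cosets Y g = {y g | y in Y} = {g o y | y in Y} *)
definition rcosets_young :: "nat \<Rightarrow> nat list \<Rightarrow> (nat \<Rightarrow> nat) set set" where
  "rcosets_young n q = {(\<lambda>y. g \<circ> y) ` young n q | g. g \<in> perms n}"

(* permutation character: number of right cosets C with C s = C, where C s = {h s | h in C} *)
definition perm_char :: "nat \<Rightarrow> nat list \<Rightarrow> 'a::field grpalg" where
  "perm_char n q = (\<lambda>s. if s \<in> perms n then
      of_nat (card {C \<in> rcosets_young n q. (\<lambda>h. s \<circ> h) ` C = C}) else 0)"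

definition solomon :: "nat \<Rightarrow> 'a::field grpalg \<Rightarrow> 'a grpalg" where
  "solomon n x = (THE y. \<exists>c. x = (\<Sum>q\<in>comps n. smul (c q) (Xi n q))
                          \<and> y = (\<Sum>q\<in>comps n. smul (c q) (perm_char n q)))"

definition partitions :: "nat \<Rightarrow> nat list set" where
  "partitions n = {l \<in> comps n. sorted_wrt (\<ge>) l}"

definition p_regular_partitions :: "nat \<Rightarrow> nat \<Rightarrow> nat list set" where
  "p_regular_partitions p n = {l \<in> partitions n. \<forall>i. count (mset l) i < p}"

definition brfact :: "nat list \<Rightarrow> nat" where
  "brfact l = (\<Prod>i\<in>set l. fact (count (mset l) i))"

definition strong_refines :: "nat list \<Rightarrow> nat list \<Rightarrow> bool" where
  "strong_refines r q \<longleftrightarrow> (\<exists>rs. length rs = length q \<and> r = concat rs \<and>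
      (\<forall>j < length q. rs ! j \<in> comps (q ! j)))"

definition rearr :: "nat list \<Rightarrow> nat list \<Rightarrow> bool" where
  "rearr q r \<longleftrightarrow> mset q = mset r"

definition weak_refines :: "nat list \<Rightarrow> nat list \<Rightarrow> bool" where
  "weak_refines r q \<longleftrightarrow> (\<exists>r'. rearr r r' \<and> strong_refines r' q)"

definition strict_weak_refines :: "nat list \<Rightarrow> nat list \<Rightarrow> bool" where
  "strict_weak_refines r q \<longleftrightarrow> weak_refines r q \<and> \<not> rearr q r"

definition cycle_type :: "nat \<Rightarrow> (nat \<Rightarrow> nat) \<Rightarrow> nat multiset" where
  "cycle_type n s = image_mset card (mset_set ((\<lambda>i. orbit s i) ` {1..n}))"

definition p'_part :: "nat \<Rightarrow> (nat \<Rightarrow> nat) \<Rightarrow> (nat \<Rightarrow> nat)" where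
  "p'_part p s = (THE t. (\<exists>k. t = s ^^ k) \<and>
      (\<exists>m. 0 < m \<and> coprime m p \<and> t ^^ m = id) \<and>
      (\<exists>a. (s \<circ> inv t) ^^ (p ^ a) = id))"

definition conj_in :: "nat \<Rightarrow> (nat \<Rightarrow> nat) \<Rightarrow> (nat \<Rightarrow> nat) \<Rightarrow> bool" where
  "conj_in n s t \<longleftrightarrow> (\<exists>g \<in> perms n. t = inv g \<circ> s \<circ> g)"

definition p_equiv :: "nat \<Rightarrow> nat \<Rightarrow> nat list \<Rightarrow> nat list \<Rightarrow> bool" where
  "p_equiv p n l m \<longleftrightarrow> (\<forall>s\<in>perms n. \<forall>t\<in>perms n.
      cycle_type n s = mset l \<and> cycle_type n t = mset m \<longrightarrow>
      conj_in n (p'_part p s) (p'_part p t))"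

definition char_fun :: "nat \<Rightarrow> nat \<Rightarrow> nat list \<Rightarrow> 'a::field grpalg" where
  "char_fun p n l = (\<lambda>s. if s \<in> perms n \<and>
      (\<exists>m \<in> partitions n. mset m = cycle_type n s \<and> p_equiv p n m l) then 1 else 0)"

end

theory Submission
  imports Defs "HOL-Library.Poly_Mapping" "HOL-Computational_Algebra.Primes"
begin

text \<open>
  Following Bidigare, the descent algebra is the algebra of \<open>S\<^sub>n\<close>-invariants in the monoid algebra of
  set compositions of \<open>{1..n}\<close>: left multiplication by \<open>\<Xi>\<^sup>q\<close> is the action on linear orders of the
  sum of all set compositions of type \<open>q\<close>. Solomon's epimorphism, evaluated at \<open>s\<close>, becomes the
  linear extension of the monoid character "every orbit of \<open>s\<close> lies in a block", hence is
  multiplicative. For set compositions \<open>k\<close>, \<open>b\<close> one has \<open>k b = k\<close> if the blocks of \<open>b\<close> are unions of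
  blocks of \<open>k\<close>, and otherwise \<open>k b\<close> has strictly finer blocks than \<open>k\<close>; so right multiplication is
  triangular with the character values on the diagonal, and the kernel of the epimorphism is nil.

  In characteristic \<open>p\<close> the character values depend only on the \<open>p'\<close>-part of \<open>s\<close>, because a
  \<open>p\<close>-group acting on a finite set \<open>X\<close> has \<open>|X|\<close> fixed points modulo \<open>p\<close>. The idempotents are
  constructed in the order of increasing \<open>\<lambda>\<close>: if \<open>s\<close> is the sum of those already found and
  \<open>w = \<Xi>\<^sup>\<lambda> / [\<lambda>]!\<close>, then \<open>h = (1 - s) w (1 - s)\<close> has image \<open>char\<^sub>\<lambda>\<close> and is congruent to \<open>w\<close> modulo
  the span of the finer types; lifting \<open>h\<close> to an idempotent by a polynomial in \<open>h\<close> keeps both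
  properties and the orthogonality to \<open>s\<close>.
\<close>

section \<open>Cycle types and conjugacy\<close>

text \<open>The order of treatment is by the number of tied pairs (\<open>type_rank\<close>), and
  this makes each step work. The image of \<open>w\<close> can be nonzero only at \<lambda> and at
  partitions of smaller rank; the \<open>p\<close>-regular ones among the latter are already
  treated, so \<open>1 - s\<close> has value 0 there. At \<lambda> the value of
  \<open>type_sum n \<lambda>\<close> is \<open>[\<lambda>]!\<close>, the number of ways to permute
  blocks of equal size, and \<open>p\<close>-regularity says that it is nonzero in the field. The
  factor \<open>1 - s\<close> stands on both sides because orthogonality is two-sided, and the two
  products with \<open>s\<close> are finer for different reasons: \<open>w s\<close> by
  triangularity, since \<open>s\<close> has value 0 at \<lambda>; \<open>s w\<close> by a comparison
  of ranks, since left multiplication has no triangular form. Completeness and primitivity rest on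
  one remark: an idempotent with zero image is nilpotent, hence zero. It applies to \<open>1\<close>
  minus the sum of the idempotents and to one summand of any orthogonal decomposition. That distinct
  \<open>p\<close>-regular partitions are not \<open>p\<close>-equivalent is likewise read off from
  the characters.\<close>

lemma finite_perms: "finite (perms n)"
  by (simp add: perms_def finite_permutations)

lemma perms_permutation: "s \<in> perms n \<Longrightarrow> permutation s"
  unfolding perms_def permutation_permutes by auto

lemma perms_in_iff: "s \<in> perms n \<Longrightarrow> s i \<in> {1..n} \<longleftrightarrow> i \<in> {1..n}"
  unfolding perms_def mem_Collect_eq by (rule permutes_in_image)

lemma perms_id: "id \<in> perms n"
  by (simp add: perms_def)

lemma perms_inv: "s \<in> perms n \<Longrightarrow> inv s \<in> perms n"
  by (simp add: perms_def permutes_inv)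

lemma perms_comp: "s \<in> perms n \<Longrightarrow> t \<in> perms n \<Longrightarrow> s \<circ> t \<in> perms n"
  by (simp add: perms_def permutes_compose)

lemma perms_funpow: "s \<in> perms n \<Longrightarrow> s ^^ k \<in> perms n"
  by (induction k) (simp_all add: perms_id perms_comp del: funpow.simps(2) add: funpow_Suc_right)

lemma perms_bij: "s \<in> perms n \<Longrightarrow> bij s"
  by (simp add: perms_def permutes_bij)

lemma perms_inv_apply [simp]:
  "s \<in> perms n \<Longrightarrow> s (inv s i) = i" "s \<in> perms n \<Longrightarrow> inv s (s i) = i"
  by (simp_all add: perms_def permutes_inverses)

lemma perms_inv_inv: "s \<in> perms n \<Longrightarrow> inv (inv s) = s"
  by (simp add: perms_def permutes_inv_inv)

lemma perms_inv_comp: "s \<in> perms n \<Longrightarrow> t \<in> perms n \<Longrightarrow> inv (s \<circ> t) = inv t \<circ> inv s"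
  by (simp add: o_inv_distrib perms_bij)

lemma perms_self_in_orbit: "s \<in> perms n \<Longrightarrow> i \<in> orbit s i"
  by (simp add: permutation_self_in_orbit perms_permutation)

lemma perms_orbit_subset: "s \<in> perms n \<Longrightarrow> i \<in> {1..n} \<Longrightarrow> orbit s i \<subseteq> {1..n}"
  unfolding perms_def mem_Collect_eq by (rule permutes_orbit_subset)

lemma perms_orbit_finite: "s \<in> perms n \<Longrightarrow> finite (orbit s i)"
  by (simp add: finite_orbit perms_self_in_orbit)

lemma perms_orbit_eq:
  assumes "s \<in> perms n" "j \<in> orbit s i" shows "orbit s j = orbit s i"
  by (rule orbit_cyclic_eq3[OF cyclic_on_orbit'[OF perms_permutation[OF assms(1)]] assms(2)])

section \<open>Orbits and fixed points of powers\<close>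

text \<open>\<open>L\<close> is the first return time of \<open>x\<close>; before it the iterates
  are distinct, so it is the size of the orbit. Only \<open>x \<in> orbit s x\<close> is assumed
  because a later use concerns a map that is periodic merely on a finite set.\<close>

lemma funpow_fixes_iff':
  assumes self: "x \<in> orbit s x"
  shows "(s ^^ j) x = x \<longleftrightarrow> card (orbit s x) dvd j"
proof -
  define L where "L = funpow_dist1 s x x"
  have L: "(s ^^ L) x = x" unfolding L_def by (rule funpow_dist1_prop[OF self])
  have inj: "inj_on (\<lambda>n. (s ^^ n) x) {0..<L}" unfolding L_def
    by (rule inj_on_funpow_dist1[OF self])
  have "orbit s x = (\<lambda>n. (s ^^ n) x) ` {0..<L}" unfolding L_def
    by (rule orbit_conv_funpow_dist1[OF self])
  then have card: "card (orbit s x) = L" using card_image[OF inj] by simp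
  have Lpos: "L > 0" by (simp add: L_def)
  have "(s ^^ j) x = x \<longleftrightarrow> (s ^^ (j mod L)) x = (s ^^ 0) x"
    using funpow_mod_eq[OF L] by simp
  also have "\<dots> \<longleftrightarrow> j mod L = 0"
    using inj Lpos by (auto simp: inj_on_def)
  finally show ?thesis using card by (simp add: dvd_eq_mod_eq_0)
qed

lemma funpow_fixes_iff:
  "s \<in> perms n \<Longrightarrow> (s ^^ j) x = x \<longleftrightarrow> card (orbit s x) dvd j"
  by (rule funpow_fixes_iff'[OF perms_self_in_orbit])

lemma disjoint_orbits:
  assumes "s \<in> perms n" "A \<in> orbit s ` S" "B \<in> orbit s ` S" "A \<noteq> B"
  shows "A \<inter> B = {}"
  using assms perms_orbit_eq[OF assms(1)] by blast

lemma Union_orbits: "s \<in> perms n \<Longrightarrow> \<Union> (orbit s ` {1..n}) = {1..n}"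
  using perms_orbit_subset[of s n] perms_self_in_orbit[of s n] by fast

text \<open>On an orbit of length \<open>L\<close> the \<open>j\<close>-th power of \<open>s\<close>
  fixes every point if \<open>L\<close> divides \<open>j\<close> and no point otherwise. Such counts
  pass easily to powers of \<open>s\<close>, without describing how cycles split.\<close>

lemma card_fixpoints_funpow:
  assumes s: "s \<in> perms n"
  shows "card {x \<in> {1..n}. (s ^^ j) x = x} = (\<Sum>L\<in>#cycle_type n s. if L dvd j then L else 0)"
proof -
  let ?F = "\<lambda>A. {x \<in> A. (s ^^ j) x = x}"
  have "{x \<in> {1..n}. (s ^^ j) x = x} = (\<Union>A\<in>orbit s ` {1..n}. ?F A)"
    using Union_orbits[OF s] by blast
  also have "card \<dots> = (\<Sum>A\<in>orbit s ` {1..n}. card (?F A))"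
  proof (rule card_UN_disjoint)
    show "\<forall>A\<in>orbit s ` {1..n}. finite (?F A)" using perms_orbit_finite[OF s] by auto
    show "\<forall>A\<in>orbit s ` {1..n}. \<forall>B\<in>orbit s ` {1..n}. A \<noteq> B \<longrightarrow> ?F A \<inter> ?F B = {}"
      using disjoint_orbits[OF s] by blast
  qed simp
  also have "\<dots> = (\<Sum>A\<in>orbit s ` {1..n}. if card A dvd j then card A else 0)"
  proof (rule sum.cong[OF refl])
    fix A assume "A \<in> orbit s ` {1..n}"
    then obtain i where i: "A = orbit s i" by blast
    have "(s ^^ j) x = x \<longleftrightarrow> card A dvd j" if "x \<in> A" for x
      using funpow_fixes_iff[OF s, of j x] perms_orbit_eq[OF s] that i by simp
    then have "?F A = (if card A dvd j then A else {})" by auto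
    then show "card (?F A) = (if card A dvd j then card A else 0)" by simp
  qed
  also have "\<dots> = (\<Sum>L\<in>#cycle_type n s. if L dvd j then L else 0)"
    by (simp only: cycle_type_def image_mset.compositionality o_def sum_unfold_sum_mset)
  finally show ?thesis .
qed

text \<open>The sum at \<open>j\<close> is \<open>j * count M j\<close> plus terms from proper
  divisors of \<open>j\<close>, so strong induction recovers the counts. An entry 0 would be
  invisible to all these sums.\<close>

lemma multiset_eq_if_divisor_sums_eq:
  fixes M M' :: "nat multiset"
  assumes "0 \<notin># M" "0 \<notin># M'"
    and eq: "\<And>j. j > 0 \<Longrightarrow> (\<Sum>L\<in>#M. if L dvd j then L else 0) = (\<Sum>L\<in>#M'. if L dvd j then L else 0)"
  shows "M = M'"
proof (rule multiset_eqI)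
  fix j
  have expand: "(\<Sum>L\<in>#X. if L dvd j then L else 0) = (\<Sum>L | L dvd j. L * count X L)"
    if "j > 0" for X :: "nat multiset" and j
  proof -
    have fin: "finite {L. L dvd j}" using that by simp
    show ?thesis
    proof (induction X)
      case (add x X)
      have "(\<Sum>L | L dvd j. L * count (add_mset x X) L)
          = (\<Sum>L | L dvd j. L * count X L + (if L = x then x else 0))"
        by (rule sum.cong) auto
      also have "\<dots> = (\<Sum>L | L dvd j. L * count X L) + (if x dvd j then x else 0)"
        using fin by (simp add: sum.distrib sum.delta)
      finally show ?case using add by simp
    qed simp
  qed
  show "count M j = count M' j"
  proof (induction j rule: less_induct)
    case (less j)
    show ?case
    proof (cases "j = 0")
      case True
      then show ?thesis using assms by (simp add: not_in_iff)
    next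
      case False
      then have fin: "finite {L. L dvd j}" by simp
      have split: "(\<Sum>L | L dvd j. L * count X L)
          = j * count X j + (\<Sum>L\<in>{L. L dvd j} - {j}. L * count X L)" for X
        using fin by (subst sum.remove[of _ j]) auto
      have "(\<Sum>L\<in>{L. L dvd j} - {j}. L * count M L) = (\<Sum>L\<in>{L. L dvd j} - {j}. L * count M' L)"
        using less False by (intro sum.cong) (auto dest!: dvd_imp_le)
      then show ?thesis
        using eq[of j] expand[of j] split[of M] split[of M'] False by simp
    qed
  qed
qed

lemma cycle_type_pos: "s \<in> perms n \<Longrightarrow> 0 \<notin># cycle_type n s"
  using perms_self_in_orbit perms_orbit_finite
  by (fastforce simp: cycle_type_def)

lemma cycle_type_eqI:
  assumes "s \<in> perms n" "t \<in> perms n"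
    and "\<And>j. j > 0 \<Longrightarrow> card {x \<in> {1..n}. (s ^^ j) x = x} = card {x \<in> {1..n}. (t ^^ j) x = x}"
  shows "cycle_type n s = cycle_type n t"
  using assms by (intro multiset_eq_if_divisor_sums_eq)
    (simp_all add: cycle_type_pos flip: card_fixpoints_funpow)

lemma sum_mset_cycle_type:
  assumes "s \<in> perms n" shows "\<Sum>\<^sub># (cycle_type n s) = n"
proof -
  \<comment> \<open>For exponent 0 every point is fixed and every length divides, so the count
    formula becomes the total.\<close>
  have "{x \<in> {1..n}. (s ^^ 0) x = x} = {1..n}" by auto
  then show ?thesis using card_fixpoints_funpow[OF assms, of 0] by simp
qed

section \<open>Permutations of equal cycle type are conjugate\<close>

lemma image_mset_eq_imp_bij:
  assumes "finite A" "finite B"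
    and "image_mset f (mset_set A) = image_mset g (mset_set B)"
  obtains h where "bij_betw h A B" "\<And>x. x \<in> A \<Longrightarrow> g (h x) = f x"
proof -
  have cf: "card {x \<in> A. f x = c} = card {x \<in> B. g x = c}" for c
  proof -
    have "count (image_mset f (mset_set A)) c = count (image_mset g (mset_set B)) c"
      using assms by simp
    then show ?thesis using assms(1,2)
      by (simp add: count_image_mset_eq_card_vimage)
  qed
  have "\<exists>h. bij_betw h {x \<in> A. f x = c} {x \<in> B. g x = c}" for c
    using cf assms by (intro finite_same_card_bij) auto
  then obtain H where H: "\<And>c. bij_betw (H c) {x \<in> A. f x = c} {x \<in> B. g x = c}"
    by metis
  define h where "h = (\<lambda>x. H (f x) x)"
  have gh: "g (h x) = f x \<and> h x \<in> B" if "x \<in> A" for x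
    using bij_betwE[OF H[of "f x"]] that by (auto simp: h_def)
  have "bij_betw h A B"
  proof (rule bij_betw_imageI)
    show "inj_on h A"
    proof (rule inj_onI)
      fix x y assume xy: "x \<in> A" "y \<in> A" "h x = h y"
      then have "f x = f y" using gh by metis
      then show "x = y" using xy bij_betw_imp_inj_on[OF H[of "f x"]]
        by (auto simp: h_def inj_on_def)
    qed
    show "h ` A = B"
    proof
      show "h ` A \<subseteq> B" using gh by blast
      show "B \<subseteq> h ` A"
      proof
        fix y assume "y \<in> B"
        then have "y \<in> H (g y) ` {x \<in> A. f x = g y}"
          using bij_betw_imp_surj_on[OF H[of "g y"]] by simp
        then obtain x where "x \<in> A" "f x = g y" "y = H (g y) x" by blast
        then have "y = h x" by (simp add: h_def)
        then show "y \<in> h ` A" using \<open>x \<in> A\<close> by blast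
      qed
    qed
  qed
  then show ?thesis using that gh by blast
qed

lemma orbit_funpowE:
  assumes "s \<in> perms n" "y \<in> orbit s x" obtains k where "y = (s ^^ k) x"
  using assms(2) by (auto simp: orbit_altdef)

text \<open>Orbits are matched by length through \<open>h\<close>, each orbit \<open>A\<close> gets
  a base point \<open>a A\<close>, and \<open>g\<close> sends the \<open>k\<close>-th
  \<open>t\<close>-iterate of a base point to the \<open>k\<close>-th \<open>s\<close>-iterate of
  the base point of the matched orbit.\<close>

lemma conj_in_if_cycle_type_eq:
  assumes s: "s \<in> perms n" and t: "t \<in> perms n" and eq: "cycle_type n s = cycle_type n t"
  shows "conj_in n s t"
proof -
  let ?N = "{1..n}"
  obtain h where h: "bij_betw h (orbit t ` ?N) (orbit s ` ?N)"
    and hc: "\<And>A. A \<in> orbit t ` ?N \<Longrightarrow> card (h A) = card A"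
    using image_mset_eq_imp_bij[of "orbit t ` ?N" "orbit s ` ?N" card card] eq
    by (auto simp: cycle_type_def)
  define a where "a = (\<lambda>A :: nat set. SOME x. x \<in> A)"
  have a_in: "a A \<in> A" if "A \<in> orbit u ` ?N" "u \<in> perms n" for A u
  proof -
    have "\<exists>x. x \<in> A" using that perms_self_in_orbit[of u n] by blast
    then obtain x where "x \<in> A" ..
    then show ?thesis unfolding a_def by (rule someI)
  qed
  have aorb: "orbit u (a A) = A" if "A \<in> orbit u ` ?N" "u \<in> perms n" for A u
    using that a_in[OF that] perms_orbit_eq[of u n] by auto
  define k where "k = (\<lambda>x. SOME k. x = (t ^^ k) (a (orbit t x)))"
  have k: "x = (t ^^ k x) (a (orbit t x))" if "x \<in> ?N" for x
  proof -
    have "x \<in> orbit t (a (orbit t x))"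
      using aorb[of "orbit t x" t] that t perms_self_in_orbit[OF t] by auto
    then show ?thesis unfolding k_def by (metis (mono_tags, lifting) orbit_funpowE[OF t] someI)
  qed
  define g where "g = (\<lambda>x. if x \<in> ?N then (s ^^ k x) (a (h (orbit t x))) else x)"
  have hin: "h (orbit t x) \<in> orbit s ` ?N" if "x \<in> ?N" for x
    using h that by (auto dest: bij_betwE)
  \<comment> \<open>Any exponent reaching \<open>x\<close> may replace the chosen
    \<open>k x\<close>, because matched orbits have equal length. The intertwining property uses the
    exponent \<open>Suc (k x)\<close> for \<open>t x\<close>, which need not be
    \<open>k (t x)\<close>.\<close>
  have g_any: "g x = (s ^^ j) (a (h (orbit t x)))" 
    if x: "x \<in> ?N" and j: "x = (t ^^ j) (a (orbit t x))" for x j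
  proof -
    let ?A = "orbit t x" and ?b = "a (orbit t x)" and ?c = "a (h (orbit t x))"
    have cA: "card (orbit t ?b) = card (orbit s ?c)"
      using aorb[of ?A t] aorb[of "h ?A" s] hin[OF x] hc[of ?A] x s t by simp
    have *: "(u ^^ i) z = (u ^^ (i mod card (orbit u z))) z" if "u \<in> perms n" for u i z
      using funpow_fixes_iff[OF that, of "card (orbit u z)" z] funpow_mod_eq by (metis dvd_refl)
    let ?L = "card (orbit t ?b)"
    have key: "i mod ?L = i' mod ?L" if "(t ^^ i) ?b = (t ^^ i') ?b" "i' \<le> i" for i i'
    proof -
      have "(t ^^ i') ((t ^^ (i - i')) ?b) = (t ^^ i') ?b"
        using that by (metis funpow_add le_add_diff_inverse comp_apply)
      moreover have "inj (t ^^ i')" using perms_bij[OF perms_funpow[OF t]] by (simp add: bij_is_inj)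
      ultimately have "(t ^^ (i - i')) ?b = ?b" by (simp add: inj_eq)
      then have "?L dvd i - i'" using funpow_fixes_iff[OF t] by blast
      then show ?thesis using that(2) by (metis mod_eq_dvd_iff_nat)
    qed
    have "(t ^^ j) ?b = (t ^^ k x) ?b" using j k[OF x] by simp
    then have "j mod ?L = k x mod ?L" using key[of j "k x"] key[of "k x" j] by (metis nat_le_linear)
    then show ?thesis using *[OF s, of j ?c] *[OF s, of "k x" ?c] cA x by (simp add: g_def)
  qed
  have gin: "g x \<in> h (orbit t x)" if "x \<in> ?N" for x
  proof -
    have "(s ^^ i) c \<in> orbit s c" for i c
      using perms_self_in_orbit[OF s] by (simp add: funpow_in_orbit)
    then show ?thesis using aorb[of "h (orbit t x)" s] hin[OF that] s that
      by (auto simp: g_def)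
  qed
  have gN: "g x \<in> ?N" if "x \<in> ?N" for x
    using gin[OF that] hin[OF that] perms_orbit_subset[OF s] by blast
  have inter: "g (t x) = s (g x)" for x
  proof (cases "x \<in> ?N")
    case True
    then have tx: "t x \<in> ?N" using perms_in_iff[OF t] by blast
    have o: "orbit t (t x) = orbit t x"
      by (rule perms_orbit_eq[OF t]) (rule orbit.base)
    have "t x = (t ^^ Suc (k x)) (a (orbit t (t x)))" using k[OF True] o by simp
    from g_any[OF tx this] show ?thesis using o True by (simp add: g_def)
  next
    case False
    then have "t x = x" "s x = x" using s t by (auto simp: perms_def permutes_def)
    then show ?thesis using False by (auto simp: g_def)
  qed
  have inj: "inj_on g ?N"
  proof (rule inj_onI)
    fix x y assume xy: "x \<in> ?N" "y \<in> ?N" "g x = g y"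
    have "h (orbit t x) = h (orbit t y)"
      using gin[OF xy(1)] gin[OF xy(2)] xy(3) hin[OF xy(1)] hin[OF xy(2)]
        disjoint_orbits[OF s] by (metis IntI empty_iff)
    then have o: "orbit t x = orbit t y"
      using h xy by (auto simp: bij_betw_def inj_on_def)
    let ?b = "a (orbit t x)" and ?c = "a (h (orbit t x))"
    have cA: "card (orbit t ?b) = card (orbit s ?c)"
      using aorb[of "orbit t x" t] aorb[of "h (orbit t x)" s] hin hc xy s t by simp
    have e: "(s ^^ k x) ?c = (s ^^ k y) ?c" using xy o by (simp add: g_def)
    have key: "(t ^^ i) ?b = (t ^^ i') ?b" if "(s ^^ i) ?c = (s ^^ i') ?c" "i' \<le> i" for i i'
    proof -
      have "(s ^^ i') ((s ^^ (i - i')) ?c) = (s ^^ i') ?c"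
        using that by (metis funpow_add le_add_diff_inverse comp_apply)
      moreover have "inj (s ^^ i')" using perms_bij[OF perms_funpow[OF s]] by (simp add: bij_is_inj)
      ultimately have "(s ^^ (i - i')) ?c = ?c" by (simp add: inj_eq)
      then have "(t ^^ (i - i')) ?b = ?b" 
        using funpow_fixes_iff[OF t] funpow_fixes_iff[OF s] cA by simp
      then show ?thesis using that(2) by (metis funpow_add le_add_diff_inverse comp_apply)
    qed
    then have "(t ^^ k x) ?b = (t ^^ k y) ?b" using e by (metis nat_le_linear)
    then show "x = y" using k[OF xy(1)] k[OF xy(2)] o by simp
  qed
  have "g permutes ?N"
  proof (rule bij_imp_permutes)
    have "g ` ?N \<subseteq> ?N" using gN by blast
    then have "g ` ?N = ?N" using endo_inj_surj[OF finite_atLeastAtMost _ inj] by blast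
    then show "bij_betw g ?N ?N" using inj by (simp add: bij_betw_def)
  qed (auto simp: g_def)
  then have gp: "g \<in> perms n" by (simp add: perms_def)
  moreover have "t = inv g \<circ> s \<circ> g"
    using inter perms_inv_apply[OF gp] by (metis comp_apply ext)
  ultimately show ?thesis by (auto simp: conj_in_def)
qed

section \<open>Permutations with prescribed orbits\<close>

text \<open>Induction over the points: a new point \<open>x\<close> either is a cycle of its own or
  is inserted directly after some \<open>y\<close> of its fibre.\<close>

lemma ex_permutes_orbits_eq_fibres:
  assumes "finite S"
  shows "\<exists>\<sigma>. \<sigma> permutes S \<and> (\<forall>i\<in>S. orbit \<sigma> i = {j \<in> S. f j = f i})"
  using assms
proof (induction S)
  case empty
  show ?case by (intro exI[of _ id]) (simp add: permutes_def)
next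
  case (insert x S)
  then obtain \<sigma> where s: "\<sigma> permutes S" and o: "\<And>i. i \<in> S \<Longrightarrow> orbit \<sigma> i = {j \<in> S. f j = f i}"
    by blast
  have sx: "\<sigma> x = x" using s insert.hyps by (simp add: permutes_def)
  show ?case
  proof (cases "\<exists>y\<in>S. f y = f x")
    case False
    have "orbit \<sigma> x = {x}" using sx by (simp add: orbit_eq_singleton_iff)
    moreover have "\<sigma> permutes insert x S" using s by (rule permutes_imp_permutes_insert)
    ultimately show ?thesis using o False by (intro exI[of _ \<sigma>]) auto
  next
    case True
    then obtain y where y: "y \<in> S" "f y = f x" by blast
    \<comment> \<open>As \<open>\<sigma> x = x\<close>, this sends \<open>y\<close> to
      \<open>x\<close> and \<open>x\<close> to \<open>\<sigma> y\<close> and agrees with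
      \<open>\<sigma>\<close> elsewhere.\<close>
    define \<tau> where "\<tau> = \<sigma> \<circ> transpose x y"
    have t: "\<tau> permutes insert x S"
      unfolding \<tau>_def using y(1) by (intro permutes_compose permutes_swap_id permutes_imp_permutes_insert[OF s]) auto
    have tp: "permutation \<tau>" using t insert.hyps by (auto simp: permutation_permutes)
    have ty: "\<tau> y = x" and tx: "\<tau> x = \<sigma> y" using sx by (simp_all add: \<tau>_def)
    have tz: "\<tau> z = \<sigma> z" if "z \<noteq> x" "z \<noteq> y" for z
      using that by (simp add: \<tau>_def transpose_def)
    let ?A = "{j \<in> S. f j = f y}"
    have A: "orbit \<sigma> y = ?A" using o[OF y(1)] .
    have sub: "z \<in> orbit \<tau> x" if "z \<in> orbit \<sigma> y" for z
      using that
    proof induction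
      case base
      show ?case using orbit.base[of \<tau> x] tx by simp
    next
      case (step z)
      then have "z \<noteq> x" using A insert.hyps by auto
      then show ?case using step orbit.step[of z \<tau> x] orbit.base[of \<tau> x] tx tz[of z]
        by (cases "z = y") auto
    qed
    have "y \<in> orbit \<tau> x" using sub A y by blast
    then have x: "x \<in> orbit \<tau> x" using orbit.step[of y \<tau> x] ty by simp
    have sub2: "z \<in> insert x ?A" if "z \<in> orbit \<tau> x" for z
      using that
    proof induction
      case base
      show ?case using tx A orbit.base[of \<sigma> y] by auto
    next
      case (step z)
      have "\<sigma> y \<in> ?A" using A orbit.base[of \<sigma> y] by auto
      moreover have "\<sigma> z \<in> ?A" if "z \<in> ?A" using A that orbit.step[of z \<sigma> y] by auto
      ultimately show ?case using step tx ty tz[of z] by (cases "z = x"; cases "z = y") auto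
    qed
    have ox: "orbit \<tau> x = insert x ?A" using sub sub2 A x by blast
    have "orbit \<tau> i = {j \<in> insert x S. f j = f i}" if i: "i \<in> insert x S" for i
    proof (cases "f i = f y")
      case True
      then have "i \<in> orbit \<tau> x" using i ox by auto
      then have "orbit \<tau> i = orbit \<tau> x"
        by (rule orbit_cyclic_eq3[OF cyclic_on_orbit'[OF tp]])
      then show ?thesis using ox True y by auto
    next
      case False
      then have iS: "i \<in> S" using i y by auto
      have "orbit \<tau> i = orbit \<sigma> i"
      proof (rule orbit_cong0[symmetric])
        show "i \<in> {j \<in> S. f j = f i}" using iS by simp
        show "\<sigma> \<in> {j \<in> S. f j = f i} \<rightarrow> {j \<in> S. f j = f i}"
          using o[OF iS] orbit.step[of _ \<sigma> i] by blast
        show "\<And>z. z \<in> {j \<in> S. f j = f i} \<Longrightarrow> \<sigma> z = \<tau> z"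
          using tz False insert.hyps by force
      qed
      then show ?thesis using o[OF iS] False y by auto
    qed
    then show ?thesis using t by blast
  qed
qed

lemma ex_perm_orbits_eq_fibres:
  obtains \<sigma> where "\<sigma> \<in> perms n" "\<And>i. i \<in> {1..n} \<Longrightarrow> orbit \<sigma> i = {j \<in> {1..n}. f j = f i}"
  using ex_permutes_orbits_eq_fibres[of "{1..n}" f] unfolding perms_def by auto

section \<open>Fixed points modulo \<open>p\<close>, and the \<open>p'\<close>-part of a
  permutation\<close>

text \<open>Orbits of non-fixed points have length dividing \<open>p\<close> but different from 1,
  hence equal to \<open>p\<close>.\<close>

lemma card_mod_eq_card_fixpoints_prime:
  assumes "prime p" "finite X" and fX: "\<And>x. x \<in> X \<Longrightarrow> f x \<in> X"
    and per: "\<And>x. x \<in> X \<Longrightarrow> (f ^^ p) x = x"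
  shows "card X mod p = card {x \<in> X. f x = x} mod p"
proof -
  let ?Y = "{x \<in> X. f x \<noteq> x}"
  have p0: "p > 0" using assms(1) by (simp add: prime_gt_0_nat)
  have self: "x \<in> orbit f x" if "x \<in> X" for x
    using per[OF that] p0 unfolding orbit_altdef by force
  have oe: "orbit f y = orbit f x" if "x \<in> X" "y \<in> orbit f x" for x y
  proof (rule orbit_cyclic_eq3[OF _ that(2)])
    show "cyclic_on f (orbit f x)" using self[OF that(1)] by (auto simp: cyclic_on_def)
  qed
  have oX: "y \<in> X" if "x \<in> X" "y \<in> orbit f x" for x y
    using that(2,1) by induction (auto intro: fX)
  have oY: "orbit f x \<subseteq> ?Y" if "x \<in> ?Y" for x
  proof
    fix y assume y: "y \<in> orbit f x"
    have "f y \<noteq> y"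
    proof
      assume "f y = y"
      then have "orbit f y = {y}" by (simp add: orbit_eq_singleton_iff)
      then have "orbit f x = {y}" using oe[of x y] y that by auto
      then have "orbit f x = {x}" using self that by fastforce
      then show False using that by (simp add: orbit_eq_singleton_iff)
    qed
    then show "y \<in> ?Y" using oX[of x y] y that by simp
  qed
  have "p dvd card (\<Union> (orbit f ` ?Y))"
  proof (rule dvd_partition)
    show "finite (\<Union> (orbit f ` ?Y))"
      by (rule finite_subset[of _ X]) (use oY assms in blast)+
    show "\<forall>c\<in>orbit f ` ?Y. p dvd card c"
    proof
      fix c assume "c \<in> orbit f ` ?Y"
      then obtain x where x: "x \<in> ?Y" "c = orbit f x" by blast
      have "card (orbit f x) dvd p"
        using funpow_fixes_iff'[OF self, of x p] per x by simp
      moreover have "card (orbit f x) \<noteq> 1"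
        using funpow_fixes_iff'[OF self, of x 1] x by auto
      ultimately show "p dvd card c" using assms(1) x prime_nat_iff by auto
    qed
    show "\<forall>c1\<in>orbit f ` ?Y. \<forall>c2\<in>orbit f ` ?Y. c1 \<noteq> c2 \<longrightarrow> c1 \<inter> c2 = {}"
    proof (intro ballI impI)
      fix c1 c2 assume c: "c1 \<in> orbit f ` ?Y" "c2 \<in> orbit f ` ?Y" "c1 \<noteq> c2"
      then obtain x y where xy: "x \<in> X" "y \<in> X" "c1 = orbit f x" "c2 = orbit f y" by auto
      have "c1 = c2" if "z \<in> c1 \<inter> c2" for z
        using oe[OF xy(1), of z] oe[OF xy(2), of z] that xy by simp
      then show "c1 \<inter> c2 = {}" using c(3) by auto
    qed
  qed
  moreover have "\<Union> (orbit f ` ?Y) = ?Y" using oY self by blast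
  moreover have "card X = card {x \<in> X. f x = x} + card ?Y"
  proof -
    have "X = {x \<in> X. f x = x} \<union> ?Y" by blast
    then have "card X = card ({x \<in> X. f x = x} \<union> ?Y)" by simp
    also have "\<dots> = card {x \<in> X. f x = x} + card ?Y"
      using assms by (intro card_Un_disjoint) auto
    finally show ?thesis .
  qed
  ultimately show ?thesis by (auto elim!: dvdE)
qed

text \<open>Induction on \<open>a\<close>: the \<open>p\<close>-th power of
  \<open>f ^^ (p ^ a)\<close> is the identity on \<open>X\<close>, and on the fixed points of
  \<open>f ^^ (p ^ a)\<close> the induction hypothesis applies to \<open>f\<close>.\<close>

lemma card_mod_eq_card_fixpoints_prime_power:
  assumes "prime p" "finite X" "\<And>x. x \<in> X \<Longrightarrow> f x \<in> X"
    and "\<And>x. x \<in> X \<Longrightarrow> (f ^^ (p ^ a)) x = x"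
  shows "card X mod p = card {x \<in> X. f x = x} mod p"
  using assms(2-)
proof (induction a arbitrary: X)
  case 0
  then have "{x \<in> X. f x = x} = X" by auto
  then show ?case by simp
next
  case (Suc a)
  let ?g = "f ^^ (p ^ a)" and ?Y = "{x \<in> X. (f ^^ (p ^ a)) x = x}"
  have gX: "(f ^^ k) x \<in> X" if "x \<in> X" for x k
    using that Suc.prems(2) by (induction k) auto
  have "card X mod p = card ?Y mod p"
  proof (rule card_mod_eq_card_fixpoints_prime[OF assms(1) Suc.prems(1)])
    show "?g x \<in> X" if "x \<in> X" for x using gX that by blast
    show "(?g ^^ p) x = x" if "x \<in> X" for x
      using Suc.prems(3)[OF that] by (simp add: funpow_mult mult.commute)
  qed
  also have "\<dots> = card {x \<in> ?Y. f x = x} mod p"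
  proof (rule Suc.IH)
    show "f x \<in> ?Y" if "x \<in> ?Y" for x
      using that Suc.prems(2) by (simp add: funpow_swap1[symmetric])
  qed (use Suc.prems in auto)
  also have "{x \<in> ?Y. f x = x} = {x \<in> X. f x = x}"
  proof -
    have "(f ^^ k) x = x" if "f x = x" for x k using that by (induction k) auto
    then show ?thesis by blast
  qed
  finally show ?case .
qed

text \<open>Writing \<open>n! = p\<^sup>A m\<close> with \<open>m\<close> prime to \<open>p\<close>, the exponent is \<open>0\<close> modulo \<open>p\<^sup>A\<close> and \<open>1\<close> modulo
  \<open>m\<close>, so that one and the same power gives the \<open>p'\<close>-part of every permutation.\<close>
definition p'_exponent :: "nat \<Rightarrow> nat \<Rightarrow> nat" where
  "p'_exponent p n = (SOME K. \<exists>A m. coprime m p \<and> m > 0 \<and> fact n = p ^ A * m \<and> p ^ A dvd K \<and>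
     (\<exists>y. K = m * y + 1))"

lemma p'_exponentE:
  assumes "prime p"
  obtains A m y where "coprime m p" "m > 0" "fact n = p ^ A * m" "p ^ A dvd p'_exponent p n"
    "p'_exponent p n = m * y + 1"
proof -
  obtain m where m: "(fact n :: nat) = p ^ multiplicity p (fact n) * m" "\<not> p dvd m"
    using multiplicity_decompose'[of "fact n" p] assms by (metis fact_nonzero not_prime_unit)
  let ?A = "multiplicity p (fact n)"
  have cop: "coprime m p" using prime_imp_coprime[OF assms m(2)] by (rule coprime_commute[THEN iffD1])
  have p0: "p ^ ?A \<noteq> 0" using assms by (simp add: prime_gt_0_nat)
  obtain x y where "p ^ ?A * x = m * y + gcd (p ^ ?A) m"
    using bezout_nat[OF p0, of m] by blast
  moreover have "gcd (p ^ ?A) m = 1" using cop by (simp add: coprime_commute)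
  ultimately have "p ^ ?A * x = m * y + 1" by simp
  then have "\<exists>K A m. coprime m p \<and> m > 0 \<and> fact n = p ^ A * m \<and> p ^ A dvd K \<and> (\<exists>y. K = m * y + 1)"
    using m(1) cop p0 by (metis dvd_triv_left fact_nonzero mult_0_right neq0_conv)
  from someI_ex[OF this] show ?thesis using that unfolding p'_exponent_def by blast
qed

lemma perms_funpow_fact: "s \<in> perms n \<Longrightarrow> fact n dvd j \<Longrightarrow> s ^^ j = id"
proof
  fix x assume s: "s \<in> perms n" and j: "fact n dvd j"
  have "card (orbit s x) dvd j"
  proof (cases "x \<in> {1..n}")
    case True
    have "card (orbit s x) \<le> n" using card_mono[OF _ perms_orbit_subset[OF s True]] by simp
    moreover have "card (orbit s x) \<ge> 1"
      using perms_orbit_finite[OF s] perms_self_in_orbit[OF s] by (metis One_nat_def Suc_leI card_gt_0_iff empty_iff)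
    ultimately show ?thesis using j by (meson dvd_fact dvd_trans)
  next
    case False
    then have "s x = x" using s by (simp add: perms_def permutes_def)
    then have "orbit s x = {x}" by (simp add: orbit_eq_singleton_iff)
    then show ?thesis by simp
  qed
  then show "(s ^^ j) x = id x" using funpow_fixes_iff[OF s] by simp
qed

lemma perms_funpow_cong:
  assumes "s \<in> perms n" "fact n dvd c" shows "s ^^ (i + c) = s ^^ i"
  using perms_funpow_fact[OF assms] by (simp add: funpow_add)

text \<open>Turns the condition in \<open>p'_part\<close> that the quotient of \<open>s\<close> by
  \<open>t\<close> has \<open>p\<close>-power order into an equality of powers.\<close>

lemma comp_inv_funpow_eq_id_iff:
  assumes t: "t \<in> perms n" and comm: "s \<circ> t = t \<circ> s"
  shows "(s \<circ> inv t) ^^ j = id \<longleftrightarrow> s ^^ j = t ^^ j"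
proof -
  have it: "inv t \<circ> t = id" "t \<circ> inv t = id" using t by (auto simp: fun_eq_iff)
  have c2: "(t ^^ j) \<circ> s = s \<circ> (t ^^ j)" for j
    by (induction j) (simp_all add: fun_eq_iff, metis comm comp_apply)
  have "(s \<circ> inv t) ^^ j \<circ> t ^^ j = s ^^ j" for j
  proof (induction j)
    case (Suc j)
    have "(s \<circ> inv t) ^^ Suc j \<circ> t ^^ Suc j = (s \<circ> inv t) ^^ j \<circ> (s \<circ> (inv t \<circ> t) \<circ> t ^^ j)"
      by (simp add: funpow_Suc_right[of j "s \<circ> inv t"] comp_assoc del: funpow.simps(2))
        (simp add: comp_assoc)
    also have "\<dots> = (s \<circ> inv t) ^^ j \<circ> t ^^ j \<circ> s" using it c2 by (simp add: comp_assoc)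
    also have "\<dots> = s ^^ Suc j" using Suc by (simp only: funpow_Suc_right)
    finally show ?case .
  qed simp
  then have e: "((s \<circ> inv t) ^^ j) ((t ^^ j) z) = (s ^^ j) z" for z by (metis comp_apply)
  have surj: "surj (t ^^ j)" using perms_bij[OF perms_funpow[OF t]] by (rule bij_is_surj)
  show ?thesis
  proof
    assume "(s \<circ> inv t) ^^ j = id"
    then show "s ^^ j = t ^^ j" using e by (simp add: fun_eq_iff)
  next
    assume "s ^^ j = t ^^ j"
    then have "((s \<circ> inv t) ^^ j) ((t ^^ j) z) = (t ^^ j) z" for z using e by simp
    then show "(s \<circ> inv t) ^^ j = id" using surj by (metis ext id_apply surjD)
  qed
qed

text \<open>The exponent minus 1 is a multiple of \<open>m\<close>, so its product with
  \<open>p ^ B\<close> is a multiple of \<open>fact n\<close>, and such powers are trivial.\<close>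

lemma funpow_p'_exponent_power:
  assumes p: "prime p" and s: "s \<in> perms n"
  obtains A where "\<And>B. B \<ge> A \<Longrightarrow> (s ^^ p'_exponent p n) ^^ (p ^ B) = s ^^ (p ^ B)"
proof -
  let ?K = "p'_exponent p n"
  obtain A m y where Am: "fact n = p ^ A * m" and K: "?K = m * y + 1"
    by (rule p'_exponentE[OF p])
  have "(s ^^ ?K) ^^ (p ^ B) = s ^^ (p ^ B)" if "B \<ge> A" for B
  proof -
    have "?K * p ^ B = p ^ B + p ^ B * m * y" using K by (simp add: algebra_simps)
    moreover have "fact n dvd p ^ B * m * y" using Am that by (simp add: le_imp_power_dvd mult_dvd_mono dvd_mult2)
    ultimately show ?thesis using perms_funpow_cong[OF s] by (simp add: funpow_mult mult.commute)
  qed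
  then show ?thesis by (rule that)
qed

lemma p'_part_eq_funpow:
  assumes p: "prime p" and s: "s \<in> perms n"
  shows "p'_part p s = s ^^ p'_exponent p n"
proof -
  let ?K = "p'_exponent p n"
  obtain A' m where Am: "coprime m p" "m > 0" "fact n = p ^ A' * m" "p ^ A' dvd ?K"
    by (rule p'_exponentE[OF p])
  let ?u = "s ^^ ?K"
  have u_m: "?u ^^ m = id"
    using perms_funpow_fact[OF s, of "?K * m"] Am by (simp add: funpow_mult mult_dvd_mono mult.commute)
  obtain A where u_p: "\<And>B. B \<ge> A \<Longrightarrow> ?u ^^ (p ^ B) = s ^^ (p ^ B)"
    using funpow_p'_exponent_power[OF p s] by blast
  have comm: "s \<circ> s ^^ k = s ^^ k \<circ> s" for k by (metis funpow.simps(2) funpow_Suc_right)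
  show ?thesis unfolding p'_part_def
  proof (rule the_equality)
    have "(s \<circ> inv ?u) ^^ (p ^ A) = id"
      using comp_inv_funpow_eq_id_iff[OF perms_funpow[OF s] comm] u_p by simp
    then show "(\<exists>k. ?u = s ^^ k) \<and> (\<exists>m>0. coprime m p \<and> ?u ^^ m = id) \<and> (\<exists>a. (s \<circ> inv ?u) ^^ (p ^ a) = id)"
      using u_m Am(1,2) by blast
  next
    fix t assume "(\<exists>k. t = s ^^ k) \<and> (\<exists>m>0. coprime m p \<and> t ^^ m = id) \<and> (\<exists>a. (s \<circ> inv t) ^^ (p ^ a) = id)"
    then obtain k m' a where t: "t = s ^^ k" and m': "m' > 0" "coprime m' p" "t ^^ m' = id"
      and a: "(s \<circ> inv t) ^^ (p ^ a) = id" by blast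
    have "s ^^ (p ^ a) = t ^^ (p ^ a)"
      using a comp_inv_funpow_eq_id_iff[OF perms_funpow[OF s] comm] t by simp
    then have "(s ^^ (p ^ a)) ^^ (p ^ A) = (t ^^ (p ^ a)) ^^ (p ^ A)" by simp
    then have tu: "t ^^ (p ^ (a + A)) = ?u ^^ (p ^ (a + A))"
      using u_p[of "a + A"] by (simp add: funpow_mult power_add mult.commute)
    have cop: "gcd (p ^ (a + A)) (m * m') = 1" using Am(1) m'(2) by (simp add: coprime_commute)
    have "p ^ (a + A) \<noteq> 0" using p by (simp add: prime_gt_0_nat)
    from bezout_nat[OF this, of "m * m'"] cop obtain x z where xz: "p ^ (a + A) * x = m * m' * z + 1"
      by auto
    \<comment> \<open>\<open>p ^ (a + A) * x\<close> is 1 modulo both \<open>m\<close> and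
      \<open>m'\<close>, so raising to the power \<open>x\<close> undoes raising to
      \<open>p ^ (a + A)\<close>, for \<open>t\<close> as well as for \<open>?u\<close>. Their
      powers agree, hence so do they.\<close>
    have idn: "(f ^^ (p ^ (a + A))) ^^ x = f" if "f ^^ m = id \<or> f ^^ m' = id" for f :: "nat \<Rightarrow> nat"
    proof -
      have "f ^^ (m * m' * z) = id"
        using that by (metis funpow_mult id_funpow mult.assoc mult.commute)
      then show ?thesis using xz by (simp add: funpow_mult mult.commute)
    qed
    show "t = ?u" using idn[of t] idn[of ?u] tu m'(3) u_m by metis
  qed
qed

text \<open>\<open>i\<close> and \<open>p * i\<close> differ only in the power of \<open>p\<close>.
  The \<open>p\<close>-part of \<open>p * i\<close> divides \<open>fact n\<close>, because
  \<open>p * i \<le> n\<close>, and hence divides the exponent anyway.\<close>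

lemma dvd_p'_exponent_mult_iff:
  assumes p: "prime p" and "i > 0" "p * i \<le> n"
  shows "p * i dvd p'_exponent p n * j \<longleftrightarrow> i dvd p'_exponent p n * j"
proof
  let ?K = "p'_exponent p n"
  obtain A m y where Am: "coprime m p" "fact n = p ^ A * m" "p ^ A dvd ?K"
    by (rule p'_exponentE[OF p])
  show "p * i dvd ?K * j" if dvd: "i dvd ?K * j"
  proof -
    obtain i' where i': "i = p ^ multiplicity p i * i'" "\<not> p dvd i'"
      using multiplicity_decompose'[of i p] assms by (metis less_irrefl not_prime_unit)
    let ?a = "Suc (multiplicity p i)"
    have pi: "p * i = p ^ ?a * i'" using i' by simp
    have "p * i dvd fact n" using assms by (intro dvd_fact) (auto simp: prime_gt_0_nat Suc_leI)
    then have "p ^ ?a dvd p ^ A * m" using pi Am(2) by (metis dvd_mult_left)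
    moreover have "coprime (p ^ ?a) m" using Am(1) by (simp add: coprime_commute)
    ultimately have "p ^ ?a dvd p ^ A" using coprime_dvd_mult_left_iff by blast
    then have "p ^ ?a dvd ?K * j" using Am(3) by (meson dvd_mult2 dvd_trans)
    moreover have "i' dvd ?K * j" using dvd i' by (metis dvd_mult_right)
    moreover have "coprime (p ^ ?a) i'" using i'(2) p by (simp add: prime_imp_coprime)
    ultimately show ?thesis using pi divides_mult by metis
  qed
qed (rule dvd_mult_right)

text \<open>Merging \<open>p\<close> equal cycles into one does not change the \<open>p'\<close>-part up to conjugacy.\<close>
lemma ex_p_regular_multiset:
  assumes p: "prime p"
  shows "0 \<notin># M \<Longrightarrow> \<Sum>\<^sub># M = n \<Longrightarrow> \<exists>M'. 0 \<notin># M' \<and> \<Sum>\<^sub># M' = n \<and> (\<forall>i. count M' i < p) \<and>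
    (\<forall>j. (\<Sum>L\<in>#M. if L dvd p'_exponent p n * j then L else 0) =
         (\<Sum>L\<in>#M'. if L dvd p'_exponent p n * j then L else 0))"
proof (induction "size M" arbitrary: M rule: less_induct)
  case less
  show ?case
  proof (cases "\<forall>i. count M i < p")
    case True
    then show ?thesis using less.prems by blast
  next
    case False
    then obtain i where "p \<le> count M i" by (auto simp: not_less)
    then have "replicate_mset p i \<subseteq># M" by (simp add: count_le_replicate_mset_subset_eq)
    then obtain M0 where M: "M = replicate_mset p i + M0" by (auto simp: subset_mset.le_iff_add)
    define M1 where "M1 = add_mset (p * i) M0"
    have p2: "p \<ge> 2" using p by (rule prime_ge_2_nat)
    then have "i \<in># M" by (simp add: M)
    then have i0: "i > 0" using less.prems by (metis gr0I)
    have size: "size M1 < size M" using p2 by (simp add: M M1_def)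
    have "0 \<notin># M1" using less.prems i0 p2 by (auto simp: M M1_def)
    moreover have s1: "\<Sum>\<^sub># M1 = n" using less.prems(2) by (simp add: M M1_def sum_mset_replicate_mset)
    ultimately have "\<exists>M'. 0 \<notin># M' \<and> \<Sum>\<^sub># M' = n \<and> (\<forall>i. count M' i < p) \<and>
      (\<forall>j. (\<Sum>L\<in>#M1. if L dvd p'_exponent p n * j then L else 0) =
           (\<Sum>L\<in>#M'. if L dvd p'_exponent p n * j then L else 0))"
      using less.hyps[OF size] by blast
    moreover have "p * i \<le> n" using s1 by (auto simp: M1_def)
    then have "(\<Sum>L\<in>#M1. if L dvd p'_exponent p n * j then L else 0)
      = (\<Sum>L\<in>#M. if L dvd p'_exponent p n * j then L else 0)" for j
      using dvd_p'_exponent_mult_iff[OF p i0, of n j] by (simp add: M M1_def sum_mset_replicate_mset)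
    ultimately show ?thesis by simp
  qed
qed

section \<open>Set compositions as total preorders\<close>

text \<open>Set compositions of \<open>{1..n}\<close> are encoded as total preorders. A relation is stored on all of
  \<open>nat\<close>, but is required to hold outside \<open>{1..n}\<close>, so that the full relation is the one-block set
  composition. The product of set compositions is the lexicographic product of relations, which is
  associative on arbitrary relations; it is written additively so that
  \<open>lexrel \<Rightarrow>\<^sub>0 'a\<close> becomes its monoid algebra.\<close>

datatype lexrel = Lex (le: "nat \<Rightarrow> nat \<Rightarrow> bool")

instantiation lexrel :: monoid_add
begin
definition "0 = Lex (\<lambda>_ _. True)"
definition "a + b = Lex (\<lambda>i j. le a i j \<and> (le a j i \<longrightarrow> le b i j))"
instance
  by standard (auto simp: zero_lexrel_def plus_lexrel_def lexrel.expand fun_eq_iff)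
end

lemma le_zero [simp]: "le 0 i j"
  by (simp add: zero_lexrel_def)

lemma le_plus [simp]: "le (a + b) i j \<longleftrightarrow> le a i j \<and> (le a j i \<longrightarrow> le b i j)"
  by (simp add: plus_lexrel_def)

lemma lexrel_eqI: "(\<And>i j. le a i j \<longleftrightarrow> le b i j) \<Longrightarrow> a = b"
  by (simp add: lexrel.expand fun_eq_iff)

definition rank_rel :: "nat \<Rightarrow> (nat \<Rightarrow> nat) \<Rightarrow> lexrel" where
  "rank_rel n f = Lex (\<lambda>i j. i \<in> {1..n} \<and> j \<in> {1..n} \<longrightarrow> f i \<le> f j)"

definition set_comps :: "nat \<Rightarrow> lexrel set" where
  "set_comps n = range (rank_rel n)"

definition sim :: "nat \<Rightarrow> lexrel \<Rightarrow> (nat \<times> nat) set" where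
  "sim n k = {(i, j). i \<in> {1..n} \<and> j \<in> {1..n} \<and> le k i j \<and> le k j i}"

definition act :: "(nat \<Rightarrow> nat) \<Rightarrow> lexrel \<Rightarrow> lexrel" where
  "act g k = Lex (\<lambda>i j. le k (inv g i) (inv g j))"

lemma le_rank_rel [simp]: "le (rank_rel n f) i j \<longleftrightarrow> (i \<in> {1..n} \<and> j \<in> {1..n} \<longrightarrow> f i \<le> f j)"
  by (simp add: rank_rel_def)

lemma le_act [simp]: "le (act g k) i j \<longleftrightarrow> le k (inv g i) (inv g j)"
  by (simp add: act_def)

lemma rank_rel_in_set_comps [simp]: "rank_rel n f \<in> set_comps n"
  by (simp add: set_comps_def)

lemma set_compsE:
  assumes "k \<in> set_comps n" obtains f where "k = rank_rel n f"
  using assms by (auto simp: set_comps_def)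

lemma rank_rel_cong: "(\<And>i. i \<in> {1..n} \<Longrightarrow> f i = g i) \<Longrightarrow> rank_rel n f = rank_rel n g"
  by (rule lexrel_eqI) auto

lemma rank_rel_eq_iff:
  "rank_rel n f = rank_rel n g \<longleftrightarrow> (\<forall>i\<in>{1..n}. \<forall>j\<in>{1..n}. f i \<le> f j \<longleftrightarrow> g i \<le> g j)"
proof
  assume "rank_rel n f = rank_rel n g"
  then have "\<And>i j. le (rank_rel n f) i j = le (rank_rel n g) i j" by simp
  then show "\<forall>i\<in>{1..n}. \<forall>j\<in>{1..n}. f i \<le> f j \<longleftrightarrow> g i \<le> g j" by (simp only: le_rank_rel) blast
qed (auto intro!: lexrel_eqI)

lemma sim_rank_rel: "sim n (rank_rel n f) = {(i, j). i \<in> {1..n} \<and> j \<in> {1..n} \<and> f i = f j}"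
  by (auto simp: sim_def)

lemma sim_subset: "sim n k \<subseteq> {1..n} \<times> {1..n}"
  by (auto simp: sim_def)

lemma finite_sim [simp]: "finite (sim n k)"
  by (rule finite_subset[OF sim_subset]) simp

lemma card_sim_le: "card (sim n k) \<le> n * n"
  using card_mono[OF _ sim_subset, of n k] by (simp add: card_cartesian_product)

lemma sim_plus: "sim n (a + b) = sim n a \<inter> sim n b"
  by (auto simp: sim_def)

lemma zero_in_set_comps [simp]: "0 \<in> set_comps n"
proof -
  have "rank_rel n (\<lambda>_. 0) = 0" by (rule lexrel_eqI) simp
  then show ?thesis using rank_rel_in_set_comps[of n "\<lambda>_. 0"] by simp
qed

lemma plus_in_set_comps:
  assumes "a \<in> set_comps n" "b \<in> set_comps n" shows "a + b \<in> set_comps n"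
proof -
  obtain f g where fg: "a = rank_rel n f" "b = rank_rel n g" using assms by (metis set_compsE)
  \<comment> \<open>\<open>M\<close> exceeds all values of \<open>g\<close>, so
    \<open>f i * M + g i\<close> encodes the pair of ranks lexicographically as one number.\<close>
  define M where "M = Suc (\<Sum>i\<in>{1..n}. g i)"
  have M: "g i < M" if "i \<in> {1..n}" for i
    unfolding M_def using member_le_sum[OF that, of g] by auto
  have "a + b = rank_rel n (\<lambda>i. f i * M + g i)"
  proof (rule lexrel_eqI)
    fix i j
    show "le (a + b) i j = le (rank_rel n (\<lambda>i. f i * M + g i)) i j"
    proof (cases "i \<in> {1..n} \<and> j \<in> {1..n}")
      case True
      then have gM: "g i < M" "g j < M" using M by auto
      have "f i * M + g i < f j * M + g j" if "f i < f j"
      proof -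
        have "Suc (f i) * M \<le> f j * M" using that by (intro mult_le_mono1) simp
        then show ?thesis using gM by simp
      qed
      moreover have "f j * M + g j < f i * M + g i" if "f j < f i"
      proof -
        have "Suc (f j) * M \<le> f i * M" using that by (intro mult_le_mono1) simp
        then show ?thesis using gM by simp
      qed
      ultimately show ?thesis using True fg by (cases "f i" "f j" rule: linorder_cases) auto
    qed (auto simp: fg)
  qed
  then show ?thesis by simp
qed

lemma finite_set_comps [simp]: "finite (set_comps n)"
proof (rule finite_subset)
  let ?L = "\<lambda>R. Lex (\<lambda>i j. i \<in> {1..n} \<and> j \<in> {1..n} \<longrightarrow> (i, j) \<in> R)"
  show "set_comps n \<subseteq> ?L ` Pow ({1..n} \<times> {1..n})"
  proof
    fix k assume "k \<in> set_comps n"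
    then obtain f where "k = rank_rel n f" by (rule set_compsE)
    then have "k = ?L {(i, j). i \<in> {1..n} \<and> j \<in> {1..n} \<and> f i \<le> f j}"
      by (intro lexrel_eqI) auto
    then show "k \<in> ?L ` Pow ({1..n} \<times> {1..n})" by blast
  qed
qed simp

lemma plus_absorb:
  assumes "a \<in> set_comps n" "b \<in> set_comps n" "sim n a \<subseteq> sim n b"
  shows "a + b = a"
proof (rule lexrel_eqI)
  fix i j
  have "le b i j" if "le a i j" "le a j i"
  proof (cases "i \<in> {1..n} \<and> j \<in> {1..n}")
    case True
    then have "(i, j) \<in> sim n a" using that by (simp add: sim_def)
    then show ?thesis using assms(3) by (auto simp: sim_def)
  next
    case False
    then show ?thesis using assms(2) by (auto elim: set_compsE)
  qed
  then show "le (a + b) i j = le a i j" by auto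
qed

section \<open>The action of permutations on set compositions\<close>

lemma act_comp: "g \<in> perms n \<Longrightarrow> h \<in> perms n \<Longrightarrow> act (g \<circ> h) k = act g (act h k)"
  by (rule lexrel_eqI) (simp add: perms_inv_comp)

lemma act_id [simp]: "act id k = k"
  by (rule lexrel_eqI) simp

lemma act_inv [simp]:
  assumes "g \<in> perms n" shows "act (inv g) (act g k) = k" "act g (act (inv g) k) = k"
  using assms by (auto intro!: lexrel_eqI simp: perms_inv_inv)

lemma act_plus: "act g (a + b) = act g a + act g b"
  by (rule lexrel_eqI) simp

lemma act_rank_rel: "g \<in> perms n \<Longrightarrow> act g (rank_rel n f) = rank_rel n (f \<circ> inv g)"
  using perms_in_iff[OF perms_inv, of g n] by (intro lexrel_eqI) (simp only: le_act le_rank_rel o_apply)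

lemma act_in_set_comps: "g \<in> perms n \<Longrightarrow> k \<in> set_comps n \<Longrightarrow> act g k \<in> set_comps n"
  by (elim set_compsE) (simp add: act_rank_rel)

lemma act_inj: "g \<in> perms n \<Longrightarrow> act g a = act g b \<longleftrightarrow> a = b"
  by (metis act_inv(1))

lemma bij_betw_act_set_comps: "g \<in> perms n \<Longrightarrow> bij_betw (act g) (set_comps n) (set_comps n)"
  by (rule bij_betw_byWitness[of _ "act (inv g)"]) (auto simp: act_in_set_comps perms_inv)

lemma sim_act: "g \<in> perms n \<Longrightarrow> (i, j) \<in> sim n (act g k) \<longleftrightarrow> (inv g i, inv g j) \<in> sim n k"
  using perms_in_iff[OF perms_inv, of g n] by (simp add: sim_def del: atLeastAtMost_iff)

lemma card_sim_act:
  assumes g: "g \<in> perms n" shows "card (sim n (act g k)) = card (sim n k)"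
proof (rule bij_betw_same_card)
  show "bij_betw (map_prod (inv g) (inv g)) (sim n (act g k)) (sim n k)"
  proof (rule bij_betw_byWitness[of _ "map_prod g g"])
    show "map_prod (inv g) (inv g) ` sim n (act g k) \<subseteq> sim n k"
      by (auto simp: sim_act[OF g])
    show "map_prod g g ` sim n k \<subseteq> sim n (act g k)"
      by (auto simp: sim_act[OF g] perms_inv_apply[OF g])
  qed (auto simp: perms_inv_apply[OF g])
qed

abbreviation vals :: "nat \<Rightarrow> (nat \<Rightarrow> 'b) \<Rightarrow> 'b multiset" where
  "vals n f \<equiv> image_mset f (mset_set {1..n})"

text \<open>A weakly increasing function lists its own values in sorted order.\<close>

lemma mono_image_mset_unique:
  fixes f g :: "nat \<Rightarrow> nat"
  assumes "mono_on {1..n} f" "mono_on {1..n} g"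
    and "vals n f = vals n g"
    and "i \<in> {1..n}"
  shows "f i = g i"
proof -
  have srt: "sorted (map h [1..<Suc n])" if "mono_on {1..n} h" for h :: "nat \<Rightarrow> nat"
    unfolding sorted_map
    by (rule sorted_wrt_mono_rel[OF _ sorted_upt]) (use that in \<open>auto simp: mono_on_def\<close>)
  have ms: "mset (map h [1..<Suc n]) = vals n h" for h :: "nat \<Rightarrow> nat"
    by (simp only: mset_map mset_upt atLeastLessThanSuc_atLeastAtMost)
  have "map f [1..<Suc n] = map g [1..<Suc n]"
    using srt[OF assms(1)] srt[OF assms(2)] ms[of f] ms[of g] assms(3)
    by (metis properties_for_sort)
  then show ?thesis using assms(4) by (auto simp: map_eq_conv simp del: upt_Suc)
qed

lemma ex_sorting_perm:
  fixes f :: "nat \<Rightarrow> nat"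
  obtains h where "h \<in> perms n" "mono_on {1..n} (f \<circ> h)"
proof -
  define xs where "xs = sort (map f [1..<Suc n])"
  define F where "F = (\<lambda>i. xs ! (i - 1))"
  have len: "length xs = n" by (simp add: xs_def)
  have "mono_on {1..n} F"
    by (rule mono_onI) (auto simp: F_def xs_def intro!: sorted_nth_mono)
  have "map F [1..<Suc n] = xs"
    by (rule nth_equalityI) (auto simp: F_def len simp del: upt_Suc)
  then have "vals n F = mset xs"
    by (metis atLeastLessThanSuc_atLeastAtMost mset_map mset_upt)
  also have "\<dots> = vals n f"
    unfolding xs_def mset_sort by (simp only: mset_map mset_upt atLeastLessThanSuc_atLeastAtMost)
  finally obtain h where h: "h permutes {1..n}" "\<forall>x\<in>{1..n}. F x = f (h x)"
    using image_mset_eq_implies_permutes[of "{1..n}" F f] by auto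
  have "mono_on {1..n} (f \<circ> h)"
    using \<open>mono_on {1..n} F\<close> h(2) by (auto simp: mono_on_def)
  then show ?thesis using that h(1) by (simp add: perms_def)
qed

lemma image_mset_comp_perm:
  assumes "g \<in> perms n"
  shows "vals n (f \<circ> g) = vals n f"
  using permutes_image_mset[of g "{1..n}"] assms
  by (simp add: perms_def flip: image_mset.compositionality)

text \<open>One permutation sorts both rankings, since they induce the same preorder; sorted
  rankings with the same multiset of values coincide.\<close>

lemma rank_rel_inj:
  assumes eq: "rank_rel n f = rank_rel n g"
    and ms: "vals n f = vals n g"
    and i: "i \<in> {1..n}"
  shows "f i = g i"
proof -
  obtain h where h: "h \<in> perms n" "mono_on {1..n} (f \<circ> h)" by (rule ex_sorting_perm)
  have "mono_on {1..n} (g \<circ> h)"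
  proof (rule mono_onI)
    fix r s assume rs: "r \<in> {1..n}" "s \<in> {1..n}" "r \<le> s"
    then have "f (h r) \<le> f (h s)" using h(2) by (auto simp: mono_on_def)
    then show "(g \<circ> h) r \<le> (g \<circ> h) s"
      using eq perms_in_iff[OF h(1)] rs unfolding rank_rel_eq_iff by simp
  qed
  moreover have "vals n (f \<circ> h) = vals n (g \<circ> h)"
    using ms h(1) by (simp only: image_mset_comp_perm)
  moreover have "inv h i \<in> {1..n}" using i perms_in_iff[OF perms_inv[OF h(1)]] by blast
  ultimately have "(f \<circ> h) (inv h i) = (g \<circ> h) (inv h i)"
    using mono_image_mset_unique[OF h(2)] by blast
  then show ?thesis using h(1) by simp
qed

text \<open>Since blocks are ordered, a permutation fixing \<open>k\<close> cannot exchange blocks: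
  \<open>f\<close> and \<open>f \<circ> inv s\<close> induce the same preorder and have the same
  multiset of values, so they agree on \<open>{1..n}\<close>.\<close>

lemma act_fixes_iff:
  assumes s: "s \<in> perms n" and k: "k \<in> set_comps n"
  shows "act s k = k \<longleftrightarrow> (\<forall>i\<in>{1..n}. (i, s i) \<in> sim n k)"
proof -
  obtain f where f: "k = rank_rel n f" using k by (rule set_compsE)
  have iff: "(i, s i) \<in> sim n k \<longleftrightarrow> f i = f (s i)" if "i \<in> {1..n}" for i
    using that perms_in_iff[OF s, of i] unfolding f sim_rank_rel by auto
  show ?thesis
  proof
    assume "act s k = k"
    then have "rank_rel n (f \<circ> inv s) = rank_rel n f" using s f by (simp add: act_rank_rel)
    then have "(f \<circ> inv s) i = f i" if "i \<in> {1..n}" for i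
      using image_mset_comp_perm[OF perms_inv[OF s]] that by (rule rank_rel_inj)
    then have "f i = f (s i)" if "i \<in> {1..n}" for i
      using that s perms_in_iff[OF s, of i] by (metis comp_apply perms_inv_apply(2))
    then show "\<forall>i\<in>{1..n}. (i, s i) \<in> sim n k" using iff by simp
  next
    assume *: "\<forall>i\<in>{1..n}. (i, s i) \<in> sim n k"
    have "(f \<circ> inv s) i = f i" if "i \<in> {1..n}" for i
    proof -
      have "inv s i \<in> {1..n}" using perms_in_iff[OF perms_inv[OF s], of i] that by blast
      then show ?thesis using * iff[of "inv s i"] perms_inv_apply(1)[OF s, of i] by (metis comp_apply)
    qed
    then have "rank_rel n (f \<circ> inv s) = rank_rel n f" by (rule rank_rel_cong)
    then show "act s k = k" using s f by (simp add: act_rank_rel)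
  qed
qed

section \<open>Compositions and types\<close>

lemma finite_psums [simp]: "finite (psums q)"
  by (simp add: psums_def)

lemma psums_snoc: "psums (q @ [x]) = insert (sum_list q + x) (psums q)"
proof -
  have "psums (q @ [x]) = (\<lambda>j. sum_list (take j (q @ [x]))) ` {1..Suc (length q)}"
    by (auto simp: psums_def)
  also have "{1..Suc (length q)} = insert (Suc (length q)) {1..length q}" by auto
  also have "(\<lambda>j. sum_list (take j (q @ [x]))) ` \<dots>
      = insert (sum_list q + x) ((\<lambda>j. sum_list (take j (q @ [x]))) ` {1..length q})"
    by simp
  also have "(\<lambda>j. sum_list (take j (q @ [x]))) ` {1..length q} = psums q"
    by (auto simp: psums_def)
  finally show ?thesis .
qed

lemma finite_comps [simp]: "finite (comps n)"
proof (rule finite_subset)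
  show "comps n \<subseteq> {q. set q \<subseteq> {..n} \<and> length q \<le> n}"
  proof
    fix q assume q: "q \<in> comps n"
    have "length q \<le> sum_list q" if "\<forall>x\<in>set q. 0 < x" for q :: "nat list"
      using that by (induction q) auto
    then show "q \<in> {q. set q \<subseteq> {..n} \<and> length q \<le> n}"
      using q member_le_sum_list by (fastforce simp: comps_def)
  qed
qed (simp add: finite_lists_length_le)

lemma sum_list_take_strict_mono:
  assumes "q \<in> comps n" "i < j" "j \<le> length q"
  shows "sum_list (take i q) < sum_list (take j q)"
proof -
  have "sum_list (take i q) < sum_list (take (Suc i) q)"
    using assms by (auto simp: take_Suc_conv_app_nth comps_def)
  also have "take j q = take (Suc i) q @ take (j - Suc i) (drop (Suc i) q)"
    using assms by (metis Suc_leI le_add_diff_inverse take_add)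
  then have "sum_list (take (Suc i) q) \<le> sum_list (take j q)" by simp
  finally show ?thesis .
qed

lemma sum_list_take_mono:
  "q \<in> comps n \<Longrightarrow> i \<le> j \<Longrightarrow> j \<le> length q \<Longrightarrow> sum_list (take i q) \<le> sum_list (take j q)"
  using sum_list_take_strict_mono[of q n i j] by (cases "i = j") auto

text \<open>Blocks are numbered from \<open>0\<close>.\<close>
definition block :: "nat list \<Rightarrow> nat \<Rightarrow> nat" where
  "block q i = card {x \<in> psums q. x < i}"

lemma block_mono: "i \<le> j \<Longrightarrow> block q i \<le> block q j"
  unfolding block_def by (rule card_mono) auto

lemma block_Suc_eq_iff: "block q (Suc i) = block q i \<longleftrightarrow> i \<notin> psums q"
proof -
  have "{x \<in> psums q. x < Suc i} = {x \<in> psums q. x < i} \<union> (if i \<in> psums q then {i} else {})"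
    by (auto simp: less_Suc_eq)
  then show ?thesis by (simp add: block_def)
qed

lemma block_eqI:
  assumes q: "q \<in> comps n" and j: "j < length q"
    and i: "sum_list (take j q) < i" "i \<le> sum_list (take (Suc j) q)"
  shows "block q i = j"
proof -
  have "{x \<in> psums q. x < i} = (\<lambda>l. sum_list (take l q)) ` {1..j}"
  proof (intro equalityI subsetI)
    fix x assume "x \<in> {x \<in> psums q. x < i}"
    then obtain l where l: "x = sum_list (take l q)" "1 \<le> l" "l \<le> length q" "x < i"
      by (auto simp: psums_def)
    have "l \<le> j"
    proof (rule ccontr)
      assume "\<not> l \<le> j"
      then have "sum_list (take (Suc j) q) \<le> x" using sum_list_take_mono[OF q, of "Suc j" l] l by simp
      then show False using l i by simp
    qed
    then show "x \<in> (\<lambda>l. sum_list (take l q)) ` {1..j}" using l by auto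
  next
    fix x assume "x \<in> (\<lambda>l. sum_list (take l q)) ` {1..j}"
    then obtain l where l: "x = sum_list (take l q)" "1 \<le> l" "l \<le> j" by auto
    then have "x \<le> sum_list (take j q)" using sum_list_take_mono[OF q] j by simp
    then show "x \<in> {x \<in> psums q. x < i}" using l j i by (auto simp: psums_def)
  qed
  moreover have "inj_on (\<lambda>l. sum_list (take l q)) {1..j}"
    using sum_list_take_strict_mono[OF q] j
    by (intro linorder_inj_onI) (auto simp: less_le)
  ultimately show ?thesis by (simp add: block_def card_image)
qed

lemma ex_block:
  assumes q: "q \<in> comps n" and i: "i \<in> {1..n}"
  obtains j where "j < length q" "sum_list (take j q) < i" "i \<le> sum_list (take (Suc j) q)"
proof -
  define j where "j = (LEAST j. i \<le> sum_list (take j q))"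
  have ex: "i \<le> sum_list (take (length q) q)" using q i by (simp add: comps_def)
  have j: "i \<le> sum_list (take j q)" unfolding j_def by (rule LeastI[of _ "length q"]) (rule ex)
  have jl: "j \<le> length q" unfolding j_def by (rule Least_le) (rule ex)
  have j0: "j \<noteq> 0" using j i by (metis atLeastAtMost_iff not_one_le_zero le_zero_eq take0 list.size(1) sum_list.Nil take_0)
  then obtain j' where j': "j = Suc j'" by (cases j) auto
  have "\<not> i \<le> sum_list (take j' q)" using not_less_Least[of j' "\<lambda>j. i \<le> sum_list (take j q)"] j' j_def by simp
  then show ?thesis using that[of j'] j j' jl by simp
qed

lemma block_less_length: "q \<in> comps n \<Longrightarrow> i \<in> {1..n} \<Longrightarrow> block q i < length q"
  by (metis ex_block block_eqI)

lemma block_fibre: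
  assumes q: "q \<in> comps n" and j: "j < length q"
  shows "{i \<in> {1..n}. block q i = j} = {sum_list (take j q) + 1 .. sum_list (take (Suc j) q)}"
proof (intro equalityI subsetI)
  fix i assume i: "i \<in> {i \<in> {1..n}. block q i = j}"
  then have "i \<in> {1..n}" by simp
  then obtain l where l: "l < length q" "sum_list (take l q) < i" "i \<le> sum_list (take (Suc l) q)"
    by (rule ex_block[OF q])
  then have "l = j" using block_eqI[OF q l] i by simp
  then show "i \<in> {sum_list (take j q) + 1 .. sum_list (take (Suc j) q)}" using l by simp
next
  fix i assume i: "i \<in> {sum_list (take j q) + 1 .. sum_list (take (Suc j) q)}"
  have "sum_list (take (Suc j) q) \<le> sum_list (take (length q) q)"
    by (rule sum_list_take_mono[OF q]) (use j in auto)
  then have "i \<le> n" using i q by (simp add: comps_def)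
  then show "i \<in> {i \<in> {1..n}. block q i = j}" using i block_eqI[OF q j, of i] by simp
qed

lemma card_block_fibre:
  assumes "q \<in> comps n" "j < length q"
  shows "card {i \<in> {1..n}. block q i = j} = q ! j"
  unfolding block_fibre[OF assms] using assms(2) by (simp add: take_Suc_conv_app_nth)

lemma block_surj:
  assumes q: "q \<in> comps n" and j: "j < length q"
  obtains i where "i \<in> {1..n}" "block q i = j"
proof -
  have "card {i \<in> {1..n}. block q i = j} > 0"
    using card_block_fibre[OF q j] q j by (simp add: comps_def)
  then show ?thesis using that by (auto simp: card_gt_0_iff)
qed

lemma block_image: "q \<in> comps n \<Longrightarrow> block q ` {1..n} = {..<length q}"
  using block_less_length block_surj by (metis (no_types, lifting) equalityI image_subsetI image_eqI lessThan_iff subsetI)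

lemma psums_subset: "q \<in> comps n \<Longrightarrow> psums q \<subseteq> {1..n}"
proof
  fix x assume q: "q \<in> comps n" and "x \<in> psums q"
  then obtain j where j: "x = sum_list (take j q)" "1 \<le> j" "j \<le> length q" by (auto simp: psums_def)
  then have "sum_list (take 0 q) < x" using sum_list_take_strict_mono[OF q, of 0 j] by simp
  moreover have "x \<le> sum_list (take (length q) q)" using sum_list_take_mono[OF q, of j "length q"] j by simp
  ultimately show "x \<in> {1..n}" using q by (simp add: comps_def)
qed

lemma n_in_psums:
  assumes "q \<in> comps n" "n \<ge> 1" shows "n \<in> psums q"
proof -
  have "n = sum_list (take (length q) q)" "length q \<ge> 1" using assms by (cases q; auto simp: comps_def)+
  then show ?thesis unfolding psums_def by blast
qed

lemma block_eq_imp_comp_eq: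
  assumes q: "q \<in> comps n" and r: "r \<in> comps n"
    and eq: "\<And>i. i \<in> {1..n} \<Longrightarrow> block q i = block r i"
  shows "q = r"
proof (rule nth_equalityI)
  have "block q ` {1..n} = block r ` {1..n}" using eq by (intro image_cong) auto
  then show len: "length q = length r" using block_image[OF q] block_image[OF r] by simp
  fix j assume "j < length q"
  then have "q ! j = card {i \<in> {1..n}. block q i = j}" "r ! j = card {i \<in> {1..n}. block r i = j}"
    using card_block_fibre[OF q] card_block_fibre[OF r] len by simp_all
  moreover have "{i \<in> {1..n}. block q i = j} = {i \<in> {1..n}. block r i = j}" using eq by auto
  ultimately show "q ! j = r ! j" by simp
qed

text \<open>The last part is the gap between \<open>n\<close> and the largest other element
  \<open>m\<close> of \<open>D\<close>; the remaining parts form a composition of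
  \<open>m\<close>.\<close>

lemma ex_comp_psums_eq:
  "n \<ge> 1 \<Longrightarrow> n \<in> D \<Longrightarrow> D \<subseteq> {1..n} \<Longrightarrow> \<exists>q\<in>comps n. psums q = D"
proof (induction n arbitrary: D rule: less_induct)
  case (less n)
  show ?case
  proof (cases "D = {n}")
    case True
    have "psums [n] = {n}" using psums_snoc[of "[]" n] by (simp add: psums_def)
    then show ?thesis using True less.prems by (intro bexI[of _ "[n]"]) (auto simp: comps_def)
  next
    case False
    define m where "m = Max (D - {n})"
    have fin: "finite (D - {n})" using less.prems(3) finite_subset by blast
    have m: "m \<in> D - {n}" unfolding m_def using False less.prems by (intro Max_in[OF fin]) auto
    have mle: "x \<le> m" if "x \<in> D - {n}" for x unfolding m_def using that by (rule Max_ge[OF fin])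
    have "m < n" "m \<ge> 1" using m less.prems by (force simp: le_less)+
    moreover have "D - {n} \<subseteq> {1..m}"
    proof
      fix x assume x: "x \<in> D - {n}"
      then have "x \<in> {1..n}" using less.prems(3) by blast
      then show "x \<in> {1..m}" using mle[OF x] by simp
    qed
    ultimately obtain q where q: "q \<in> comps m" "psums q = D - {n}"
      using less.IH[of m "D - {n}"] m by blast
    have "psums (q @ [n - m]) = insert n (D - {n})"
      using psums_snoc[of q "n - m"] q \<open>m < n\<close> by (simp add: comps_def)
    also have "\<dots> = D" using less.prems by auto
    finally show ?thesis using q \<open>m < n\<close> by (intro bexI[of _ "q @ [n - m]"]) (auto simp: comps_def)
  qed
qed

section \<open>Set compositions of a given type\<close>

text \<open>For a composition \<open>q\<close> of \<open>n\<close> the blocks are consecutive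
  intervals whose lengths are the parts of \<open>q\<close>, and the stabilizer is the Young
  subgroup.\<close>

definition std_rel :: "nat \<Rightarrow> nat list \<Rightarrow> lexrel" where
  "std_rel n q = rank_rel n (block q)"

text \<open>The set compositions whose block sizes are, in order, the parts of \<open>q\<close>.\<close>
definition of_type :: "nat \<Rightarrow> nat list \<Rightarrow> lexrel set" where
  "of_type n q = {rank_rel n f | f.
     vals n f = vals n (block q)}"

lemma of_typeE:
  assumes "k \<in> of_type n q"
  obtains f where "k = rank_rel n f" "vals n f = vals n (block q)"
  using assms by (auto simp: of_type_def)

lemma of_type_subset: "of_type n q \<subseteq> set_comps n"
  by (auto simp: of_type_def)

lemma finite_of_type [simp]: "finite (of_type n q)"
  by (rule finite_subset[OF of_type_subset]) simp

lemma std_rel_in_set_comps [simp]: "std_rel n q \<in> set_comps n"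
  by (simp add: std_rel_def)

text \<open>Rankings with equal multisets of values differ by a permutation of the points. Types are
  thus the orbits of the symmetric group, which is why the sums over types span the
  invariants.\<close>

lemma of_type_eq_orbit: "of_type n q = (\<lambda>g. act g (std_rel n q)) ` perms n"
proof (intro equalityI subsetI)
  fix k assume "k \<in> of_type n q"
  then obtain f where f: "k = rank_rel n f" "vals n f = vals n (block q)"
    by (rule of_typeE)
  then obtain h where h: "h permutes {1..n}" "\<forall>x\<in>{1..n}. f x = block q (h x)"
    using image_mset_eq_implies_permutes[of "{1..n}" f "block q"] by auto
  then have hp: "h \<in> perms n" by (simp add: perms_def)
  have "k = rank_rel n (block q \<circ> h)" unfolding f(1) by (rule rank_rel_cong) (use h in simp)
  also have "\<dots> = act (inv h) (std_rel n q)"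
    using hp by (simp add: std_rel_def act_rank_rel perms_inv perms_inv_inv)
  finally show "k \<in> (\<lambda>g. act g (std_rel n q)) ` perms n" using perms_inv[OF hp] by blast
next
  fix k assume "k \<in> (\<lambda>g. act g (std_rel n q)) ` perms n"
  then obtain g where g: "g \<in> perms n" "k = act g (std_rel n q)" by blast
  then have "k = rank_rel n (block q \<circ> inv g)" by (simp add: std_rel_def act_rank_rel)
  then show "k \<in> of_type n q" unfolding of_type_def
    using image_mset_comp_perm[OF perms_inv[OF g(1)]] by blast
qed

lemma std_rel_in_of_type [simp]: "std_rel n q \<in> of_type n q"
  by (auto simp: of_type_def std_rel_def)

lemma act_in_of_type: "g \<in> perms n \<Longrightarrow> k \<in> of_type n q \<Longrightarrow> act g k \<in> of_type n q"
  unfolding of_type_eq_orbit using act_comp perms_comp by (auto simp flip: act_comp)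

lemma of_type_monotone:
  assumes "k \<in> of_type n q" and mono: "\<And>i j. i \<le> j \<Longrightarrow> i \<in> {1..n} \<Longrightarrow> j \<in> {1..n} \<Longrightarrow> le k i j"
  shows "k = std_rel n q"
proof -
  obtain f where f: "k = rank_rel n f" "vals n f = vals n (block q)"
    using assms(1) by (rule of_typeE)
  have "mono_on {1..n} f" using mono by (intro mono_onI) (simp add: f)
  moreover have "mono_on {1..n} (block q)" by (intro mono_onI) (simp add: block_mono)
  ultimately have "f i = block q i" if "i \<in> {1..n}" for i
    using mono_image_mset_unique f(2) that by blast
  then show ?thesis unfolding f(1) std_rel_def by (rule rank_rel_cong)
qed

lemma le_std_rel: "i \<le> j \<Longrightarrow> le (std_rel n q) i j"
  by (simp add: std_rel_def block_mono)

lemma mono_eq_iff_steps_eq: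
  fixes F :: "nat \<Rightarrow> nat"
  assumes "mono_on {1..n} F" "i \<in> {1..n}" "j \<in> {1..n}" "j \<le> i"
  shows "F i \<le> F j \<longleftrightarrow> (\<forall>x. j \<le> x \<and> x < i \<longrightarrow> F (Suc x) = F x)"
proof
  assume le: "F i \<le> F j"
  show "\<forall>x. j \<le> x \<and> x < i \<longrightarrow> F (Suc x) = F x"
  proof (intro allI impI)
    fix x assume x: "j \<le> x \<and> x < i"
    have "F j \<le> F x" "F x \<le> F (Suc x)" "F (Suc x) \<le> F i"
      using x assms by (auto intro!: mono_onD[OF assms(1)])
    then show "F (Suc x) = F x" using le by simp
  qed
next
  assume *: "\<forall>x. j \<le> x \<and> x < i \<longrightarrow> F (Suc x) = F x"
  have "F (j + d) = F j" if "j + d \<le> i" for d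
    using that * by (induction d) auto
  from this[of "i - j"] show "F i \<le> F j" using assms by simp
qed

lemma mono_rank_rel_eqI:
  fixes F G :: "nat \<Rightarrow> nat"
  assumes F: "mono_on {1..n} F" and G: "mono_on {1..n} G"
    and steps: "\<And>x. 1 \<le> x \<Longrightarrow> x < n \<Longrightarrow> F (Suc x) = F x \<longleftrightarrow> G (Suc x) = G x"
  shows "rank_rel n F = rank_rel n G"
  unfolding rank_rel_eq_iff
proof (intro ballI)
  fix i j assume ij: "i \<in> {1..n}" "j \<in> {1..n}"
  show "F i \<le> F j \<longleftrightarrow> G i \<le> G j"
  proof (cases "i \<le> j")
    case True
    then show ?thesis using ij F G by (auto simp: mono_on_def)
  next
    case False
    then have ji: "j \<le> i" by simp
    show ?thesis unfolding mono_eq_iff_steps_eq[OF F ij ji] mono_eq_iff_steps_eq[OF G ij ji]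
      using ij steps by (metis atLeastAtMost_iff le_trans less_le_trans)
  qed
qed

lemma ex_type_of_set_comp:
  assumes "n \<ge> 1" "k \<in> set_comps n"
  obtains q where "q \<in> comps n" "k \<in> of_type n q"
proof -
  obtain f where f: "k = rank_rel n f" using assms(2) by (rule set_compsE)
  obtain h where h: "h \<in> perms n" "mono_on {1..n} (f \<circ> h)" by (rule ex_sorting_perm)
  \<comment> \<open>The positions where the sorted ranking jumps; \<open>n\<close> is added because
    the partial sums of a composition include the total.\<close>
  define D where "D = insert n {x. 1 \<le> x \<and> x < n \<and> f (h (Suc x)) \<noteq> f (h x)}"
  obtain q where q: "q \<in> comps n" "psums q = D"
    using ex_comp_psums_eq[of n D] assms(1) by (force simp: D_def)
  have "rank_rel n (f \<circ> h) = rank_rel n (block q)"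
  proof (rule mono_rank_rel_eqI[OF h(2)])
    show "mono_on {1..n} (block q)" by (intro mono_onI) (simp add: block_mono)
    fix x assume "1 \<le> x" "x < n"
    then show "(f \<circ> h) (Suc x) = (f \<circ> h) x \<longleftrightarrow> block q (Suc x) = block q x"
      unfolding block_Suc_eq_iff q D_def by auto
  qed
  then have "act h (rank_rel n (f \<circ> h)) = act h (std_rel n q)" by (simp add: std_rel_def)
  moreover have "act h (rank_rel n (f \<circ> h)) = k"
    using h(1) f by (simp add: act_rank_rel o_def)
  ultimately have "k \<in> of_type n q" using h(1) unfolding of_type_eq_orbit by blast
  then show ?thesis using that q by blast
qed

lemma of_type_disjoint:
  assumes q: "q \<in> comps n" and r: "r \<in> comps n" and "std_rel n r \<in> of_type n q"
  shows "r = q"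
proof -
  have eq: "std_rel n r = std_rel n q"
    using assms(3) by (rule of_type_monotone) (rule le_std_rel)
  have "i \<in> psums r \<longleftrightarrow> i \<in> psums q" if "i \<in> {1..n}" for i
  proof (cases "i = n")
    case True
    then show ?thesis using n_in_psums[OF q] n_in_psums[OF r] that by auto
  next
    case False
    then have i: "i \<in> {1..n}" "Suc i \<in> {1..n}" using that by auto
    have "block r (Suc i) \<le> block r i \<longleftrightarrow> block q (Suc i) \<le> block q i"
      using eq i unfolding std_rel_def rank_rel_eq_iff by blast
    then have "block r (Suc i) = block r i \<longleftrightarrow> block q (Suc i) = block q i"
      using block_mono[of i "Suc i"] by (metis le_antisym le_SucI order_refl)
    then show ?thesis unfolding block_Suc_eq_iff by blast
  qed
  then have "psums r = psums q" using psums_subset[OF q] psums_subset[OF r] by blast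
  then show ?thesis by (intro block_eq_imp_comp_eq[OF r q]) (simp add: block_def)
qed

lemma of_type_unique:
  assumes "q \<in> comps n" "r \<in> comps n" "k \<in> of_type n q" "k \<in> of_type n r"
  shows "q = r"
proof -
  obtain g where g: "g \<in> perms n" "k = act g (std_rel n r)" using assms(4) by (auto simp: of_type_eq_orbit)
  then have "std_rel n r = act (inv g) k" by simp
  then have "std_rel n r \<in> of_type n q" using act_in_of_type[OF perms_inv[OF g(1)] assms(3)] by simp
  then show ?thesis using of_type_disjoint assms by blast
qed

lemma act_in_of_type_iff:
  assumes "g \<in> perms n" shows "act g k \<in> of_type n q \<longleftrightarrow> k \<in> of_type n q"
  using act_in_of_type[OF assms] act_in_of_type[OF perms_inv[OF assms]] act_inv[OF assms] by metis

lemma count_block: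
  assumes "q \<in> comps n"
  shows "count (vals n (block q)) j = (if j < length q then q ! j else 0)"
proof -
  have "count (vals n (block q)) j = card {i \<in> {1..n}. block q i = j}"
    by (simp only: count_image_mset_eq_card_vimage finite_atLeastAtMost)
  moreover have "{i \<in> {1..n}. block q i = j} = {}" if "\<not> j < length q"
    using that block_less_length[OF assms] by blast
  ultimately show ?thesis using card_block_fibre[OF assms] by (metis card.empty)
qed

lemma of_type_rankE:
  assumes q: "q \<in> comps n" and "k \<in> of_type n q"
  obtains f where "k = rank_rel n f" "\<And>i. i \<in> {1..n} \<Longrightarrow> f i < length q"
    "\<And>j. j < length q \<Longrightarrow> card {i \<in> {1..n}. f i = j} = q ! j"
proof -
  obtain f where f: "k = rank_rel n f" "vals n f = vals n (block q)"
    using assms(2) by (rule of_typeE)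
  have c: "card {i \<in> {1..n}. f i = j} = (if j < length q then q ! j else 0)" for j
  proof -
    have "card {i \<in> {1..n}. f i = j} = count (vals n f) j"
      by (simp only: count_image_mset_eq_card_vimage finite_atLeastAtMost)
    then show ?thesis unfolding f(2) count_block[OF q] .
  qed
  have "f i < length q" if i: "i \<in> {1..n}" for i
  proof (rule ccontr)
    assume "\<not> f i < length q"
    then have "card {j \<in> {1..n}. f j = f i} = 0" using c by simp
    moreover have "finite {j \<in> {1..n}. f j = f i}" by simp
    ultimately have "{j \<in> {1..n}. f j = f i} = {}" using card_0_eq by blast
    then show False using i by blast
  qed
  then show ?thesis using that f(1) c by simp
qed

lemma image_mset_eq_blockI:
  assumes q: "q \<in> comps n" and less: "\<And>i. i \<in> {1..n} \<Longrightarrow> f i < length q"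
    and card: "\<And>j. j < length q \<Longrightarrow> card {i \<in> {1..n}. f i = j} = q ! j"
  shows "vals n f = vals n (block q)"
proof (rule multiset_eqI)
  fix j
  have "count (vals n f) j = card {i \<in> {1..n}. f i = j}"
    by (simp only: count_image_mset_eq_card_vimage finite_atLeastAtMost)
  also have "\<dots> = (if j < length q then q ! j else 0)"
  proof (cases "j < length q")
    case False
    then have "{i \<in> {1..n}. f i = j} = {}" using less by blast
    then show ?thesis using False by (metis card.empty)
  qed (use card in simp)
  finally show "count (vals n f) j = count (vals n (block q)) j"
    unfolding count_block[OF q] .
qed

section \<open>Block sizes, tied pairs and refinement\<close>

text \<open>Built like \<open>cycle_type\<close>, with classes of \<open>R\<close> in place of
  orbits, so that the order of the blocks is forgotten and the two multisets can be
  compared.\<close>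

definition class_sizes :: "nat \<Rightarrow> (nat \<times> nat) set \<Rightarrow> nat multiset" where
  "class_sizes n R = image_mset card (mset_set ((\<lambda>i. {j \<in> {1..n}. (i, j) \<in> R}) ` {1..n}))"

lemma mset_conv_image_nth: "mset q = image_mset ((!) q) (mset_set {..<length q})"
  by (metis atLeast0LessThan map_nth mset_map mset_upt)

lemma class_sizes_sim:
  assumes q: "q \<in> comps n" and k: "k \<in> of_type n q"
  shows "class_sizes n (sim n k) = mset q"
proof -
  obtain f where f: "k = rank_rel n f" "\<And>i. i \<in> {1..n} \<Longrightarrow> f i < length q"
    "\<And>j. j < length q \<Longrightarrow> card {i \<in> {1..n}. f i = j} = q ! j" by (rule of_type_rankE[OF assms]) blast
  define F where "F = (\<lambda>j. {i \<in> {1..n}. f i = j})"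
  have cF: "card (F j) = q ! j" if "j < length q" for j using f(3)[OF that] by (simp add: F_def)
  have ne: "\<exists>i\<in>{1..n}. f i = j" if "j < length q" for j
  proof -
    have "card (F j) > 0" using cF[OF that] q that by (simp add: comps_def)
    then have "F j \<noteq> {}" by force
    then show ?thesis by (auto simp: F_def)
  qed
  have "inj_on F {..<length q}"
  proof (rule inj_onI)
    fix a b assume ab: "a \<in> {..<length q}" "F a = F b"
    then obtain i where i: "i \<in> {1..n}" "f i = a" using ne by blast
    then have "i \<in> F a" by (simp add: F_def)
    then have "i \<in> F b" using ab by simp
    then show "a = b" using i by (simp add: F_def)
  qed
  moreover have "(\<lambda>i. {j \<in> {1..n}. (i, j) \<in> sim n k}) ` {1..n} = F ` {..<length q}"
  proof -
    have "(\<lambda>i. {j \<in> {1..n}. (i, j) \<in> sim n k}) ` {1..n} = (\<lambda>i. F (f i)) ` {1..n}"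
      by (intro image_cong) (auto simp: f(1) sim_rank_rel F_def)
    also have "\<dots> = F ` f ` {1..n}" by (simp add: image_image)
    also have "f ` {1..n} = {..<length q}"
    proof
      show "f ` {1..n} \<subseteq> {..<length q}" using f(2) by blast
      show "{..<length q} \<subseteq> f ` {1..n}" using ne by blast
    qed
    finally show ?thesis .
  qed
  ultimately have "class_sizes n (sim n k) = image_mset card (image_mset F (mset_set {..<length q}))"
    by (simp add: class_sizes_def image_mset_mset_set)
  also have "\<dots> = image_mset ((!) q) (mset_set {..<length q})"
    unfolding image_mset.compositionality by (intro image_mset_cong) (simp add: cF)
  finally show ?thesis by (simp add: mset_conv_image_nth)
qed

text \<open>A block of size \<open>x\<close> contributes \<open>x * x\<close> tied pairs. The number
  ignores the order of the parts and drops when the blocks become strictly finer.\<close>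

lemma card_sim_of_type:
  assumes q: "q \<in> comps n" and k: "k \<in> of_type n q"
  shows "card (sim n k) = (\<Sum>x\<in>#mset q. x * x)"
proof -
  obtain f where f: "k = rank_rel n f" "\<And>i. i \<in> {1..n} \<Longrightarrow> f i < length q"
    "\<And>j. j < length q \<Longrightarrow> card {i \<in> {1..n}. f i = j} = q ! j" by (rule of_type_rankE[OF assms]) blast
  define F where "F = (\<lambda>j. {i \<in> {1..n}. f i = j})"
  have "sim n k = (\<Union>j\<in>{..<length q}. F j \<times> F j)"
  proof (intro equalityI subsetI)
    fix x assume "x \<in> sim n k"
    then obtain i j where "x = (i, j)" "i \<in> {1..n}" "j \<in> {1..n}" "f i = f j"
      unfolding f(1) sim_rank_rel by blast
    then show "x \<in> (\<Union>j\<in>{..<length q}. F j \<times> F j)" using f(2)[of i]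
      by (intro UN_I[of "f i"]) (auto simp: F_def)
  qed (auto simp: f(1) sim_rank_rel F_def)
  also have "card \<dots> = (\<Sum>j\<in>{..<length q}. card (F j \<times> F j))"
    by (rule card_UN_disjoint) (auto simp: F_def)
  also have "\<dots> = (\<Sum>j\<in>{..<length q}. q ! j * q ! j)"
    using f(3) by (intro sum.cong) (simp_all add: card_cartesian_product F_def)
  also have "\<dots> = (\<Sum>x\<in>#mset q. x * x)"
    by (subst mset_conv_image_nth) (simp only: image_mset.compositionality o_def sum_unfold_sum_mset)
  finally show ?thesis .
qed

lemma mset_eq_if_sim_eq:
  assumes "q \<in> comps n" "r \<in> comps n" "k \<in> of_type n q" "k' \<in> of_type n r" "sim n k = sim n k'"
  shows "mset q = mset r"
  using assms class_sizes_sim by metis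

lemma mset_concat_filter_upt:
  assumes "\<And>c. c < m \<Longrightarrow> h c < (l::nat)"
  shows "mset (concat (map (\<lambda>j. map g (filter (\<lambda>c. h c = j) [0..<m])) [0..<l])) = mset (map g [0..<m])"
proof -
  have "mset (concat (map (\<lambda>j. map g (filter (\<lambda>c. h c = j) xs)) [0..<l])) = mset (map g xs)"
    if "\<And>c. c \<in> set xs \<Longrightarrow> h c < l" for xs
    using that
  proof (induction xs)
    case Nil
    show ?case by (induction l) auto
  next
    case (Cons a xs)
    have *: "mset (concat (map (\<lambda>j. map g (filter (\<lambda>c. h c = j) (a # xs))) [0..<i]))
       = mset (concat (map (\<lambda>j. map g (filter (\<lambda>c. h c = j) xs)) [0..<i])) + (if h a < i then {#g a#} else {#})" for i
      by (induction i) (auto simp: less_Suc_eq)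
    show ?case using *[of l] Cons by simp
  qed
  from this[of "[0..<m]"] show ?thesis using assms by simp
qed

text \<open>The block sizes of \<open>k\<close>, listed group by group according to the block of
  \<open>k'\<close> that contains them, form a rearrangement of \<open>q\<close> that strongly
  refines \<open>l\<close>. The types are not rearrangements of each other because the number of
  tied pairs differs.\<close>

lemma strict_weak_refines_if_sim_psubset:
  assumes q: "q \<in> comps n" and l: "l \<in> comps n"
    and k: "k \<in> of_type n q" and k': "k' \<in> of_type n l" and sub: "sim n k \<subset> sim n k'"
  shows "strict_weak_refines q l"
proof -
  obtain f where f: "k = rank_rel n f" "\<And>i. i \<in> {1..n} \<Longrightarrow> f i < length q"
    "\<And>j. j < length q \<Longrightarrow> card {i \<in> {1..n}. f i = j} = q ! j" by (rule of_type_rankE[OF q k]) blast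
  obtain f' where f': "k' = rank_rel n f'" "\<And>i. i \<in> {1..n} \<Longrightarrow> f' i < length l"
    "\<And>j. j < length l \<Longrightarrow> card {i \<in> {1..n}. f' i = j} = l ! j" by (rule of_type_rankE[OF l k']) blast
  have "\<exists>i. i \<in> {1..n} \<and> f i = c" if "c < length q" for c
  proof -
    have "card {i \<in> {1..n}. f i = c} > 0" using f(3)[OF that] q that by (simp add: comps_def)
    then show ?thesis by (metis (mono_tags, lifting) Collect_empty_eq card.empty less_irrefl)
  qed
  then obtain r where r: "\<And>c. c < length q \<Longrightarrow> r c \<in> {1..n} \<and> f (r c) = c" by metis
  \<comment> \<open>\<open>r c\<close> represents block \<open>c\<close> of \<open>k\<close>, and
    \<open>h c\<close> is the number of the block of \<open>k'\<close> around it.\<close>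
  define h where "h = (\<lambda>c. f' (r c))"
  have hf: "f' i = h (f i)" if i: "i \<in> {1..n}" for i
  proof -
    have "(i, r (f i)) \<in> sim n k" unfolding f(1) sim_rank_rel using i r[OF f(2)[OF i]] by simp
    then have "(i, r (f i)) \<in> sim n k'" using sub by blast
    then show ?thesis unfolding f'(1) sim_rank_rel h_def by simp
  qed
  define rs where "rs = map (\<lambda>j. map ((!) q) (filter (\<lambda>c. h c = j) [0..<length q])) [0..<length l]"
  have "mset (concat rs) = mset (map ((!) q) [0..<length q])"
    unfolding rs_def by (rule mset_concat_filter_upt) (use r f'(2) in \<open>auto simp: h_def\<close>)
  then have 1: "mset q = mset (concat rs)" by (simp add: map_nth)
  have "rs ! j \<in> comps (l ! j)" if j: "j < length l" for j
  proof -
    have rsj: "rs ! j = map ((!) q) (filter (\<lambda>c. h c = j) [0..<length q])" using j by (simp add: rs_def)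
    have "sum_list (rs ! j) = (\<Sum>c\<in>{c. c < length q \<and> h c = j}. q ! c)"
      unfolding rsj by (subst sum_list_distinct_conv_sum_set) (auto intro!: sum.cong)
    also have "\<dots> = (\<Sum>c\<in>{c. c < length q \<and> h c = j}. card {i \<in> {1..n}. f i = c})"
      using f(3) by (intro sum.cong) auto
    also have "\<dots> = card (\<Union>c\<in>{c. c < length q \<and> h c = j}. {i \<in> {1..n}. f i = c})"
      by (rule card_UN_disjoint[symmetric]) auto
    also have "(\<Union>c\<in>{c. c < length q \<and> h c = j}. {i \<in> {1..n}. f i = c}) = {i \<in> {1..n}. f' i = j}"
    proof (intro equalityI subsetI)
      fix i assume "i \<in> {i \<in> {1..n}. f' i = j}"
      then have i: "i \<in> {1..n}" "f' i = j" by simp_all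
      then show "i \<in> (\<Union>c\<in>{c. c < length q \<and> h c = j}. {i \<in> {1..n}. f i = c})"
        using hf[OF i(1)] f(2)[OF i(1)] by (intro UN_I[of "f i"]) simp_all
    next
      fix i assume "i \<in> (\<Union>c\<in>{c. c < length q \<and> h c = j}. {i \<in> {1..n}. f i = c})"
      then have "i \<in> {1..n}" "h (f i) = j" by blast+
      then show "i \<in> {i \<in> {1..n}. f' i = j}" using hf by simp
    qed
    also have "card \<dots> = l ! j" using f'(3)[OF j] .
    finally show ?thesis using q by (auto simp: rsj comps_def)
  qed
  then have "strong_refines (concat rs) l"
    unfolding strong_refines_def by (intro exI[of _ rs]) (simp add: rs_def)
  then have "weak_refines q l" using 1 by (auto simp: weak_refines_def rearr_def)
  moreover have "mset l \<noteq> mset q"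
  proof
    assume "mset l = mset q"
    then have "card (sim n k) = card (sim n k')"
      using card_sim_of_type[OF q k] card_sim_of_type[OF l k'] by simp
    then show False using psubset_card_mono[OF finite_sim sub] by simp
  qed
  ultimately show ?thesis by (simp add: strict_weak_refines_def rearr_def)
qed

section \<open>Permutation characters count fixed set compositions\<close>

lemma young_eq_stabilizer:
  assumes q: "q \<in> comps n"
  shows "young n q = {y \<in> perms n. act y (std_rel n q) = std_rel n q}"
proof -
  have "(\<forall>j<length q. y ` {sum_list (take j q) + 1 .. sum_list (take (Suc j) q)}
        = {sum_list (take j q) + 1 .. sum_list (take (Suc j) q)}) \<longleftrightarrow> act y (std_rel n q) = std_rel n q"
    if y: "y \<in> perms n" for y
  proof -
    have *: "act y (std_rel n q) = std_rel n q \<longleftrightarrow> (\<forall>i\<in>{1..n}. block q i = block q (y i))"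
    proof -
      have "(i, y i) \<in> sim n (std_rel n q) \<longleftrightarrow> block q i = block q (y i)" if "i \<in> {1..n}" for i
        using that perms_in_iff[OF y, of i] unfolding std_rel_def sim_rank_rel by blast
      then show ?thesis unfolding act_fixes_iff[OF y std_rel_in_set_comps] by blast
    qed
    let ?B = "\<lambda>j. {i \<in> {1..n}. block q i = j}"
    show ?thesis unfolding *
    proof
      assume H: "\<forall>j<length q. y ` {sum_list (take j q) + 1 .. sum_list (take (Suc j) q)}
        = {sum_list (take j q) + 1 .. sum_list (take (Suc j) q)}"
      show "\<forall>i\<in>{1..n}. block q i = block q (y i)"
      proof
        fix i assume i: "i \<in> {1..n}"
        have "y ` ?B (block q i) = ?B (block q i)"
          using H block_less_length[OF q i] block_fibre[OF q block_less_length[OF q i]] by simp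
        moreover have "i \<in> ?B (block q i)" using i by simp
        ultimately have "y i \<in> ?B (block q i)" by blast
        then show "block q i = block q (y i)" by simp
      qed
    next
      assume H: "\<forall>i\<in>{1..n}. block q i = block q (y i)"
      show "\<forall>j<length q. y ` {sum_list (take j q) + 1 .. sum_list (take (Suc j) q)}
        = {sum_list (take j q) + 1 .. sum_list (take (Suc j) q)}"
      proof (intro allI impI)
        fix j assume j: "j < length q"
        have "y ` ?B j \<subseteq> ?B j"
        proof
          fix x assume "x \<in> y ` ?B j"
          then obtain i where "i \<in> {1..n}" "block q i = j" "x = y i" by blast
          then show "x \<in> ?B j" using H perms_in_iff[OF y, of i] by auto
        qed
        moreover have "inj_on y (?B j)" using perms_bij[OF y] by (simp add: bij_def inj_on_def)
        ultimately have "y ` ?B j = ?B j" by (intro endo_inj_surj) simp_all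
        then show "y ` {sum_list (take j q) + 1 .. sum_list (take (Suc j) q)}
        = {sum_list (take j q) + 1 .. sum_list (take (Suc j) q)}" unfolding block_fibre[OF q j] .
      qed
    qed
  qed
  then show ?thesis unfolding young_def by blast
qed

lemma card_image_eq_if_kernels_eq:
  assumes "\<And>a b. a \<in> A \<Longrightarrow> b \<in> A \<Longrightarrow> F a = F b \<longleftrightarrow> G a = G b"
  shows "card (F ` A) = card (G ` A)"
proof -
  have "bij_betw (\<lambda>x. G (inv_into A F x)) (F ` A) (G ` A)"
  proof (rule bij_betw_imageI)
    show "inj_on (\<lambda>x. G (inv_into A F x)) (F ` A)"
      by (rule inj_onI) (metis assms f_inv_into_f inv_into_into)
    show "(\<lambda>x. G (inv_into A F x)) ` F ` A = G ` A"
    proof -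
      have "G (inv_into A F (F a)) = G a" if "a \<in> A" for a
        using assms that by (metis f_inv_into_f inv_into_into image_eqI)
      then show ?thesis by (simp add: image_image)
    qed
  qed
  then show ?thesis by (rule bij_betw_same_card)
qed

text \<open>The Young subgroup is the stabilizer of \<open>std_rel n q\<close>, so the coset of
  \<open>g\<close> and \<open>act g (std_rel n q)\<close> determine each other. The correspondence
  respects the action of \<open>s\<close> and hence matches fixed cosets with fixed set
  compositions.\<close>

lemma perm_char_eq:
  assumes q: "q \<in> comps n" and s: "s \<in> perms n"
  shows "perm_char n q s = of_nat (card {k \<in> of_type n q. act s k = k})"
proof -
  let ?P = "std_rel n q" and ?Y = "young n q"
  let ?F = "\<lambda>g. (\<lambda>y. g \<circ> y) ` ?Y" and ?G = "\<lambda>g. act g ?P"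
  have Y: "?Y = {y \<in> perms n. act y ?P = ?P}" by (rule young_eq_stabilizer[OF q])
  have kernel: "?F g = ?F h \<longleftrightarrow> ?G g = ?G h" if g: "g \<in> perms n" and h: "h \<in> perms n" for g h
  proof
    assume F: "?F g = ?F h"
    have "id \<in> ?Y" by (simp add: Y perms_id)
    then have "g \<in> ?F g" by (metis comp_id image_eqI)
    then obtain y where "y \<in> ?Y" "g = h \<circ> y" using F by blast
    then show "?G g = ?G h" using h act_comp[OF h] by (simp add: Y)
  next
    assume G: "?G g = ?G h"
    have sub: "?F g \<subseteq> ?F h" if G: "?G g = ?G h" and g: "g \<in> perms n" and h: "h \<in> perms n" for g h
    proof
      fix x assume "x \<in> ?F g"
      then obtain y where y: "y \<in> ?Y" "x = g \<circ> y" by blast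
      define z where "z = inv h \<circ> g \<circ> y"
      have yp: "y \<in> perms n" using y Y by simp
      have "act z ?P = act (inv h) (act g (act y ?P))"
        unfolding z_def act_comp[OF perms_comp[OF perms_inv[OF h] g] yp] act_comp[OF perms_inv[OF h] g] ..
      also have "\<dots> = ?P" using y(1) G h by (simp add: Y)
      finally have "z \<in> ?Y" using g h yp by (simp add: Y z_def perms_inv perms_comp)
      moreover have "x = h \<circ> z" using h y by (simp add: z_def fun_eq_iff)
      ultimately show "x \<in> ?F h" by blast
    qed
    show "?F g = ?F h" using sub[OF G g h] sub[OF G[symmetric] h g] by blast
  qed
  let ?A = "{g \<in> perms n. act s (act g ?P) = act g ?P}"
  have sF: "(\<lambda>h. s \<circ> h) ` ?F g = ?F (s \<circ> g)" for g by (simp add: image_image comp_assoc)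
  have "(\<lambda>h. s \<circ> h) ` ?F g = ?F g \<longleftrightarrow> act s (act g ?P) = act g ?P" if g: "g \<in> perms n" for g
    unfolding sF using kernel[OF perms_comp[OF s g] g] act_comp[OF s g] by simp
  then have 1: "{C \<in> rcosets_young n q. (\<lambda>h. s \<circ> h) ` C = C} = ?F ` ?A"
    unfolding rcosets_young_def by blast
  have 2: "{k \<in> of_type n q. act s k = k} = ?G ` ?A"
    unfolding of_type_eq_orbit by blast
  have "card (?F ` ?A) = card (?G ` ?A)"
    by (rule card_image_eq_if_kernels_eq) (use kernel in blast)
  then show ?thesis using s unfolding perm_char_def 1 2 by simp
qed

text \<open>With the blocks of \<open>k\<close> as cycles of \<open>\<sigma>\<close>, every orbit
  lies in a block of \<open>b\<close> exactly if every block of \<open>k\<close> does. So the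
  characters attached to \<open>sim n k\<close> and to the graph of \<open>\<sigma>\<close>
  coincide.\<close>

lemma ex_perm_of_set_comp:
  assumes k: "k \<in> set_comps n"
  obtains \<sigma> where "\<sigma> \<in> perms n"
    "\<And>b. b \<in> set_comps n \<Longrightarrow> (\<forall>i\<in>{1..n}. (i, \<sigma> i) \<in> sim n b) \<longleftrightarrow> sim n k \<subseteq> sim n b"
    "cycle_type n \<sigma> = class_sizes n (sim n k)"
proof -
  obtain f where f: "k = rank_rel n f" using k by (rule set_compsE)
  obtain \<sigma> where s: "\<sigma> \<in> perms n" and o: "\<And>i. i \<in> {1..n} \<Longrightarrow> orbit \<sigma> i = {j \<in> {1..n}. f j = f i}"
    by (rule ex_perm_orbits_eq_fibres[of n f]) blast
  have "(\<forall>i\<in>{1..n}. (i, \<sigma> i) \<in> sim n b) \<longleftrightarrow> sim n k \<subseteq> sim n b" if b: "b \<in> set_comps n" for b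
  proof -
    obtain g where g: "b = rank_rel n g" using b by (rule set_compsE)
    show ?thesis
    proof
      assume "\<forall>i\<in>{1..n}. (i, \<sigma> i) \<in> sim n b"
      then have st: "g (\<sigma> i) = g i" if "i \<in> {1..n}" for i using that unfolding g sim_rank_rel by fastforce
      have "g j = g i" if "j \<in> orbit \<sigma> i" "i \<in> {1..n}" for i j
        using that
      proof induction
        case (step y)
        then have "y \<in> {1..n}" using perms_orbit_subset[OF s] by blast
        then show ?case using step st by simp
      qed (use st in simp)
      then show "sim n k \<subseteq> sim n b" unfolding f g sim_rank_rel using o by fastforce
    next
      assume sub: "sim n k \<subseteq> sim n b"
      show "\<forall>i\<in>{1..n}. (i, \<sigma> i) \<in> sim n b"
      proof
        fix i assume i: "i \<in> {1..n}"
        have "\<sigma> i \<in> {j \<in> {1..n}. f j = f i}" using o[OF i] orbit.base[of \<sigma> i] by simp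
        then have "(i, \<sigma> i) \<in> sim n k" unfolding f sim_rank_rel using i by simp
        then show "(i, \<sigma> i) \<in> sim n b" using sub by blast
      qed
    qed
  qed
  moreover have "cycle_type n \<sigma> = class_sizes n (sim n k)"
  proof -
    have "orbit \<sigma> ` {1..n} = (\<lambda>i. {j \<in> {1..n}. (i, j) \<in> sim n k}) ` {1..n}"
      using o by (intro image_cong refl) (auto simp: f sim_rank_rel)
    then show ?thesis by (simp only: cycle_type_def class_sizes_def)
  qed
  ultimately show ?thesis using that s by blast
qed


section \<open>The value of a type sum at its own type\<close>

text \<open>Orbit-stabilizer for permutations of the positions of \<open>l\<close>, compared with
  the multinomial formula: both factor \<open>fact (length l)\<close> with the number of
  rearrangements of \<open>l\<close> as one factor.\<close>

lemma card_part_stabilizer: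
  "card {\<pi>. \<pi> permutes {..<length l} \<and> (\<forall>j<length l. l ! \<pi> j = l ! j)} = brfact l"
  (is "card ?S = _")
proof -
  let ?P = "{\<pi>. \<pi> permutes {..<length l}}" and ?M = "permutations_of_multiset (mset l)"
  have finP: "finite ?P" by (simp add: finite_permutations)
  have fib: "card {\<pi> \<in> ?P. permute_list \<pi> l = ys} = card ?S" if ys: "ys \<in> ?M" for ys
  proof -
    have "mset ys = mset l" using ys by (simp add: permutations_of_multiset_def)
    then obtain \<rho> where r: "\<rho> permutes {..<length l}" "permute_list \<rho> l = ys"
      by (rule mset_eq_permutation)
    have eq_iff: "permute_list \<pi> l = ys \<longleftrightarrow> (\<forall>j<length l. l ! \<pi> j = l ! \<rho> j)" for \<pi>
      unfolding r(2)[symmetric] by (auto simp: permute_list_def)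
    have "bij_betw (\<lambda>\<pi>. \<pi> \<circ> inv \<rho>) {\<pi> \<in> ?P. permute_list \<pi> l = ys} ?S"
    proof (rule bij_betw_byWitness[of _ "\<lambda>\<pi>. \<pi> \<circ> \<rho>"])
      have ri: "inv \<rho> j < length l \<longleftrightarrow> j < length l" "\<rho> j < length l \<longleftrightarrow> j < length l" for j
        using permutes_in_image[OF permutes_inv[OF r(1)], of j] permutes_in_image[OF r(1), of j] by simp_all
      show "(\<lambda>\<pi>. \<pi> \<circ> inv \<rho>) ` {\<pi> \<in> ?P. permute_list \<pi> l = ys} \<subseteq> ?S"
        using r(1) by (auto simp: eq_iff permutes_compose permutes_inv ri permutes_inverses[OF r(1)])
      show "(\<lambda>\<pi>. \<pi> \<circ> \<rho>) ` ?S \<subseteq> {\<pi> \<in> ?P. permute_list \<pi> l = ys}"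
        using r(1) by (auto simp: eq_iff permutes_compose ri)
    qed (auto simp: fun_eq_iff permutes_inverses[OF r(1)])
    then show ?thesis by (rule bij_betw_same_card)
  qed
  have "fact (length l) = card ?P" by (subst card_permutations) auto
  also have "\<dots> = (\<Sum>ys\<in>?M. \<Sum>\<pi>\<in>{\<pi> \<in> ?P. permute_list \<pi> l = ys}. 1)"
    unfolding card_eq_sum
    by (rule sum.group[symmetric, OF finP finite_permutations_of_multiset]) (auto simp: permutations_of_multiset_def)
  also have "\<dots> = card ?M * card ?S" using fib by simp
  finally have 1: "card ?M * card ?S = fact (length l)" by simp
  have 2: "card ?M * brfact l = fact (length l)"
    using card_permutations_of_multiset_aux[of "mset l"] by (simp add: brfact_def)
  have "card ?M \<noteq> 0"
  proof
    assume "card ?M = 0"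
    then have "fact (length l) = (0::nat)" unfolding 2[symmetric] by simp
    then show False by simp
  qed
  moreover have "card ?M * card ?S = card ?M * brfact l" using 1 2 by simp
  ultimately show ?thesis by (simp only: mult_cancel1) blast
qed

text \<open>Such a \<open>b\<close> has as many blocks as \<open>std_rel n l\<close> and its blocks
  are unions of those, so it merely reorders them; having type \<open>l\<close>, it may exchange
  only blocks of equal size.\<close>

lemma card_of_type_sim:
  assumes l: "l \<in> comps n"
  shows "card {b \<in> of_type n l. sim n (std_rel n l) \<subseteq> sim n b} = brfact l"
proof -
  let ?L = "length l"
  let ?S = "{\<pi>. \<pi> permutes {..<?L} \<and> (\<forall>j<?L. l ! \<pi> j = l ! j)}"
  let ?A = "{b \<in> of_type n l. sim n (std_rel n l) \<subseteq> sim n b}"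
  let ?E = "\<lambda>\<pi>. rank_rel n (\<pi> \<circ> block l)"
  have ms: "vals n (\<pi> \<circ> block l) = vals n (block l)"
    if p: "\<pi> \<in> ?S" for \<pi>
  proof (rule image_mset_eq_blockI[OF l])
    have pp: "\<pi> permutes {..<?L}" using p by simp
    show "(\<pi> \<circ> block l) i < ?L" if "i \<in> {1..n}" for i
      using permutes_in_image[OF pp, of "block l i"] block_less_length[OF l that] by simp
    fix j assume j: "j < ?L"
    have ij: "inv \<pi> j < ?L" using permutes_in_image[OF permutes_inv[OF pp], of j] j by simp
    have "{i \<in> {1..n}. (\<pi> \<circ> block l) i = j} = {i \<in> {1..n}. block l i = inv \<pi> j}"
      using permutes_inverses[OF pp] by (metis comp_apply)
    then have "card {i \<in> {1..n}. (\<pi> \<circ> block l) i = j} = l ! inv \<pi> j"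
      using card_block_fibre[OF l ij] by simp
    also have "\<dots> = l ! \<pi> (inv \<pi> j)" using p ij by simp
    finally show "card {i \<in> {1..n}. (\<pi> \<circ> block l) i = j} = l ! j"
      using permutes_inverses[OF pp] by simp
  qed
  have "bij_betw ?E ?S ?A"
  proof (rule bij_betw_imageI)
    show "inj_on ?E ?S"
    proof (rule inj_onI)
      fix \<pi> \<rho> assume pr: "\<pi> \<in> ?S" "\<rho> \<in> ?S" "?E \<pi> = ?E \<rho>"
      have e: "(\<pi> \<circ> block l) i = (\<rho> \<circ> block l) i" if "i \<in> {1..n}" for i
        using pr(3) that ms[OF pr(1)] ms[OF pr(2)] by (metis rank_rel_inj)
      show "\<pi> = \<rho>"
      proof
        fix j
        show "\<pi> j = \<rho> j"
        proof (cases "j < ?L")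
          case True
          then obtain i where "i \<in> {1..n}" "block l i = j" by (rule block_surj[OF l])
          then show ?thesis using e by force
        next
          case False
          then show ?thesis using pr by (simp add: permutes_def)
        qed
      qed
    qed
    show "?E ` ?S = ?A"
    proof (intro equalityI subsetI)
      fix b assume "b \<in> ?E ` ?S"
      then obtain \<pi> where p: "\<pi> \<in> ?S" "b = ?E \<pi>" by blast
      have "b \<in> of_type n l" using ms[OF p(1)] p(2) by (auto simp: of_type_def)
      moreover have "sim n (std_rel n l) \<subseteq> sim n b"
        unfolding p(2) std_rel_def sim_rank_rel by auto
      ultimately show "b \<in> ?A" by simp
    next
      fix b assume b: "b \<in> ?A"
      then have bt: "b \<in> of_type n l" and sub: "sim n (std_rel n l) \<subseteq> sim n b" by simp_all
      obtain f where f: "b = rank_rel n f" "\<And>i. i \<in> {1..n} \<Longrightarrow> f i < ?L"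
        "\<And>j. j < ?L \<Longrightarrow> card {i \<in> {1..n}. f i = j} = l ! j"
        by (rule of_type_rankE[OF l bt]) blast
      have "\<exists>i. i \<in> {1..n} \<and> block l i = j" if "j < ?L" for j
        using block_surj[OF l that] by blast
      then obtain r where r: "\<And>j. j < ?L \<Longrightarrow> r j \<in> {1..n} \<and> block l (r j) = j" by metis
      define h where "h = (\<lambda>j. if j < ?L then f (r j) else j)"
      have hf: "h (block l i) = f i" if i: "i \<in> {1..n}" for i
      proof -
        have bi: "block l i < ?L" by (rule block_less_length[OF l i])
        have "(i, r (block l i)) \<in> sim n (std_rel n l)"
          unfolding std_rel_def sim_rank_rel using i r[OF bi] by simp
        then have "(i, r (block l i)) \<in> sim n b" using sub by blast
        then show ?thesis unfolding f(1) sim_rank_rel h_def using bi by simp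
      qed
      have himg: "h ` {..<?L} = {..<?L}"
      proof (intro equalityI subsetI)
        fix j assume "j \<in> h ` {..<?L}"
        then show "j \<in> {..<?L}" using f(2) r by (auto simp: h_def)
      next
        fix j assume j: "j \<in> {..<?L}"
        then have "card {i \<in> {1..n}. f i = j} > 0" using f(3)[of j] l by (simp add: comps_def)
        then obtain i where i: "i \<in> {1..n}" "f i = j"
          by (metis (mono_tags, lifting) Collect_empty_eq card.empty less_irrefl)
        then have "j = h (block l i)" using hf by simp
        then show "j \<in> h ` {..<?L}" using block_less_length[OF l i(1)] by blast
      qed
      then have hinj: "inj_on h {..<?L}" by (intro eq_card_imp_inj_on) simp_all
      have hp: "h permutes {..<?L}"
        by (rule bij_imp_permutes) (use himg hinj in \<open>auto simp: bij_betw_def h_def\<close>)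
      moreover have "l ! h j = l ! j" if j: "j < ?L" for j
      proof -
        have "h j < ?L" using himg j by blast
        then have "l ! h j = card {i \<in> {1..n}. f i = h j}" using f(3) by simp
        also have "{i \<in> {1..n}. f i = h j} = {i \<in> {1..n}. block l i = j}"
        proof -
          have "f i = h j \<longleftrightarrow> block l i = j" if i: "i \<in> {1..n}" for i
            unfolding hf[OF i, symmetric] using permutes_inj[OF hp] by (simp add: inj_eq)
          then show ?thesis by blast
        qed
        finally show ?thesis using card_block_fibre[OF l j] by simp
      qed
      moreover have "b = ?E h" unfolding f(1) by (rule rank_rel_cong) (simp add: hf)
      ultimately show "b \<in> ?E ` ?S" by blast
    qed
  qed
  then have "card ?S = card ?A" by (rule bij_betw_same_card)
  then show ?thesis using card_part_stabilizer by simp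
qed

section \<open>The monoid algebra and its characters\<close>

abbreviation keys :: "('b \<Rightarrow>\<^sub>0 'a::zero) \<Rightarrow> 'b set" where
  "keys \<equiv> Poly_Mapping.keys"

abbreviation lookup :: "('b \<Rightarrow>\<^sub>0 'a::zero) \<Rightarrow> 'b \<Rightarrow> 'a" where
  "lookup \<equiv> Poly_Mapping.lookup"

abbreviation single :: "'b \<Rightarrow> 'a \<Rightarrow> ('b \<Rightarrow>\<^sub>0 'a::zero)" where
  "single \<equiv> Poly_Mapping.single"

lemma sum_fun_apply: "(\<Sum>i\<in>I. f i) x = (\<Sum>i\<in>I. f i x)"
  by (induction I rule: infinite_finite_induct) auto

lemma keys_sum_subset:
  assumes "\<And>i. i \<in> I \<Longrightarrow> keys (f i) \<subseteq> S"
  shows "keys (\<Sum>i\<in>I. f i) \<subseteq> S"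
  using assms
proof (induction I rule: infinite_finite_induct)
  case (insert i I)
  then show ?case using keys_add[of "f i" "sum f I"] by simp blast
qed auto

lemma keys_diff_subset: "keys x \<subseteq> S \<Longrightarrow> keys y \<subseteq> S \<Longrightarrow> keys (x - y :: 'b \<Rightarrow>\<^sub>0 'a::ab_group_add) \<subseteq> S"
  by (auto simp: in_keys_iff lookup_minus) (metis in_keys_iff subsetD)

lemma keys_add_subset: "keys x \<subseteq> S \<Longrightarrow> keys y \<subseteq> S \<Longrightarrow> keys (x + y) \<subseteq> S"
  using keys_add[of x y] by blast

lemma poly_mapping_expand:
  assumes "finite T" "keys x \<subseteq> T"
  shows "x = (\<Sum>a\<in>T. single a (lookup x a))"
proof (rule poly_mapping_eqI)
  fix k
  have "lookup (\<Sum>a\<in>T. single a (lookup x a)) k = (\<Sum>a\<in>T. if a = k then lookup x a else 0)"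
    unfolding lookup_sum by (intro sum.cong) (auto simp: lookup_single when_def)
  also have "\<dots> = lookup x k" using assms by (auto simp: sum.delta' in_keys_iff)
  finally show "lookup x k = lookup (\<Sum>a\<in>T. single a (lookup x a)) k" by simp
qed

lemma times_expand:
  fixes x y :: "'b::monoid_add \<Rightarrow>\<^sub>0 'a::field"
  assumes "finite S" "finite T" "keys x \<subseteq> S" "keys y \<subseteq> T"
  shows "x * y = (\<Sum>a\<in>S. \<Sum>b\<in>T. single (a + b) (lookup x a * lookup y b))"
proof -
  have "x * y = (\<Sum>a\<in>S. single a (lookup x a)) * (\<Sum>b\<in>T. single b (lookup y b))"
    using poly_mapping_expand[OF assms(1,3)] poly_mapping_expand[OF assms(2,4)] by simp
  also have "\<dots> = (\<Sum>a\<in>S. \<Sum>b\<in>T. single (a + b) (lookup x a * lookup y b))"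
    by (simp add: sum_product mult_single)
  finally show ?thesis .
qed

lemma lookup_times:
  fixes x y :: "'b::monoid_add \<Rightarrow>\<^sub>0 'a::field"
  assumes "finite S" "finite T" "keys x \<subseteq> S" "keys y \<subseteq> T"
  shows "lookup (x * y) k = (\<Sum>a\<in>S. \<Sum>b\<in>T. if a + b = k then lookup x a * lookup y b else 0)"
  unfolding times_expand[OF assms] lookup_sum
  by (intro sum.cong refl) (auto simp: lookup_single when_def)

text \<open>Scalars act as multiples \<open>single 0 c\<close> of the unit, so that ring laws of the
  monoid algebra apply.\<close>

definition scale :: "'a \<Rightarrow> ('b::monoid_add \<Rightarrow>\<^sub>0 'a) \<Rightarrow> ('b \<Rightarrow>\<^sub>0 'a::field)" where
  "scale c x = single 0 c * x"

lemma lookup_scale [simp]: "lookup (scale c x) k = c * lookup x k"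
  unfolding scale_def mult_map_scale_conv_mult[symmetric] by (simp add: Poly_Mapping.map.rep_eq when_def)

lemma keys_scale: "keys (scale c x) \<subseteq> keys x"
  by (auto simp: in_keys_iff)

lemma scale_mult_left: "scale c x * y = scale c (x * y)"
  by (simp add: scale_def mult.assoc)

text \<open>The character of the monoid of set compositions attached to a relation \<open>R\<close>. Solomon's
  epimorphism evaluated at \<open>s\<close> is the case where \<open>R\<close> is the graph of \<open>s\<close>.\<close>
definition chi :: "nat \<Rightarrow> (nat \<times> nat) set \<Rightarrow> (lexrel \<Rightarrow>\<^sub>0 'a) \<Rightarrow> 'a::field" where
  "chi n R x = (\<Sum>k\<in>keys x. if R \<subseteq> sim n k then lookup x k else 0)"

lemma chi_superset:
  assumes "finite T" "keys x \<subseteq> T"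
  shows "chi n R x = (\<Sum>k\<in>T. if R \<subseteq> sim n k then lookup x k else 0)"
  unfolding chi_def by (rule sum.mono_neutral_left) (use assms in \<open>auto simp: in_keys_iff\<close>)

lemma chi_add: "chi n R (x + y) = chi n R x + chi n R y"
proof -
  have "keys (x + y) \<subseteq> keys x \<union> keys y" by (rule keys_add)
  then show ?thesis
    by (simp add: chi_superset[of "keys x \<union> keys y"] flip: sum.distrib)
      (intro sum.cong, auto simp: lookup_add)
qed

lemma chi_zero [simp]: "chi n R 0 = 0"
  by (simp add: chi_def)

lemma chi_diff: "chi n R (x - y) = chi n R x - chi n R y"
  using chi_add[of n R "x - y" y] by simp

lemma chi_sum: "chi n R (\<Sum>i\<in>I. f i) = (\<Sum>i\<in>I. chi n R (f i))"
  by (induction I rule: infinite_finite_induct) (simp_all add: chi_add)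

lemma chi_single: "chi n R (single k c) = (if R \<subseteq> sim n k then c else 0)"
  by (simp add: chi_superset[of "{k}"])

text \<open>The ties of a product are the common ties (\<open>sim_plus\<close>), so containing
  \<open>R\<close> is multiplicative on basis elements.\<close>

lemma chi_mult: "chi n R (x * y) = chi n R x * chi n R y"
proof -
  have "chi n R (x * y) = (\<Sum>a\<in>keys x. \<Sum>b\<in>keys y. chi n R (single (a + b) (lookup x a * lookup y b)))"
    using times_expand[of "keys x" "keys y" x y] by (simp add: chi_sum)
  also have "\<dots> = (\<Sum>a\<in>keys x. \<Sum>b\<in>keys y. (if R \<subseteq> sim n a then lookup x a else 0) *
      (if R \<subseteq> sim n b then lookup y b else 0))"
    by (intro sum.cong refl) (auto simp: chi_single sim_plus)
  also have "\<dots> = chi n R x * chi n R y" by (simp add: chi_def sum_product)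
  finally show ?thesis .
qed

lemma sim_zero: "sim n 0 = {1..n} \<times> {1..n}"
  by (auto simp: sim_def)

lemma chi_one: "R \<subseteq> {1..n} \<times> {1..n} \<Longrightarrow> chi n R 1 = 1"
  using chi_single[of n R 0 1] by (simp add: sim_zero)

lemma chi_scale: "R \<subseteq> {1..n} \<times> {1..n} \<Longrightarrow> chi n R (scale c x) = c * chi n R x"
  unfolding scale_def chi_mult by (simp add: chi_single sim_zero)

lemma chi_power: "R \<subseteq> {1..n} \<times> {1..n} \<Longrightarrow> chi n R (x ^ j) = chi n R x ^ j"
  by (induction j) (simp_all add: chi_one chi_mult)

text \<open>The terms \<open>b\<close> of \<open>x\<close> with \<open>k + b = k\<close> send their
  coefficients to \<open>k\<close>, where these add up to the character value; all other terms
  refine \<open>k\<close> strictly.\<close>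

lemma single_times_triangular:
  fixes x :: "lexrel \<Rightarrow>\<^sub>0 'a::field"
  assumes k: "k \<in> set_comps n" and x: "keys x \<subseteq> set_comps n"
  shows "keys (single k c * x - single k (c * chi n (sim n k) x)) \<subseteq> {b \<in> set_comps n. sim n b \<subset> sim n k}"
proof -
  let ?T = "set_comps n" and ?P = "\<lambda>b. sim n k \<subseteq> sim n b"
  have "single k c * x = (\<Sum>b\<in>?T. single (k + b) (c * lookup x b))"
    using times_expand[of "{k}" ?T "single k c" x] x by simp
  also have "\<dots> = (\<Sum>b\<in>?T. if ?P b then single k (c * lookup x b) else 0)
      + (\<Sum>b\<in>?T. if ?P b then 0 else single (k + b) (c * lookup x b))"
    unfolding sum.distrib[symmetric] by (intro sum.cong refl) (use k plus_absorb in auto)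
  also have "(\<Sum>b\<in>?T. if ?P b then single k (c * lookup x b) else 0) = single k (c * chi n (sim n k) x)"
    unfolding chi_superset[OF finite_set_comps x] sum_distrib_left
  proof (induction rule: finite_induct[OF finite_set_comps[of n]])
    case (2 b F)
    then show ?case by (simp add: single_add)
  qed simp
  finally have "single k c * x - single k (c * chi n (sim n k) x)
      = (\<Sum>b\<in>?T. if ?P b then 0 else single (k + b) (c * lookup x b))" by simp
  also have "keys \<dots> \<subseteq> {b \<in> set_comps n. sim n b \<subset> sim n k}"
  proof (rule keys_sum_subset)
    fix b assume "b \<in> ?T"
    then show "keys (if ?P b then 0 else single (k + b) (c * lookup x b)) \<subseteq> {b \<in> set_comps n. sim n b \<subset> sim n k}"
      using plus_in_set_comps[OF k] by (auto simp: sim_plus)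
  qed
  finally show ?thesis .
qed

text \<open>Each further factor \<open>x\<close> strictly lowers the number of tied pairs of every
  term, and there are at most \<open>n * n\<close> pairs; hence the exponent.\<close>

lemma nilpotent_if_chi_zero:
  fixes x :: "lexrel \<Rightarrow>\<^sub>0 'a::field"
  assumes x: "keys x \<subseteq> set_comps n" and chi: "\<And>k. k \<in> set_comps n \<Longrightarrow> chi n (sim n k) x = 0"
  shows "x ^ Suc (n * n) = 0"
proof -
  have "keys (x ^ j) \<subseteq> {k \<in> set_comps n. card (sim n k) + j \<le> n * n}" for j
  proof (induction j)
    case 0
    show ?case using card_sim_le[of n 0] by simp
  next
    case (Suc j)
    have "x ^ Suc j = (\<Sum>k\<in>keys (x ^ j). single k (lookup (x ^ j) k) * x)"
      unfolding power_Suc2 sum_distrib_right[symmetric]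
      using poly_mapping_expand[of "keys (x ^ j)" "x ^ j"] by simp
    also have "keys \<dots> \<subseteq> {k \<in> set_comps n. card (sim n k) + Suc j \<le> n * n}"
    proof (rule keys_sum_subset)
      fix k assume "k \<in> keys (x ^ j)"
      then have k: "k \<in> set_comps n" "card (sim n k) + j \<le> n * n" using Suc by auto
      have "keys (single k (lookup (x ^ j) k) * x) \<subseteq> {b \<in> set_comps n. sim n b \<subset> sim n k}"
        using single_times_triangular[OF k(1) x, of "lookup (x ^ j) k"] chi[OF k(1)] by simp
      moreover have "card (sim n b) + Suc j \<le> n * n" if "sim n b \<subset> sim n k" for b
        using psubset_card_mono[OF finite_sim that] k(2) by simp
      ultimately show "keys (single k (lookup (x ^ j) k) * x) \<subseteq> {k \<in> set_comps n. card (sim n k) + Suc j \<le> n * n}"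
        by blast
    qed
    finally show ?case .
  qed
  from this[of "Suc (n * n)"] have "keys (x ^ Suc (n * n)) = {}" by auto
  then show ?thesis by (simp only: keys_eq_empty)
qed

section \<open>Invariants of the symmetric group\<close>

definition invariants :: "nat \<Rightarrow> (lexrel \<Rightarrow>\<^sub>0 'a::field) set" where
  "invariants n = {x. keys x \<subseteq> set_comps n \<and> (\<forall>g\<in>perms n. \<forall>k. lookup x (act g k) = lookup x k)}"

lemma invariants_keys: "x \<in> invariants n \<Longrightarrow> keys x \<subseteq> set_comps n"
  by (simp add: invariants_def)

lemma invariants_lookup: "x \<in> invariants n \<Longrightarrow> g \<in> perms n \<Longrightarrow> lookup x (act g k) = lookup x k"
  by (simp add: invariants_def)

lemma invariants_zero: "0 \<in> invariants n"
  by (simp add: invariants_def)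

lemma invariants_one: "1 \<in> invariants n"
proof -
  have "act g 0 = 0" for g by (rule lexrel_eqI) simp
  then have "act g k = 0 \<longleftrightarrow> k = 0" if "g \<in> perms n" for g k
    using act_inj[OF that, of k 0] by simp
  then show ?thesis by (simp add: invariants_def lookup_one when_def)
qed

lemma invariants_add: "x \<in> invariants n \<Longrightarrow> y \<in> invariants n \<Longrightarrow> x + y \<in> invariants n"
  by (simp add: invariants_def lookup_add keys_add_subset)

lemma invariants_diff: "x \<in> invariants n \<Longrightarrow> y \<in> invariants n \<Longrightarrow> x - y \<in> invariants n"
  by (simp add: invariants_def lookup_minus keys_diff_subset)

lemma invariants_scale: "x \<in> invariants n \<Longrightarrow> scale c x \<in> invariants n"
  using keys_scale[of c x] by (auto simp: invariants_def)

lemma invariants_sum: "(\<And>i. i \<in> I \<Longrightarrow> f i \<in> invariants n) \<Longrightarrow> (\<Sum>i\<in>I. f i) \<in> invariants n"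
  by (induction I rule: infinite_finite_induct) (auto intro: invariants_zero invariants_add)

lemma keys_mult_set_comps:
  "keys x \<subseteq> set_comps n \<Longrightarrow> keys y \<subseteq> set_comps n \<Longrightarrow> keys (x * y) \<subseteq> set_comps n"
  using keys_mult[of x y] plus_in_set_comps by blast

text \<open>Here \<open>y'\<close> is the translate of \<open>y\<close> by \<open>g\<close>: left
  multiplication by an invariant is equivariant. Keeping \<open>y'\<close> apart from
  \<open>y\<close> covers both invariant \<open>y\<close> and the action on a single linear
  order.\<close>

lemma lookup_times_act:
  fixes x y y' :: "lexrel \<Rightarrow>\<^sub>0 'a::field"
  assumes x: "x \<in> invariants n" and y: "keys y \<subseteq> set_comps n" "keys y' \<subseteq> set_comps n"
    and g: "g \<in> perms n" and yy: "\<And>b. lookup y' (act g b) = lookup y b"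
  shows "lookup (x * y') (act g k) = lookup (x * y) k"
proof -
  let ?T = "set_comps n"
  note T = finite_set_comps[of n] and xk = invariants_keys[OF x]
  have "lookup (x * y') (act g k)
      = (\<Sum>a\<in>?T. \<Sum>b\<in>?T. if a + b = act g k then lookup x a * lookup y' b else 0)"
    by (rule lookup_times[OF T T xk y(2)])
  also have "\<dots> = (\<Sum>a\<in>?T. \<Sum>b\<in>?T. if act g a + act g b = act g k
      then lookup x (act g a) * lookup y' (act g b) else 0)"
    unfolding sum.reindex_bij_betw[OF bij_betw_act_set_comps[OF g], symmetric,
      where g = "\<lambda>a. \<Sum>b\<in>?T. if a + b = act g k then lookup x a * lookup y' b else 0"]
    by (intro sum.cong refl sum.reindex_bij_betw[OF bij_betw_act_set_comps[OF g], symmetric])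
  also have "\<dots> = (\<Sum>a\<in>?T. \<Sum>b\<in>?T. if a + b = k then lookup x a * lookup y b else 0)"
    by (simp add: act_plus[symmetric] act_inj[OF g] yy invariants_lookup[OF x g] cong: if_cong)
  also have "\<dots> = lookup (x * y) k" by (rule lookup_times[OF T T xk y(1), symmetric])
  finally show ?thesis .
qed

lemma invariants_mult: "x \<in> invariants n \<Longrightarrow> y \<in> invariants n \<Longrightarrow> x * y \<in> invariants n"
  unfolding invariants_def[of n]
  using lookup_times_act[of x n y y] invariants_lookup[of y n]
  by (auto simp: keys_mult_set_comps invariants_def)

lemma invariants_power: "x \<in> invariants n \<Longrightarrow> x ^ j \<in> invariants n"
  by (induction j) (auto intro: invariants_one invariants_mult)

definition type_sum :: "nat \<Rightarrow> nat list \<Rightarrow> (lexrel \<Rightarrow>\<^sub>0 'a::field)" where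
  "type_sum n q = (\<Sum>k\<in>of_type n q. single k 1)"

lemma lookup_type_sum: "lookup (type_sum n q) k = (if k \<in> of_type n q then 1 else 0)"
proof -
  have "lookup (type_sum n q) k = (\<Sum>a\<in>of_type n q. if a = k then 1 else 0)"
    unfolding type_sum_def lookup_sum by (intro sum.cong) (auto simp: lookup_single when_def)
  then show ?thesis by (simp add: sum.delta')
qed

lemma keys_type_sum: "keys (type_sum n q) = of_type n q"
  by (auto simp: in_keys_iff lookup_type_sum split: if_splits)

lemma type_sum_invariant: "type_sum n q \<in> invariants n"
  using of_type_subset[of n q]
  by (auto simp: invariants_def keys_type_sum lookup_type_sum act_in_of_type_iff)

lemma chi_type_sum:
  "chi n R (type_sum n q) = of_nat (card {k \<in> of_type n q. R \<subseteq> sim n k})"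
proof -
  have "chi n R (type_sum n q) = (\<Sum>k\<in>of_type n q. if R \<subseteq> sim n k then 1 else 0)"
    by (subst chi_superset[of "of_type n q"]) (auto simp: keys_type_sum lookup_type_sum intro!: sum.cong)
  also have "\<dots> = of_nat (card {k \<in> of_type n q. R \<subseteq> sim n k})"
    by (simp flip: sum.inter_filter)
  finally show ?thesis .
qed

text \<open>Coefficients are constant on orbits, and the orbits are the types;
  \<open>std_rel n q\<close> serves as the representative at which the coefficient is read
  off.\<close>

lemma invariants_decomp:
  assumes n: "n \<ge> 1" and x: "x \<in> invariants n"
  shows "x = (\<Sum>q\<in>comps n. scale (lookup x (std_rel n q)) (type_sum n q))"
proof (rule poly_mapping_eqI)
  fix k
  have e: "lookup (\<Sum>q\<in>comps n. scale (lookup x (std_rel n q)) (type_sum n q)) k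
    = (\<Sum>q\<in>comps n. if k \<in> of_type n q then lookup x (std_rel n q) else 0)"
    unfolding lookup_sum by (intro sum.cong refl) (simp add: lookup_type_sum)
  show "lookup x k = lookup (\<Sum>q\<in>comps n. scale (lookup x (std_rel n q)) (type_sum n q)) k"
  proof (cases "k \<in> set_comps n")
    case True
    then obtain r where r: "r \<in> comps n" "k \<in> of_type n r" using ex_type_of_set_comp[OF n] by blast
    then obtain g where g: "g \<in> perms n" "k = act g (std_rel n r)" by (auto simp: of_type_eq_orbit)
    have "k \<in> of_type n q \<longleftrightarrow> q = r" if "q \<in> comps n" for q
      using of_type_unique[OF that r(1)] r by blast
    then have "(\<Sum>q\<in>comps n. if k \<in> of_type n q then lookup x (std_rel n q) else 0)
      = (\<Sum>q\<in>comps n. if q = r then lookup x (std_rel n q) else 0)" by (intro sum.cong) auto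
    also have "\<dots> = lookup x (std_rel n r)" using r by (simp add: sum.delta')
    also have "\<dots> = lookup x k" using g invariants_lookup[OF x] by simp
    finally show ?thesis using e by simp
  next
    case False
    then have "k \<notin> of_type n q" for q using of_type_subset by blast
    moreover have "lookup x k = 0" using False invariants_keys[OF x] by (auto simp: in_keys_iff)
    ultimately show ?thesis using e by simp
  qed
qed

section \<open>The embedding into the group algebra\<close>

text \<open>The permutation \<open>s\<close> is identified with the linear order \<open>s 1 < s 2 < \<dots> < s n\<close>, which is
  \<open>rank_rel n (inv s)\<close>; set compositions act on linear orders by the product from the left.\<close>
definition to_grpalg :: "nat \<Rightarrow> (lexrel \<Rightarrow>\<^sub>0 'a::field) \<Rightarrow> 'a grpalg" where
  "to_grpalg n x = (\<lambda>s. if s \<in> perms n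
     then lookup (x * single (rank_rel n id) 1) (rank_rel n (inv s)) else 0)"

lemma lookup_times_single:
  fixes x :: "lexrel \<Rightarrow>\<^sub>0 'a::field"
  assumes "keys x \<subseteq> set_comps n"
  shows "lookup (x * single b c) k = (\<Sum>a\<in>set_comps n. if a + b = k then lookup x a * c else 0)"
  using lookup_times[of "set_comps n" "{b}" x "single b c" k] assms by (simp cong: if_cong)

lemma to_grpalg_apply:
  assumes "keys x \<subseteq> set_comps n" "s \<in> perms n"
  shows "to_grpalg n x s
    = (\<Sum>a\<in>set_comps n. if a + rank_rel n id = rank_rel n (inv s) then lookup x a else 0)"
  using assms by (simp add: to_grpalg_def lookup_times_single cong: if_cong)

lemma to_grpalg_zero [simp]: "to_grpalg n 0 = 0"
  by (simp add: to_grpalg_def fun_eq_iff)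

lemma to_grpalg_add: "to_grpalg n (x + y) = to_grpalg n x + to_grpalg n y"
  by (simp add: to_grpalg_def fun_eq_iff distrib_right lookup_add)

lemma to_grpalg_diff: "to_grpalg n (x - y) = to_grpalg n x - to_grpalg n y"
  by (simp add: to_grpalg_def fun_eq_iff left_diff_distrib lookup_minus)

lemma to_grpalg_sum: "to_grpalg n (\<Sum>i\<in>I. f i) = (\<Sum>i\<in>I. to_grpalg n (f i))"
  by (induction I rule: infinite_finite_induct) (simp_all add: to_grpalg_add)

lemma to_grpalg_scale: "to_grpalg n (scale c x) = smul c (to_grpalg n x)"
  by (simp add: to_grpalg_def smul_def fun_eq_iff scale_mult_left)

lemma perms_eqI:
  assumes "s \<in> perms n" "t \<in> perms n" "\<And>i. i \<in> {1..n} \<Longrightarrow> s i = t i"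
  shows "s = t"
proof
  fix i show "s i = t i"
    using assms by (cases "i \<in> {1..n}") (auto simp: perms_def permutes_def)
qed

lemma rank_rel_perm_inj:
  assumes s: "s \<in> perms n" and t: "t \<in> perms n" and eq: "rank_rel n s = rank_rel n t"
  shows "s = t"
proof (rule perms_eqI[OF s t])
  fix i assume i: "i \<in> {1..n}"
  have "vals n s = vals n t"
    using image_mset_comp_perm[OF s, of id] image_mset_comp_perm[OF t, of id] by simp
  then show "s i = t i" by (rule rank_rel_inj[OF eq _ i])
qed

text \<open>Refinement by a linear order leaves no ties, so the product is again a linear
  order.\<close>

lemma plus_linear_order:
  assumes k: "k \<in> set_comps n"
  obtains s where "s \<in> perms n" "k + rank_rel n id = rank_rel n (inv s)"
proof -
  have "k + rank_rel n id \<in> set_comps n" using k by (intro plus_in_set_comps) simp_all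
  then obtain F where F: "k + rank_rel n id = rank_rel n F" by (rule set_compsE)
  have inj: "i = j" if "i \<in> {1..n}" "j \<in> {1..n}" "F i = F j" for i j
  proof -
    have "(i, j) \<in> sim n (k + rank_rel n id)" unfolding F sim_rank_rel using that by simp
    then have "(i, j) \<in> sim n (rank_rel n id)" unfolding sim_plus by blast
    then show ?thesis unfolding sim_rank_rel by simp
  qed
  obtain h where h: "h \<in> perms n" "mono_on {1..n} (F \<circ> h)" by (rule ex_sorting_perm)
  have "rank_rel n (F \<circ> h) = rank_rel n id"
    unfolding rank_rel_eq_iff
  proof (intro ballI)
    fix i j assume ij: "i \<in> {1..n}" "j \<in> {1..n}"
    then have hij: "h i \<in> {1..n}" "h j \<in> {1..n}" using perms_in_iff[OF h(1)] by blast+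
    have "i \<le> j" if "F (h i) \<le> F (h j)"
    proof (rule ccontr)
      assume "\<not> i \<le> j"
      then have "F (h j) \<le> F (h i)" using mono_onD[OF h(2) ij(2,1)] by simp
      with that have "F (h i) = F (h j)" by (rule le_antisym)
      then have "h i = h j" by (rule inj[OF hij])
      then have "i = j" using perms_bij[OF h(1)] by (metis bij_is_inj injD)
      then show False using \<open>\<not> i \<le> j\<close> by simp
    qed
    then show "(F \<circ> h) i \<le> (F \<circ> h) j \<longleftrightarrow> id i \<le> id j"
      using mono_onD[OF h(2) ij] by auto
  qed
  then have "act h (rank_rel n (F \<circ> h)) = act h (rank_rel n id)" by simp
  moreover have "(F \<circ> h) \<circ> inv h = F" using h(1) by (simp add: fun_eq_iff)
  ultimately have "rank_rel n F = rank_rel n (inv h)" using h(1) by (simp add: act_rank_rel)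
  then show ?thesis using that h(1) F by simp
qed

text \<open>Left multiplication by \<open>x\<close> commutes with permutations, so its effect on the
  order of \<open>t\<close> is its effect on the natural order, translated by \<open>t\<close>.
  Expanding the action of \<open>y\<close> on the natural order then yields the convolution.\<close>

lemma to_grpalg_mult:
  fixes x y :: "lexrel \<Rightarrow>\<^sub>0 'a::field"
  assumes x: "x \<in> invariants n" and y: "keys y \<subseteq> set_comps n"
  shows "ga_mult n (to_grpalg n x) (to_grpalg n y) = to_grpalg n (x * y)"
proof
  fix \<pi>
  let ?P = "to_grpalg n" and ?i = "rank_rel n id" and ?o = "\<lambda>s. rank_rel n (inv s)"
  show "ga_mult n (?P x) (?P y) \<pi> = ?P (x * y) \<pi>"
  proof (cases "\<pi> \<in> perms n")
    case pi: True
    have ord_inj: "inj_on ?o (perms n)"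
      by (rule inj_onI) (metis perms_inv perms_inv_inv rank_rel_perm_inj)
    have yi: "y * single ?i 1 = (\<Sum>t\<in>perms n. single (?o t) (?P y t))"
    proof -
      have "keys (y * single ?i 1) \<subseteq> ?o ` perms n"
      proof
        fix k assume "k \<in> keys (y * single ?i 1)"
        then obtain a where "a \<in> keys y" "k = a + ?i" using keys_mult[of y "single ?i 1"] by auto
        moreover from this obtain s where "s \<in> perms n" "a + ?i = ?o s" using y plus_linear_order by blast
        ultimately show "k \<in> ?o ` perms n" by blast
      qed
      then have "y * single ?i 1 = (\<Sum>k\<in>?o ` perms n. single k (lookup (y * single ?i 1) k))"
        by (intro poly_mapping_expand) (simp_all add: finite_perms)
      also have "\<dots> = (\<Sum>t\<in>perms n. single (?o t) (lookup (y * single ?i 1) (?o t)))"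
        by (simp add: sum.reindex[OF ord_inj])
      also have "\<dots> = (\<Sum>t\<in>perms n. single (?o t) (?P y t))"
        by (intro sum.cong) (simp_all add: to_grpalg_def)
      finally show ?thesis .
    qed
    have tm: "lookup (x * single (?o t) c) (?o \<pi>) = ?P x (inv t \<circ> \<pi>) * c" if t: "t \<in> perms n" for t c
    proof -
      have act: "act t (?o (inv t \<circ> \<pi>)) = ?o \<pi>"
      proof -
        have "inv (inv t \<circ> \<pi>) \<circ> inv t = inv \<pi>"
          using t pi by (simp add: perms_inv_comp[OF perms_inv] perms_inv_inv fun_eq_iff)
        then show ?thesis using t by (simp add: act_rank_rel)
      qed
      have act2: "act t ?i = ?o t" using t by (simp add: act_rank_rel)
      have "lookup (x * single (?o t) c) (act t (?o (inv t \<circ> \<pi>))) = lookup (x * single ?i c) (?o (inv t \<circ> \<pi>))"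
      proof (rule lookup_times_act[OF x _ _ t])
        show "lookup (single (?o t) c) (act t b) = lookup (single ?i c) b" for b
          using act_inj[OF t, of ?i b] unfolding act2 by (simp add: lookup_single when_def)
      qed simp_all
      also have "\<dots> = ?P x (inv t \<circ> \<pi>) * c"
        using t pi perms_comp[OF perms_inv[OF t] pi]
        by (simp add: to_grpalg_def lookup_times_single[OF invariants_keys[OF x]] sum_distrib_right if_distrib[of "\<lambda>z. z * c"] cong: if_cong)
      finally show ?thesis unfolding act .
    qed
    have "?P (x * y) \<pi> = lookup (x * (y * single ?i 1)) (?o \<pi>)"
      using pi by (simp add: to_grpalg_def mult.assoc)
    also have "\<dots> = (\<Sum>t\<in>perms n. ?P x (inv t \<circ> \<pi>) * ?P y t)"
      unfolding yi sum_distrib_left lookup_sum using tm by (intro sum.cong) simp_all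
    \<comment> \<open>The substitution \<open>s = inv t \<circ> \<pi>\<close> solves
      \<open>t \<circ> s = \<pi>\<close>, the left-to-right product of \<open>s\<close> and
      \<open>t\<close>.\<close>
    also have "\<dots> = (\<Sum>s\<in>perms n. ?P x s * ?P y (\<pi> \<circ> inv s))"
    proof (rule sum.reindex_bij_witness[of _ "\<lambda>s. \<pi> \<circ> inv s" "\<lambda>t. inv t \<circ> \<pi>"])
      fix t assume t: "t \<in> perms n"
      show "inv t \<circ> \<pi> \<in> perms n" using t pi by (simp add: perms_comp perms_inv)
      show e: "\<pi> \<circ> inv (inv t \<circ> \<pi>) = t"
        using t pi by (simp add: perms_inv_comp[OF perms_inv] perms_inv_inv fun_eq_iff)
      show "?P x (inv t \<circ> \<pi>) * ?P y (\<pi> \<circ> inv (inv t \<circ> \<pi>)) = ?P x (inv t \<circ> \<pi>) * ?P y t" by (simp only: e)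
    next
      fix s assume s: "s \<in> perms n"
      show "\<pi> \<circ> inv s \<in> perms n" using s pi by (simp add: perms_comp perms_inv)
      show "inv (\<pi> \<circ> inv s) \<circ> \<pi> = s"
        using s pi by (simp add: perms_inv_comp[OF _ perms_inv] perms_inv_inv fun_eq_iff)
    qed
    finally show ?thesis using pi by (simp add: ga_mult_def)
  qed (simp add: ga_mult_def to_grpalg_def)
qed

lemma to_grpalg_one: "to_grpalg n 1 = ga_one n"
proof
  fix s
  have "rank_rel n id = rank_rel n (inv s) \<longleftrightarrow> s = id" if "s \<in> perms n"
    using rank_rel_perm_inj[OF perms_id perms_inv[OF that]] that
    by (metis inv_id perms_inv_inv)
  then show "to_grpalg n 1 s = ga_one n s"
    by (auto simp: to_grpalg_def ga_one_def lookup_single when_def perms_id)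
qed

text \<open>The product compares first by blocks of \<open>q\<close> and then by values of
  \<open>s\<close>. It is the natural order exactly if \<open>s\<close> increases within each block,
  that is, descends only at block ends.\<close>

lemma std_rel_plus_eq_id_iff:
  assumes s: "s \<in> perms n"
  shows "std_rel n q + rank_rel n s = rank_rel n id \<longleftrightarrow>
    (\<forall>i. 1 \<le> i \<and> i < n \<and> has_descent s i \<longrightarrow> i \<in> psums q)"
proof
  assume eq: "std_rel n q + rank_rel n s = rank_rel n id"
  show "\<forall>i. 1 \<le> i \<and> i < n \<and> has_descent s i \<longrightarrow> i \<in> psums q"
  proof (intro allI impI, elim conjE, rule ccontr)
    fix i assume i: "1 \<le> i" "i < n" "has_descent s i" "i \<notin> psums q"
    then have "block q (Suc i) = block q i" by (simp add: block_Suc_eq_iff)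
    moreover have "le (std_rel n q + rank_rel n s) i (Suc i)" unfolding eq by simp
    ultimately have "s i \<le> s (Suc i)" using i by (simp add: std_rel_def)
    then show False using i by (simp add: has_descent_def)
  qed
next
  assume D: "\<forall>i. 1 \<le> i \<and> i < n \<and> has_descent s i \<longrightarrow> i \<in> psums q"
  have inc: "s i \<le> s j" if ij: "1 \<le> i" "i \<le> j" "j \<le> n" and b: "block q j \<le> block q i" for i j
  proof -
    have "s i \<le> s (i + d)" if "i + d \<le> j" for d
      using that
    proof (induction d)
      case (Suc d)
      have "block q i \<le> block q (i + d)" "block q (i + d) \<le> block q (Suc (i + d))" "block q (Suc (i + d)) \<le> block q j"
        using Suc.prems by (auto intro!: block_mono)
      then have "i + d \<notin> psums q" using b block_Suc_eq_iff[of q "i + d"] by simp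
      then have "\<not> has_descent s (i + d)" using D Suc.prems ij by auto
      then show ?case using Suc by (simp add: has_descent_def)
    qed simp
    from this[of "j - i"] show ?thesis using ij by simp
  qed
  show "std_rel n q + rank_rel n s = rank_rel n id"
  proof (rule lexrel_eqI)
    fix i j
    show "le (std_rel n q + rank_rel n s) i j \<longleftrightarrow> le (rank_rel n id) i j"
    proof (cases "i \<in> {1..n} \<and> j \<in> {1..n}")
      case True
      show ?thesis
      proof (cases "i \<le> j")
        case le: True
        then show ?thesis using True inc[of i j] block_mono[of i j q] by (auto simp: std_rel_def)
      next
        case False
        have "s i \<noteq> s j" using False perms_bij[OF s] by (metis bij_is_inj injD order_refl)
        then show ?thesis using False True inc[of j i] block_mono[of j i q] by (auto simp: std_rel_def)
      qed
    qed (auto simp: std_rel_def)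
  qed
qed

text \<open>Only one set composition of type \<open>q\<close> can turn the natural order into that
  of \<open>s\<close>, namely \<open>act s (std_rel n q)\<close>, and it does so exactly under the
  descent condition.\<close>

lemma to_grpalg_type_sum: "to_grpalg n (type_sum n q) = Xi n q"
proof
  fix s
  let ?i = "rank_rel n id"
  show "to_grpalg n (type_sum n q) s = Xi n q s"
  proof (cases "s \<in> perms n")
    case s: True
    have acti: "act (inv s) (rank_rel n (inv s)) = ?i" "act (inv s) ?i = rank_rel n s"
    proof -
      have "inv s \<circ> s = id" using s by (simp add: fun_eq_iff)
      then show "act (inv s) (rank_rel n (inv s)) = ?i" "act (inv s) ?i = rank_rel n s"
        using s by (simp_all add: act_rank_rel perms_inv perms_inv_inv)
    qed
    have conj: "k + ?i = rank_rel n (inv s) \<longleftrightarrow> act (inv s) k + rank_rel n s = ?i" for k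
      using act_inj[OF perms_inv[OF s], of "k + ?i" "rank_rel n (inv s)"] by (simp add: acti act_plus)
    have *: "k = act s (std_rel n q)" if k: "k \<in> of_type n q" "k + ?i = rank_rel n (inv s)" for k
    proof -
      have "act (inv s) k = std_rel n q"
      proof (rule of_type_monotone)
        show "act (inv s) k \<in> of_type n q" using act_in_of_type[OF perms_inv[OF s] k(1)] .
        fix i j :: nat assume "i \<le> j"
        then have "le (act (inv s) k + rank_rel n s) i j" using conj[of k] k(2) by simp
        then show "le (act (inv s) k) i j" by simp
      qed
      then show ?thesis using act_inv(2)[OF s, of k] by simp
    qed
    let ?Q = "std_rel n q + rank_rel n s = ?i"
    have "to_grpalg n (type_sum n q) s
      = (\<Sum>a\<in>set_comps n. if a = act s (std_rel n q) then (if ?Q then 1 else 0) else 0)"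
      unfolding to_grpalg_apply[OF invariants_keys[OF type_sum_invariant] s]
    proof (rule sum.cong[OF refl])
      fix a
      show "(if a + ?i = rank_rel n (inv s) then lookup (type_sum n q) a else 0)
        = (if a = act s (std_rel n q) then if ?Q then 1 else 0 else 0)"
      proof (cases "a = act s (std_rel n q)")
        case True
        then have "a \<in> of_type n q" using act_in_of_type[OF s std_rel_in_of_type] by simp
        then show ?thesis using True conj[of a] act_inv(1)[OF s] by (simp add: lookup_type_sum)
      next
        case False
        then show ?thesis using *[of a] by (auto simp: lookup_type_sum)
      qed
    qed
    also have "\<dots> = (if ?Q then 1 else 0)"
      using act_in_set_comps[OF s std_rel_in_set_comps] by (simp add: sum.delta')
    finally show ?thesis using s unfolding std_rel_plus_eq_id_iff[OF s] by (simp add: Xi_def)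
  qed (simp add: to_grpalg_def Xi_def)
qed

section \<open>Solomon's epimorphism\<close>

text \<open>A support element with fewest ties is moved within its orbit to \<open>k0\<close>, whose
  blocks are intervals in decreasing order. Any \<open>a\<close> that refines to the same linear
  order as \<open>k0\<close> has all its ties among those of \<open>k0\<close>; by minimality only
  \<open>k0\<close> itself can lie in the support, so its coefficient appears alone.\<close>

lemma to_grpalg_eq_zero:
  assumes n: "n \<ge> 1" and z: "z \<in> invariants n" and zero: "to_grpalg n z = 0"
  shows "z = 0"
proof (rule ccontr)
  assume "z \<noteq> 0"
  then have ne: "keys z \<noteq> {}" by simp
  let ?i = "rank_rel n id"
  define k where "k = arg_min_on (\<lambda>k. card (sim n k)) (keys z)"
  have k: "k \<in> keys z" unfolding k_def using ne by (intro arg_min_if_finite) simp_all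
  have kmin: "card (sim n k) \<le> card (sim n k')" if "k' \<in> keys z" for k'
    unfolding k_def using that by (intro arg_min_least) (auto simp: ne)
  obtain q where q: "q \<in> comps n" "k \<in> of_type n q"
    using ex_type_of_set_comp[OF n] k invariants_keys[OF z] by blast
  obtain g where g: "g \<in> perms n" "k = act g (std_rel n q)" using q(2) by (auto simp: of_type_eq_orbit)
  define r where "r = (\<lambda>i. if i \<in> {1..n} then n + 1 - i else i)"
  have "r permutes {1..n}"
  proof (rule bij_imp_permutes)
    show "bij_betw r {1..n} {1..n}"
      by (rule bij_betw_byWitness[of _ r]) (auto simp: r_def)
  qed (auto simp: r_def)
  then have r: "r \<in> perms n" by (simp add: perms_def)
  have rr: "inv r = r"
  proof (rule inv_unique_comp)
    show "r \<circ> r = id" "r \<circ> r = id" by (auto simp: r_def fun_eq_iff)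
  qed
  txt \<open>Moving the blocks into reversed order makes the lexicographic refinement by \<open>\<le>\<close>
    remember all of them.\<close>
  define k0 where "k0 = act r (std_rel n q)"
  have k0T: "k0 \<in> set_comps n" unfolding k0_def by (simp add: act_in_set_comps r)
  have k0z: "lookup z k0 = lookup z k"
    unfolding k0_def g(2) by (simp add: invariants_lookup[OF z] r g)
  have cards: "card (sim n k0) = card (sim n k)"
    unfolding k0_def g(2) by (simp add: card_sim_act r g)
  have strict: "j < i" if "i \<in> {1..n}" "j \<in> {1..n}" "\<not> le k0 j i" for i j
  proof (rule ccontr)
    assume "\<not> j < i"
    then have "r j \<le> r i" using that by (simp add: r_def)
    then show False using that(3) le_std_rel by (simp add: k0_def rr)
  qed
  have tot: "le a i j \<or> le a j i" if "a \<in> set_comps n" for a i j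
    using that by (elim set_compsE) auto
  obtain s where s: "s \<in> perms n" "k0 + ?i = rank_rel n (inv s)" using plus_linear_order[OF k0T] .
  have only: "a = k0 \<or> lookup z a = 0" if a: "a \<in> set_comps n" "a + ?i = rank_rel n (inv s)" for a
  proof -
    have eq: "a + ?i = k0 + ?i" using a s by simp
    have sub: "sim n a \<subseteq> sim n k0"
    proof
      fix x assume "x \<in> sim n a"
      then obtain i j where ij: "x = (i, j)" "i \<in> {1..n}" "j \<in> {1..n}" "le a i j" "le a j i"
        by (auto simp: sim_def)
      have "le k0 v u" if uv: "u \<in> {1..n}" "v \<in> {1..n}" "le a u v" "le a v u" for u v
      proof (rule ccontr)
        assume nle: "\<not> le k0 v u"
        then have "le k0 u v" using tot[OF k0T] by blast
        then have "le (k0 + ?i) u v" using nle by simp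
        then have "le (a + ?i) u v" using eq by simp
        then have "u \<le> v" using uv by simp
        then show False using strict[OF uv(1,2) nle] by simp
      qed
      then show "x \<in> sim n k0" using ij by (simp add: sim_def)
    qed
    show ?thesis
    proof (cases "sim n a = sim n k0")
      case True
      \<comment> \<open>A set composition is recovered from its ties and its refinement by the
        natural order.\<close>
      have char: "le b i j \<longleftrightarrow> (i, j) \<in> sim n b \<or> le (b + ?i) i j"
        if "b \<in> set_comps n" "i \<in> {1..n}" "j \<in> {1..n}" for b i j
        using that by (auto simp: sim_def)
      have "a = k0"
      proof (rule lexrel_eqI)
        fix i j
        show "le a i j \<longleftrightarrow> le k0 i j"
        proof (cases "i \<in> {1..n} \<and> j \<in> {1..n}")
          case ij: True
          then have "le a i j \<longleftrightarrow> (i, j) \<in> sim n k0 \<or> le (k0 + ?i) i j"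
            unfolding True[symmetric] eq[symmetric] using char[OF a(1)] by blast
          moreover have "le k0 i j \<longleftrightarrow> (i, j) \<in> sim n k0 \<or> le (k0 + ?i) i j"
            using ij char[OF k0T] by blast
          ultimately show ?thesis by blast
        next
          case False
          then have "le a i j" "le k0 i j" using a(1) k0T by (auto elim!: set_compsE)
          then show ?thesis by simp
        qed
      qed
      then show ?thesis ..
    next
      case False
      then have "sim n a \<subset> sim n k0" using sub by blast
      then have "card (sim n a) < card (sim n k)" unfolding cards[symmetric]
        by (rule psubset_card_mono[OF finite_sim])
      then have "a \<notin> keys z" using kmin by force
      then show ?thesis by (simp add: in_keys_iff)
    qed
  qed
  have "0 = to_grpalg n z s" using zero by simp
  also have "\<dots> = (\<Sum>a\<in>set_comps n. if a = k0 then lookup z a else 0)"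
    unfolding to_grpalg_apply[OF invariants_keys[OF z] s(1)]
    by (rule sum.cong[OF refl]) (use only s in auto)
  also have "\<dots> = lookup z k0" using k0T by (simp add: sum.delta)
  finally show False using k0z k by (simp add: in_keys_iff)
qed

lemma to_grpalg_inj:
  assumes "n \<ge> 1" "x \<in> invariants n" "y \<in> invariants n" "to_grpalg n x = to_grpalg n y"
  shows "x = y"
  using to_grpalg_eq_zero[OF assms(1) invariants_diff[OF assms(2,3)]] assms(4)
  by (simp add: to_grpalg_diff)

lemma comps_sum_invariant: "(\<Sum>q\<in>I. scale (c q) (type_sum n q)) \<in> invariants n"
  by (intro invariants_sum invariants_scale type_sum_invariant)

lemma to_grpalg_comps_sum:
  "to_grpalg n (\<Sum>q\<in>I. scale (c q) (type_sum n q)) = (\<Sum>q\<in>I. smul (c q) (Xi n q))"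
  by (simp add: to_grpalg_sum to_grpalg_scale to_grpalg_type_sum)

lemma descent_alg_eq:
  assumes "n \<ge> 1"
  shows "descent_alg n = to_grpalg n ` invariants n"
proof (intro equalityI subsetI)
  fix x :: "'a grpalg" assume "x \<in> descent_alg n"
  then obtain c where "x = (\<Sum>q\<in>comps n. smul (c q) (Xi n q))" by (auto simp: descent_alg_def)
  then show "x \<in> to_grpalg n ` invariants n"
    unfolding to_grpalg_comps_sum[symmetric] using comps_sum_invariant by blast
next
  fix x :: "'a grpalg" assume "x \<in> to_grpalg n ` invariants n"
  then obtain y where y: "y \<in> invariants n" "x = to_grpalg n y" by blast
  then have "x = (\<Sum>q\<in>comps n. smul (lookup y (std_rel n q)) (Xi n q))"
    using invariants_decomp[OF assms y(1)] to_grpalg_comps_sum by metis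
  then show "x \<in> descent_alg n"
    unfolding descent_alg_def by (intro CollectI exI[of _ "\<lambda>q. lookup y (std_rel n q)"])
qed

definition graph :: "nat \<Rightarrow> (nat \<Rightarrow> nat) \<Rightarrow> (nat \<times> nat) set" where
  "graph n s = (\<lambda>i. (i, s i)) ` {1..n}"

lemma graph_subset: "s \<in> perms n \<Longrightarrow> graph n s \<subseteq> {1..n} \<times> {1..n}"
  using perms_in_iff[of s n] unfolding graph_def by blast

lemma graph_subset_sim_iff:
  "s \<in> perms n \<Longrightarrow> k \<in> set_comps n \<Longrightarrow> graph n s \<subseteq> sim n k \<longleftrightarrow> act s k = k"
  unfolding graph_def by (subst act_fixes_iff) auto

lemma chi_graph_type_sum:
  assumes "s \<in> perms n"
  shows "chi n (graph n s) (type_sum n q) = of_nat (card {k \<in> of_type n q. act s k = k})"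
proof -
  have "{k \<in> of_type n q. graph n s \<subseteq> sim n k} = {k \<in> of_type n q. act s k = k}"
    using graph_subset_sim_iff[OF assms] of_type_subset by blast
  then show ?thesis by (simp add: chi_type_sum)
qed

text \<open>\<open>to_grpalg\<close> is injective on invariants and types are disjoint, so the
  coefficients \<open>c\<close> are unique; this makes the definite description in
  \<open>solomon\<close> meaningful.\<close>

lemma solomon_to_grpalg:
  fixes x :: "lexrel \<Rightarrow>\<^sub>0 'a::field"
  assumes n: "n \<ge> 1" and x: "x \<in> invariants n"
  shows "solomon n (to_grpalg n x) = (\<lambda>s. if s \<in> perms n then chi n (graph n s) x else 0)"
  unfolding solomon_def
proof (rule the_equality)
  let ?c = "\<lambda>q. lookup x (std_rel n q)"
  note dec = invariants_decomp[OF n x]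
  have y: "(\<lambda>s. if s \<in> perms n then chi n (graph n s) x else 0) = (\<Sum>q\<in>comps n. smul (?c q) (perm_char n q))"
  proof
    fix s
    show "(if s \<in> perms n then chi n (graph n s) x else 0) = (\<Sum>q\<in>comps n. smul (?c q) (perm_char n q)) s"
    proof (cases "s \<in> perms n")
      case True
      have "chi n (graph n s) x = (\<Sum>q\<in>comps n. ?c q * chi n (graph n s) (type_sum n q))"
        by (subst dec) (simp add: chi_sum chi_scale[OF graph_subset[OF True]])
      also have "\<dots> = (\<Sum>q\<in>comps n. ?c q * perm_char n q s)"
        by (intro sum.cong refl) (simp add: chi_graph_type_sum True perm_char_eq)
      finally show ?thesis using True by (simp add: sum_fun_apply smul_def)
    next
      case False
      then show ?thesis by (simp add: sum_fun_apply smul_def perm_char_def)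
    qed
  qed
  have X: "to_grpalg n x = (\<Sum>q\<in>comps n. smul (?c q) (Xi n q))"
    by (subst dec) (rule to_grpalg_comps_sum)
  show "\<exists>c. to_grpalg n x = (\<Sum>q\<in>comps n. smul (c q) (Xi n q)) \<and>
      (\<lambda>s. if s \<in> perms n then chi n (graph n s) x else 0) = (\<Sum>q\<in>comps n. smul (c q) (perm_char n q))"
    using X y by (intro exI[of _ ?c] conjI)
  fix z assume "\<exists>c. to_grpalg n x = (\<Sum>q\<in>comps n. smul (c q) (Xi n q)) \<and>
      z = (\<Sum>q\<in>comps n. smul (c q) (perm_char n q))"
  then obtain c where c: "to_grpalg n x = (\<Sum>q\<in>comps n. smul (c q) (Xi n q))"
    "z = (\<Sum>q\<in>comps n. smul (c q) (perm_char n q))" by blast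
  have "x = (\<Sum>q\<in>comps n. scale (c q) (type_sum n q))"
    by (rule to_grpalg_inj[OF n x comps_sum_invariant]) (simp add: c(1) to_grpalg_comps_sum)
  then have "?c r = (\<Sum>q\<in>comps n. if std_rel n r \<in> of_type n q then c q else 0)" for r
    by (simp add: lookup_sum lookup_type_sum if_distrib[of "\<lambda>z. _ * z"] cong: if_cong)
  moreover have "std_rel n r \<in> of_type n q \<longleftrightarrow> q = r" if "q \<in> comps n" "r \<in> comps n" for q r
    using of_type_disjoint[OF that] by auto
  ultimately have "?c r = c r" if "r \<in> comps n" for r
    using that by (simp add: sum.delta cong: sum.cong if_cong)
  then show "z = (\<lambda>s. if s \<in> perms n then chi n (graph n s) x else 0)"
    unfolding y c(2) by (intro sum.cong) simp_all
qed

lemma of_nat_eq_if_mod_CHAR_eq: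
  assumes "a mod CHAR('a::field) = b mod CHAR('a)"
  shows "(of_nat a :: 'a) = of_nat b"
proof -
  have "(of_nat c :: 'a) = of_nat (c mod CHAR('a))" for c
  proof -
    have "(of_nat c :: 'a) = of_nat (CHAR('a) * (c div CHAR('a)) + c mod CHAR('a))" by simp
    then show ?thesis by (simp only: of_nat_add of_nat_mult of_nat_CHAR) simp
  qed
  then show ?thesis using assms by metis
qed

lemma act_funpow: "s \<in> perms n \<Longrightarrow> act (s ^^ j) k = (act s ^^ j) k"
  by (induction j) (simp_all add: act_comp perms_funpow del: act_id flip: id_def, simp add: id_def[symmetric])

text \<open>On the set compositions of type \<open>q\<close> fixed by \<open>?t\<close>, a
  \<open>p\<close>-power of \<open>act s\<close> is the identity, since \<open>s\<close> and
  \<open>?t\<close> have the same \<open>p ^ A\<close>-th power. The fixed points of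
  \<open>s\<close> among them are all fixed points of \<open>s\<close> of that type, so both counts
  agree modulo \<open>p\<close>.\<close>

lemma chi_graph_funpow_p'_exponent:
  fixes x :: "lexrel \<Rightarrow>\<^sub>0 'a::field"
  assumes n: "n \<ge> 1" and x: "x \<in> invariants n" and p: "prime p" "CHAR('a) = p" and s: "s \<in> perms n"
  shows "chi n (graph n (s ^^ p'_exponent p n)) x = chi n (graph n s) x"
proof -
  let ?t = "s ^^ p'_exponent p n"
  note t = perms_funpow[OF s, of "p'_exponent p n"]
  obtain A where A: "?t ^^ (p ^ A) = s ^^ (p ^ A)"
    using funpow_p'_exponent_power[OF p(1) s] by blast
  have ts: "chi n (graph n ?t) (type_sum n q :: lexrel \<Rightarrow>\<^sub>0 'a) = chi n (graph n s) (type_sum n q)" for q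
  proof -
    let ?X = "{k \<in> of_type n q. act ?t k = k}"
    have "card ?X mod p = card {k \<in> ?X. act s k = k} mod p"
    proof (rule card_mod_eq_card_fixpoints_prime_power[OF p(1), of _ _ A])
      have comm: "?t \<circ> s = s \<circ> ?t" by (simp only: funpow_Suc_right[symmetric] funpow.simps(2)[symmetric])
      show "act s k \<in> ?X" if "k \<in> ?X" for k
        using that act_in_of_type[OF s] act_comp[OF t s, of k] act_comp[OF s t, of k] comm by simp
      show "(act s ^^ (p ^ A)) k = k" if "k \<in> ?X" for k
      proof -
        have "(act s ^^ (p ^ A)) k = (act ?t ^^ (p ^ A)) k"
          unfolding act_funpow[OF s, symmetric] act_funpow[OF t, symmetric] A ..
        also have "(act ?t ^^ j) k = k" for j using that by (induction j) auto
        finally show ?thesis .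
      qed
    qed simp
    moreover have "{k \<in> ?X. act s k = k} = {k \<in> of_type n q. act s k = k}"
    proof -
      have "act ?t k = k" if "act s k = k" for k
      proof -
        have "(act s ^^ j) k = k" for j using that by (induction j) auto
        then show ?thesis by (simp add: act_funpow[OF s])
      qed
      then show ?thesis by blast
    qed
    ultimately show ?thesis
      unfolding chi_graph_type_sum[OF s] chi_graph_type_sum[OF t]
      by (intro of_nat_eq_if_mod_CHAR_eq) (simp add: p)
  qed
  show ?thesis
    using ts by (subst (1 2) invariants_decomp[OF n x])
      (simp add: chi_sum chi_scale[OF graph_subset[OF s]] chi_scale[OF graph_subset[OF t]])
qed

lemma chi_act_reindex:
  assumes x: "x \<in> invariants n" and g: "g \<in> perms n"
    and R: "\<And>k. k \<in> set_comps n \<Longrightarrow> R' \<subseteq> sim n (act g k) \<longleftrightarrow> R \<subseteq> sim n k"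
  shows "chi n R' x = chi n R x"
proof -
  note T = finite_set_comps[of n] and xk = invariants_keys[OF x]
  have "chi n R' x = (\<Sum>k\<in>set_comps n. if R' \<subseteq> sim n (act g k) then lookup x (act g k) else 0)"
    unfolding chi_superset[OF T xk]
    by (rule sum.reindex_bij_betw[OF bij_betw_act_set_comps[OF g], symmetric])
  also have "\<dots> = (\<Sum>k\<in>set_comps n. if R \<subseteq> sim n k then lookup x k else 0)"
    by (intro sum.cong refl) (simp add: R invariants_lookup[OF x g])
  finally show ?thesis unfolding chi_superset[OF T xk] .
qed

lemma chi_graph_conj:
  assumes x: "x \<in> invariants n" and s: "s \<in> perms n" and "conj_in n s t"
  shows "chi n (graph n t) x = chi n (graph n s) x"
proof -
  obtain g where g: "g \<in> perms n" "t = inv g \<circ> s \<circ> g" using assms(3) by (auto simp: conj_in_def)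
  have t: "t \<in> perms n" using g s by (simp add: perms_comp perms_inv)
  have "chi n (graph n s) x = chi n (graph n t) x"
  proof (rule chi_act_reindex[OF x g(1)])
    fix k assume k: "k \<in> set_comps n"
    have "act t k = act (inv g) (act s (act g k))"
      unfolding g(2) act_comp[OF perms_comp[OF perms_inv[OF g(1)] s] g(1)] act_comp[OF perms_inv[OF g(1)] s] ..
    then have "act s (act g k) = act g k \<longleftrightarrow> act t k = k"
      using act_inv[OF g(1)] by metis
    then show "graph n s \<subseteq> sim n (act g k) \<longleftrightarrow> graph n t \<subseteq> sim n k"
      using graph_subset_sim_iff[OF s act_in_set_comps[OF g(1) k]] graph_subset_sim_iff[OF t k] by simp
  qed
  then show ?thesis by simp
qed

lemma sim_act_subset_iff:
  assumes g: "g \<in> perms n"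
  shows "sim n (act g a) \<subseteq> sim n (act g b) \<longleftrightarrow> sim n a \<subseteq> sim n b"
proof
  assume sub: "sim n (act g a) \<subseteq> sim n (act g b)"
  show "sim n a \<subseteq> sim n b"
  proof
    fix x assume "x \<in> sim n a"
    then obtain i j where x: "x = (i, j)" "(i, j) \<in> sim n a" by (cases x) simp
    then have "(g i, g j) \<in> sim n (act g a)" by (simp add: sim_act[OF g] perms_inv_apply[OF g])
    then have "(g i, g j) \<in> sim n (act g b)" using sub by blast
    then show "x \<in> sim n b" using x by (simp add: sim_act[OF g] perms_inv_apply[OF g])
  qed
next
  assume "sim n a \<subseteq> sim n b"
  then show "sim n (act g a) \<subseteq> sim n (act g b)"
    using sim_act[OF g] by (auto simp only: subset_iff split_paired_All)
qed

lemma chi_sim_of_type: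
  assumes x: "x \<in> invariants n" and k: "k \<in> of_type n q"
  shows "chi n (sim n k) x = chi n (sim n (std_rel n q)) x"
proof -
  obtain g where g: "g \<in> perms n" "k = act g (std_rel n q)" using k by (auto simp: of_type_eq_orbit)
  show ?thesis unfolding g(2)
    by (rule chi_act_reindex[OF x g(1)]) (rule sim_act_subset_iff[OF g(1)])
qed

section \<open>Class values at p-regular partitions\<close>

lemma power_mult_if_commute:
  fixes x y :: "'b::monoid_mult"
  assumes "x * y = y * x" shows "(x * y) ^ m = x ^ m * y ^ m"
proof (induction m)
  case (Suc m)
  have "y * x ^ m = x ^ m * y" using assms power_commuting_commutes by metis
  then show ?case using Suc by (metis mult.assoc power_Suc)
qed simp

text \<open>The geometric sum in \<open>1 - u\<close> is a cofactor on either side. Having the same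
  \<open>r\<close> on both sides gives the commutation in the lifting lemma and, later,
  orthogonality on both sides.\<close>

lemma one_diff_power_factor:
  fixes u :: "'b::ring_1"
  obtains r where "1 - (1 - u) ^ m = u * r" "1 - (1 - u) ^ m = r * u"
proof -
  have "1 - (1 - u) ^ m = u * (\<Sum>i<m. (1 - u) ^ i) \<and> 1 - (1 - u) ^ m = (\<Sum>i<m. (1 - u) ^ i) * u"
  proof (induction m)
    case (Suc m)
    let ?A = "\<Sum>i<m. (1 - u) ^ i"
    have "1 - (1 - u) ^ Suc m = (1 - (1 - u) ^ m) + u * (1 - u) ^ m" by (simp add: algebra_simps)
    also have "\<dots> = u * ?A + u * (1 - u) ^ m" using Suc by simp
    also have "\<dots> = u * (\<Sum>i<Suc m. (1 - u) ^ i)" by (simp add: distrib_left)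
    finally have 1: "1 - (1 - u) ^ Suc m = u * (\<Sum>i<Suc m. (1 - u) ^ i)" .
    have "1 - (1 - u) ^ Suc m = (1 - (1 - u) ^ m) + (1 - u) ^ m * u"
      unfolding power_Suc2 by (simp add: algebra_simps)
    also have "1 - (1 - u) ^ m = ?A * u" using Suc by blast
    also have "?A * u + (1 - u) ^ m * u = (\<Sum>i<Suc m. (1 - u) ^ i) * u" by (simp add: distrib_right)
    finally show ?case using 1 by blast
  qed simp
  then show ?thesis using that by blast
qed

text \<open>Lifting of idempotents modulo a nilpotent element: \<open>1 - (1 - h\<^sup>m)\<^sup>m\<close> is a multiple of \<open>h\<close>,
  and its complement is a multiple of \<open>(1 - h)\<^sup>m\<close>.\<close>
lemma idempotent_lift:
  fixes h :: "'b::ring_1"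
  assumes nil: "(h * (1 - h)) ^ m = 0"
  shows "(1 - (1 - h ^ m) ^ m) * (1 - (1 - h ^ m) ^ m) = 1 - (1 - h ^ m) ^ m"
proof -
  have c: "h * (1 - h) = (1 - h) * h" by (simp add: algebra_simps)
  obtain t where t: "1 - (1 - (1 - h)) ^ m = (1 - h) * t" "1 - (1 - (1 - h)) ^ m = t * (1 - h)"
    by (rule one_diff_power_factor)
  then have t': "1 - h ^ m = (1 - h) * t" and ct: "(1 - h) * t = t * (1 - h)" by simp_all
  obtain r where r: "1 - (1 - h ^ m) ^ m = r * h ^ m" using one_diff_power_factor by blast
  have "h ^ m * (1 - h ^ m) ^ m = h ^ m * ((1 - h) ^ m * t ^ m)"
    unfolding t' power_mult_if_commute[OF ct] ..
  also have "\<dots> = (h * (1 - h)) ^ m * t ^ m"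
    unfolding power_mult_if_commute[OF c] by (simp add: mult.assoc)
  finally have "h ^ m * (1 - h ^ m) ^ m = 0" using nil by simp
  then have "(1 - (1 - h ^ m) ^ m) * (1 - h ^ m) ^ m = 0" unfolding r by (simp add: mult.assoc)
  then show ?thesis by (simp add: right_diff_distrib)
qed

section \<open>Class values and the \<open>p\<close>-regular partitions\<close>

text \<open>For a composition this is the sum of the squares of its parts, a number that drops under
  proper refinement and ignores rearrangement.\<close>

definition type_rank :: "nat \<Rightarrow> nat list \<Rightarrow> nat" where
  "type_rank n l = card (sim n (std_rel n l))"

text \<open>The value of the image under Solomon's epimorphism at permutations of cycle type \<open>l\<close>.\<close>
definition class_value :: "nat \<Rightarrow> (lexrel \<Rightarrow>\<^sub>0 'a::field) \<Rightarrow> nat list \<Rightarrow> 'a" where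
  "class_value n x l = chi n (sim n (std_rel n l)) x"

lemma class_value_add: "class_value n (x + y) l = class_value n x l + class_value n y l"
  and class_value_diff: "class_value n (x - y) l = class_value n x l - class_value n y l"
  and class_value_mult: "class_value n (x * y) l = class_value n x l * class_value n y l"
  and class_value_sum: "class_value n (\<Sum>i\<in>I. f i) l = (\<Sum>i\<in>I. class_value n (f i) l)"
  and class_value_zero: "class_value n 0 l = 0"
  by (simp_all add: class_value_def chi_add chi_diff chi_mult chi_sum)

lemma class_value_one: "class_value n 1 l = 1"
  unfolding class_value_def by (rule chi_one[OF sim_subset])

lemma class_value_scale: "class_value n (scale c x) l = c * class_value n x l"
  unfolding class_value_def by (rule chi_scale[OF sim_subset])

lemma class_value_power: "class_value n (x ^ j) l = class_value n x l ^ j"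
  unfolding class_value_def by (rule chi_power[OF sim_subset])

lemma class_value_type_sum_self:
  "l \<in> comps n \<Longrightarrow> class_value n (type_sum n l) l = of_nat (brfact l)"
  by (simp add: class_value_def chi_type_sum card_of_type_sim)

lemma partitions_comps: "l \<in> partitions n \<Longrightarrow> l \<in> comps n"
  by (simp add: partitions_def)

lemma partition_eq_if_mset_eq:
  assumes "l \<in> partitions n" "m \<in> partitions n" "mset l = mset m"
  shows "l = m"
proof -
  have "sorted (rev l)" "sorted (rev m)" using assms by (auto simp: partitions_def sorted_wrt_rev)
  then have "rev l = rev m" using assms(3) by (metis mset_rev properties_for_sort)
  then show ?thesis by simp
qed

text \<open>A nonzero value requires some \<open>b\<close> of type \<open>l\<close> whose blocks are
  unions of those of \<open>std_rel n m\<close>. Either the blocks are the same, or \<open>b\<close>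
  has strictly more tied pairs.\<close>

lemma class_value_type_sum_nonzero:
  assumes l: "l \<in> partitions n" and m: "m \<in> partitions n"
    and nz: "class_value n (type_sum n l) m \<noteq> (0 :: 'a::field)"
  shows "m = l \<or> type_rank n m < type_rank n l"
proof -
  have "card {b \<in> of_type n l. sim n (std_rel n m) \<subseteq> sim n b} \<noteq> 0"
    using nz unfolding class_value_def chi_type_sum by (metis of_nat_0)
  then have "{b \<in> of_type n l. sim n (std_rel n m) \<subseteq> sim n b} \<noteq> {}" by (metis card.empty)
  then obtain b where b: "b \<in> of_type n l" "sim n (std_rel n m) \<subseteq> sim n b" by blast
  show ?thesis
  proof (cases "sim n (std_rel n m) = sim n b")
    case True
    then have "mset m = mset l"
      using mset_eq_if_sim_eq[OF partitions_comps[OF m] partitions_comps[OF l] std_rel_in_of_type b(1)] by simp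
    then show ?thesis using partition_eq_if_mset_eq[OF m l] by simp
  next
    case False
    then have "sim n (std_rel n m) \<subset> sim n b" using b by blast
    then have "type_rank n m < card (sim n b)"
      unfolding type_rank_def by (rule psubset_card_mono[OF finite_sim])
    also have "card (sim n b) = type_rank n l"
      using b(1) by (auto simp: of_type_eq_orbit card_sim_act type_rank_def)
    finally show ?thesis by simp
  qed
qed

lemma ex_perm_of_comp:
  assumes l: "l \<in> comps n"
  obtains \<sigma> where "\<sigma> \<in> perms n" "cycle_type n \<sigma> = mset l"
    "\<And>x :: lexrel \<Rightarrow>\<^sub>0 'a::field. keys x \<subseteq> set_comps n \<Longrightarrow> chi n (graph n \<sigma>) x = class_value n x l"
proof -
  obtain \<sigma> where s: "\<sigma> \<in> perms n"
    "\<And>b. b \<in> set_comps n \<Longrightarrow> (\<forall>i\<in>{1..n}. (i, \<sigma> i) \<in> sim n b) \<longleftrightarrow> sim n (std_rel n l) \<subseteq> sim n b"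
    "cycle_type n \<sigma> = class_sizes n (sim n (std_rel n l))"
    by (rule ex_perm_of_set_comp[OF std_rel_in_set_comps[of n l]]) blast
  have "graph n \<sigma> \<subseteq> sim n b \<longleftrightarrow> sim n (std_rel n l) \<subseteq> sim n b" if "b \<in> set_comps n" for b
    unfolding s(2)[OF that, symmetric] graph_def by blast
  then have "chi n (graph n \<sigma>) x = class_value n x l" if "keys x \<subseteq> set_comps n" for x :: "lexrel \<Rightarrow>\<^sub>0 'a"
    unfolding class_value_def chi_superset[OF finite_set_comps that] by (intro sum.cong) simp_all
  then show ?thesis using that s(1,3) class_sizes_sim[OF l std_rel_in_of_type] by metis
qed

text \<open>The number of fixed points of the \<open>j\<close>-th power of the \<open>p'\<close>-part of a permutation of cycle
  type \<open>M\<close>.\<close>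
definition p'_profile :: "nat \<Rightarrow> nat \<Rightarrow> nat multiset \<Rightarrow> nat \<Rightarrow> nat" where
  "p'_profile p n M j = (\<Sum>L\<in>#M. if L dvd p'_exponent p n * j then L else 0)"

lemma conj_in_if_p'_profile_eq:
  assumes s: "s \<in> perms n" and t: "t \<in> perms n"
    and eq: "p'_profile p n (cycle_type n s) = p'_profile p n (cycle_type n t)"
  shows "conj_in n (s ^^ p'_exponent p n) (t ^^ p'_exponent p n)"
proof (rule conj_in_if_cycle_type_eq)
  let ?K = "p'_exponent p n"
  show "s ^^ ?K \<in> perms n" "t ^^ ?K \<in> perms n" using s t by (simp_all add: perms_funpow)
  have fix_count: "card {x \<in> {1..n}. ((u ^^ ?K) ^^ j) x = x} = p'_profile p n (cycle_type n u) j"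
    if "u \<in> perms n" for u j
    using card_fixpoints_funpow[OF that, of "?K * j"]
    by (simp add: p'_profile_def funpow_mult mult.commute)
  show "cycle_type n (s ^^ ?K) = cycle_type n (t ^^ ?K)"
    by (intro cycle_type_eqI perms_funpow s t) (simp only: fix_count[OF s] fix_count[OF t] eq)
qed

lemma p_regular_imp_partition: "l \<in> p_regular_partitions p n \<Longrightarrow> l \<in> partitions n"
  by (simp add: p_regular_partitions_def)

lemma ex_p_regular_partition:
  assumes p: "prime p" and s: "s \<in> perms n"
  obtains \<nu> where "\<nu> \<in> p_regular_partitions p n"
    "p'_profile p n (cycle_type n s) = p'_profile p n (mset \<nu>)"
proof -
  obtain M where M: "0 \<notin># M" "\<Sum>\<^sub># M = n" "\<forall>i. count M i < p"
    "\<forall>j. p'_profile p n (cycle_type n s) j = p'_profile p n M j"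
    using ex_p_regular_multiset[OF p cycle_type_pos[OF s] sum_mset_cycle_type[OF s]]
    unfolding p'_profile_def by blast
  define \<nu> where "\<nu> = rev (sorted_list_of_multiset M)"
  have ms: "mset \<nu> = M" by (simp add: \<nu>_def)
  have "sorted_wrt (\<ge>) \<nu>" by (simp add: \<nu>_def sorted_wrt_rev)
  moreover have "sum_list \<nu> = n" using M(2) ms by (metis sum_mset_sum_list)
  moreover have "\<forall>x\<in>set \<nu>. 0 < x" using M(1) ms by (metis gr0I set_mset_mset)
  ultimately have "\<nu> \<in> p_regular_partitions p n"
    using M(3) ms by (simp add: p_regular_partitions_def partitions_def comps_def)
  then show ?thesis using that M(4) ms by blast
qed

lemma of_nat_brfact_nonzero:
  assumes p: "prime p" "CHAR('a::field) = p" and l: "l \<in> p_regular_partitions p n"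
  shows "(of_nat (brfact l) :: 'a) \<noteq> 0"
proof
  assume "(of_nat (brfact l) :: 'a) = 0"
  then have "p dvd brfact l" using p by (simp add: of_nat_eq_0_iff_char_dvd)
  then obtain i where "p dvd fact (count (mset l) i)"
    unfolding brfact_def using p(1) by (auto simp: prime_dvd_prod_iff)
  then have "p \<le> count (mset l) i" using p(1) by (simp add: prime_dvd_fact_iff)
  moreover have "count (mset l) i < p" using l by (simp add: p_regular_partitions_def)
  ultimately show False by simp
qed

context
  fixes p n :: nat
  assumes n: "n \<ge> 1" and p: "prime p" and char_p: "CHAR('a::field) = p"
begin

text \<open>Character values do not change on passing to \<open>p'\<close>-parts, and those of
  \<open>s\<close> and of a permutation of cycle type \<open>l\<close> are conjugate by equality of
  profiles.\<close>

lemma chi_graph_eq_class_value: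
  fixes x :: "lexrel \<Rightarrow>\<^sub>0 'a"
  assumes x: "x \<in> invariants n" and s: "s \<in> perms n" and l: "l \<in> comps n"
    and eq: "p'_profile p n (cycle_type n s) = p'_profile p n (mset l)"
  shows "chi n (graph n s) x = class_value n x l"
proof -
  obtain \<sigma> where \<sigma>: "\<sigma> \<in> perms n" "cycle_type n \<sigma> = mset l"
    "\<And>x :: lexrel \<Rightarrow>\<^sub>0 'a. keys x \<subseteq> set_comps n \<Longrightarrow> chi n (graph n \<sigma>) x = class_value n x l"
    using ex_perm_of_comp[OF l] by blast
  have "conj_in n (s ^^ p'_exponent p n) (\<sigma> ^^ p'_exponent p n)"
    using conj_in_if_p'_profile_eq[OF s \<sigma>(1)] eq \<sigma>(2) by simp
  then have "chi n (graph n \<sigma>) x = chi n (graph n s) x"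
    using chi_graph_conj[OF x perms_funpow[OF s]] chi_graph_funpow_p'_exponent[OF n x p char_p] s \<sigma>(1)
    by metis
  then show ?thesis using \<sigma>(3) invariants_keys[OF x] by simp
qed

text \<open>The type sum of \<open>l\<close> is nonzero at \<open>l\<close> by regularity, hence
  also at \<open>m\<close>, which forces \<open>m\<close> to have smaller rank if
  \<open>l \<noteq> m\<close>; exchanging the roles gives a contradiction.\<close>

lemma p_regular_eq_if_class_values_eq:
  assumes l: "l \<in> p_regular_partitions p n" and m: "m \<in> p_regular_partitions p n"
    and eq: "\<And>x :: lexrel \<Rightarrow>\<^sub>0 'a. x \<in> invariants n \<Longrightarrow> class_value n x l = class_value n x m"
  shows "l = m"
proof (rule ccontr)
  assume "l \<noteq> m"
  have *: "type_rank n b < type_rank n a"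
    if a: "a \<in> p_regular_partitions p n" and b: "b \<in> p_regular_partitions p n" and "a \<noteq> b"
      and e: "class_value n (type_sum n a :: lexrel \<Rightarrow>\<^sub>0 'a) b = class_value n (type_sum n a) a" for a b
  proof -
    note pa = p_regular_imp_partition[OF a] and pb = p_regular_imp_partition[OF b]
    have "class_value n (type_sum n a :: lexrel \<Rightarrow>\<^sub>0 'a) b \<noteq> 0"
      unfolding e class_value_type_sum_self[OF partitions_comps[OF pa]]
      by (rule of_nat_brfact_nonzero[OF p char_p a])
    then show ?thesis using class_value_type_sum_nonzero[OF pa pb] \<open>a \<noteq> b\<close> by blast
  qed
  show False
    using *[OF l m] *[OF m l] eq[OF type_sum_invariant] \<open>l \<noteq> m\<close> by (metis less_asym)
qed

text \<open>If \<open>s\<close> lies in the class of \<open>l\<close>, all invariants take equal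
  values at \<open>\<nu>\<close> and \<open>l\<close>, and these values separate
  \<open>p\<close>-regular partitions. Conversely, equal profiles make the \<open>p'\<close>-parts
  conjugate.\<close>

lemma char_fun_eq:
  assumes l: "l \<in> p_regular_partitions p n" and s: "s \<in> perms n"
    and \<nu>: "\<nu> \<in> p_regular_partitions p n"
    and eq: "p'_profile p n (cycle_type n s) = p'_profile p n (mset \<nu>)"
  shows "(char_fun p n l s :: 'a) = (if \<nu> = l then 1 else 0)"
proof -
  note lc = partitions_comps[OF p_regular_imp_partition[OF l]]
  note \<nu>c = partitions_comps[OF p_regular_imp_partition[OF \<nu>]]
  have "(\<exists>m\<in>partitions n. mset m = cycle_type n s \<and> p_equiv p n m l) \<longleftrightarrow> \<nu> = l"
  proof
    assume "\<exists>m\<in>partitions n. mset m = cycle_type n s \<and> p_equiv p n m l"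
    then obtain m where m: "mset m = cycle_type n s" "p_equiv p n m l" by blast
    obtain \<sigma> where \<sigma>: "\<sigma> \<in> perms n" "cycle_type n \<sigma> = mset l"
      "\<And>x :: lexrel \<Rightarrow>\<^sub>0 'a. keys x \<subseteq> set_comps n \<Longrightarrow> chi n (graph n \<sigma>) x = class_value n x l"
      using ex_perm_of_comp[OF lc] by blast
    have "conj_in n (p'_part p s) (p'_part p \<sigma>)" using m \<sigma> s by (auto simp: p_equiv_def)
    then have cj: "conj_in n (s ^^ p'_exponent p n) (\<sigma> ^^ p'_exponent p n)"
      by (simp add: p'_part_eq_funpow[OF p s] p'_part_eq_funpow[OF p \<sigma>(1)])
    have "class_value n x \<nu> = class_value n x l" if x: "x \<in> invariants n" for x :: "lexrel \<Rightarrow>\<^sub>0 'a"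
    proof -
      have "class_value n x l = chi n (graph n \<sigma>) x" using \<sigma>(3) invariants_keys[OF x] by simp
      also have "\<dots> = chi n (graph n s) x"
        using cj chi_graph_conj[OF x perms_funpow[OF s]] chi_graph_funpow_p'_exponent[OF n x p char_p] s \<sigma>(1)
        by metis
      also have "\<dots> = class_value n x \<nu>" by (rule chi_graph_eq_class_value[OF x s \<nu>c eq])
      finally show ?thesis by simp
    qed
    then show "\<nu> = l" using p_regular_eq_if_class_values_eq[OF \<nu> l] by blast
  next
    assume "\<nu> = l"
    define m where "m = rev (sorted_list_of_multiset (cycle_type n s))"
    have ms: "mset m = cycle_type n s" by (simp add: m_def)
    have "sum_list m = n" using sum_mset_cycle_type[OF s] ms by (metis sum_mset_sum_list)
    moreover have "\<forall>x\<in>set m. 0 < x" using cycle_type_pos[OF s] ms by (metis gr0I set_mset_mset)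
    ultimately have "m \<in> partitions n" by (simp add: partitions_def comps_def m_def sorted_wrt_rev)
    moreover have "p_equiv p n m l"
      unfolding p_equiv_def
    proof (intro ballI impI)
      fix a b assume ab: "a \<in> perms n" "b \<in> perms n" "cycle_type n a = mset m \<and> cycle_type n b = mset l"
      then have "conj_in n (a ^^ p'_exponent p n) (b ^^ p'_exponent p n)"
        using eq ms \<open>\<nu> = l\<close> by (intro conj_in_if_p'_profile_eq) simp_all
      then show "conj_in n (p'_part p a) (p'_part p b)"
        by (simp add: p'_part_eq_funpow[OF p ab(1)] p'_part_eq_funpow[OF p ab(2)])
    qed
    ultimately show "\<exists>m\<in>partitions n. mset m = cycle_type n s \<and> p_equiv p n m l" using ms by blast
  qed
  then show ?thesis using s by (simp add: char_fun_def)
qed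

lemma solomon_eq_char_fun:
  fixes x :: "lexrel \<Rightarrow>\<^sub>0 'a"
  assumes x: "x \<in> invariants n" and l: "l \<in> p_regular_partitions p n"
    and val: "\<And>\<nu>. \<nu> \<in> p_regular_partitions p n \<Longrightarrow> class_value n x \<nu> = (if \<nu> = l then 1 else 0)"
  shows "solomon n (to_grpalg n x) = char_fun p n l"
proof
  fix s
  show "solomon n (to_grpalg n x) s = char_fun p n l s"
  proof (cases "s \<in> perms n")
    case s: True
    obtain \<nu> where \<nu>: "\<nu> \<in> p_regular_partitions p n" "p'_profile p n (cycle_type n s) = p'_profile p n (mset \<nu>)"
      by (rule ex_p_regular_partition[OF p s])
    have "chi n (graph n s) x = class_value n x \<nu>"
      using chi_graph_eq_class_value[OF x s _ \<nu>(2)] partitions_comps p_regular_imp_partition \<nu>(1) by blast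
    then show ?thesis
      using val[OF \<nu>(1)] char_fun_eq[OF l s \<nu>] s by (simp add: solomon_to_grpalg[OF n x])
  qed (simp add: solomon_to_grpalg[OF n x] char_fun_def)
qed

text \<open>A permutation whose cycle type is the type of \<open>k\<close> has the profile of some
  \<open>p\<close>-regular partition, so vanishing at the regular partitions gives vanishing of the
  character at every \<open>k\<close>.\<close>

lemma nilpotent_if_class_values_zero:
  fixes x :: "lexrel \<Rightarrow>\<^sub>0 'a"
  assumes x: "x \<in> invariants n" and val: "\<And>\<nu>. \<nu> \<in> p_regular_partitions p n \<Longrightarrow> class_value n x \<nu> = 0"
  shows "x ^ Suc (n * n) = 0"
proof (rule nilpotent_if_chi_zero[OF invariants_keys[OF x]])
  fix k assume "k \<in> set_comps n"
  then obtain q where q: "q \<in> comps n" "k \<in> of_type n q" using ex_type_of_set_comp[OF n] by blast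
  obtain \<sigma> where \<sigma>: "\<sigma> \<in> perms n"
    "\<And>x :: lexrel \<Rightarrow>\<^sub>0 'a. keys x \<subseteq> set_comps n \<Longrightarrow> chi n (graph n \<sigma>) x = class_value n x q"
    using ex_perm_of_comp[OF q(1)] by blast
  obtain \<nu> where \<nu>: "\<nu> \<in> p_regular_partitions p n" "p'_profile p n (cycle_type n \<sigma>) = p'_profile p n (mset \<nu>)"
    by (rule ex_p_regular_partition[OF p \<sigma>(1)])
  have "chi n (sim n k) x = class_value n x q" using chi_sim_of_type[OF x q(2)] by (simp add: class_value_def)
  also have "\<dots> = chi n (graph n \<sigma>) x" using \<sigma>(2) invariants_keys[OF x] by simp
  also have "\<dots> = class_value n x \<nu>"
    using chi_graph_eq_class_value[OF x \<sigma>(1) _ \<nu>(2)] partitions_comps p_regular_imp_partition \<nu>(1) by blast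
  finally show "chi n (sim n k) x = 0" using val[OF \<nu>(1)] by simp
qed

lemma idempotent_eq_zero:
  fixes x :: "lexrel \<Rightarrow>\<^sub>0 'a"
  assumes x: "x \<in> invariants n" and idem: "x * x = x"
    and val: "\<And>\<nu>. \<nu> \<in> p_regular_partitions p n \<Longrightarrow> class_value n x \<nu> = 0"
  shows "x = 0"
proof -
  have "x ^ Suc j = x" for j using idem by (induction j) auto
  then show ?thesis using nilpotent_if_class_values_zero[OF x val] by simp
qed

text \<open>The values of orthogonal idempotent summands \<open>y\<close> and \<open>z\<close>
  multiply to 0. Away from \<open>l\<close> they also add to 0, so both vanish; at \<open>l\<close>
  one of them vanishes. That summand has value 0 at all regular partitions and is therefore
  zero.\<close>

lemma primitive_idem_to_grpalg:
  fixes x :: "lexrel \<Rightarrow>\<^sub>0 'a"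
  assumes x: "x \<in> invariants n" and idem: "x * x = x" and l: "l \<in> p_regular_partitions p n"
    and val: "\<And>\<nu>. \<nu> \<in> p_regular_partitions p n \<Longrightarrow> class_value n x \<nu> = (if \<nu> = l then 1 else 0)"
  shows "primitive_idem n (to_grpalg n x)"
proof -
  let ?P = "to_grpalg n :: (lexrel \<Rightarrow>\<^sub>0 'a) \<Rightarrow> 'a grpalg"
  have mult: "ga_mult n (?P y) (?P z) = ?P (y * z)" if "y \<in> invariants n" "z \<in> invariants n" for y z
    using to_grpalg_mult[OF that(1) invariants_keys[OF that(2)]] .
  have "x \<noteq> 0" using val[OF l] by (auto simp: class_value_zero)
  then have "?P x \<noteq> 0" using to_grpalg_eq_zero[OF n x] by blast
  moreover have "False"
    if fg: "f \<in> descent_alg n" "g \<in> descent_alg n" "f \<noteq> 0" "g \<noteq> 0"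
      "idem n f" "idem n g" "ga_mult n f g = 0" "?P x = f + g" for f g
  proof -
    obtain y z where y: "y \<in> invariants n" "f = ?P y" and z: "z \<in> invariants n" "g = ?P z"
      using fg(1,2) unfolding descent_alg_eq[OF n] by blast
    have yy: "y * y = y" and zz: "z * z = z" and yz: "y * z = 0" and xyz: "x = y + z"
    proof -
      show "y * y = y" using fg(5) y mult[OF y(1) y(1)]
        by (intro to_grpalg_inj[OF n]) (simp_all add: idem_def invariants_mult)
      show "z * z = z" using fg(6) z mult[OF z(1) z(1)]
        by (intro to_grpalg_inj[OF n]) (simp_all add: idem_def invariants_mult)
      show "y * z = 0" using fg(7) y z mult[OF y(1) z(1)]
        by (intro to_grpalg_inj[OF n]) (simp_all add: invariants_mult invariants_zero)
      show "x = y + z" using fg(8) y z x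
        by (intro to_grpalg_inj[OF n]) (simp_all add: invariants_add to_grpalg_add)
    qed
    have *: "class_value n y \<nu> * class_value n y \<nu> = class_value n y \<nu>"
      "class_value n z \<nu> * class_value n z \<nu> = class_value n z \<nu>"
      "class_value n y \<nu> * class_value n z \<nu> = 0" for \<nu>
      unfolding class_value_mult[symmetric] yy zz yz by (simp_all add: class_value_zero)
    have off: "class_value n y \<nu> = 0" "class_value n z \<nu> = 0"
      if "\<nu> \<in> p_regular_partitions p n" "\<nu> \<noteq> l" for \<nu>
    proof -
      have s: "class_value n y \<nu> + class_value n z \<nu> = 0"
        using val[OF that(1)] that(2) unfolding xyz class_value_add by simp
      have "class_value n y \<nu> = 0 \<or> class_value n z \<nu> = 0" using *(3)[of \<nu>] by simp
      then show "class_value n y \<nu> = 0" "class_value n z \<nu> = 0" using s by auto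
    qed
    have "class_value n y l = 0 \<or> class_value n z l = 0" using *(3)[of l] by simp
    then have "y = 0 \<or> z = 0"
      using idempotent_eq_zero[OF y(1) yy] idempotent_eq_zero[OF z(1) zz] off by metis
    then show False using fg(3,4) y z by auto
  qed
  moreover have "?P x \<in> descent_alg n" unfolding descent_alg_eq[OF n] using x by blast
  moreover have "idem n (?P x)" unfolding idem_def mult[OF x x] idem ..
  ultimately show ?thesis unfolding primitive_idem_def by blast
qed

end

section \<open>Construction of the idempotents\<close>

text \<open>Multiplying from either side can only refine further, so the elements supported here
  form a two-sided ideal. Its invariants are combinations of the type sums strictly refining
  \<open>l\<close>.\<close>

definition lower :: "nat \<Rightarrow> nat list \<Rightarrow> lexrel set" where
  "lower n l = {k \<in> set_comps n. \<exists>b\<in>of_type n l. sim n k \<subset> sim n b}"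

lemma plus_in_lower:
  assumes "a \<in> set_comps n" "b \<in> set_comps n" "a \<in> lower n l \<or> b \<in> lower n l"
  shows "a + b \<in> lower n l"
  using assms plus_in_set_comps[OF assms(1,2)] unfolding lower_def by (auto simp: sim_plus)

lemma lower_mult:
  assumes "keys x \<subseteq> set_comps n" "keys y \<subseteq> set_comps n"
    and "keys x \<subseteq> lower n l \<or> keys y \<subseteq> lower n l"
  shows "keys (x * y) \<subseteq> lower n l"
proof
  fix k assume "k \<in> keys (x * y)"
  then obtain a b where "a \<in> keys x" "b \<in> keys y" "k = a + b" using keys_mult[of x y] by blast
  then show "k \<in> lower n l" using assms plus_in_lower[of a n b l] by blast
qed

lemma lower_subset: "lower n l \<subseteq> set_comps n"
  by (auto simp: lower_def)

lemma lower_mult_right: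
  "keys a \<subseteq> lower n l \<Longrightarrow> keys y \<subseteq> set_comps n \<Longrightarrow> keys (a * y) \<subseteq> lower n l"
  using lower_subset[of n l] by (intro lower_mult) auto

lemma lower_mult_left:
  "keys a \<subseteq> lower n l \<Longrightarrow> keys y \<subseteq> set_comps n \<Longrightarrow> keys (y * a) \<subseteq> lower n l"
  using lower_subset[of n l] by (intro lower_mult) auto

lemma scale_type_sum: "scale c (type_sum n l) = (\<Sum>k\<in>of_type n l. single k c)"
  by (simp add: scale_def type_sum_def sum_distrib_left mult_single)

lemma type_sum_mult_mod_lower:
  assumes y: "y \<in> invariants n"
  shows "keys (type_sum n l * y - scale (class_value n y l) (type_sum n l)) \<subseteq> lower n l"
proof -
  have "type_sum n l * y - scale (class_value n y l) (type_sum n l)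
    = (\<Sum>k\<in>of_type n l. single k 1 * y - single k (1 * chi n (sim n k) y))"
    unfolding scale_type_sum unfolding type_sum_def sum_distrib_right sum_subtractf[symmetric]
    by (intro sum.cong refl) (simp add: chi_sim_of_type[OF y] class_value_def)
  also have "keys \<dots> \<subseteq> lower n l"
  proof (rule keys_sum_subset)
    fix k assume k: "k \<in> of_type n l"
    then have "k \<in> set_comps n" using of_type_subset by blast
    from single_times_triangular[OF this invariants_keys[OF y], of 1]
    show "keys (single k 1 * y - single k (1 * chi n (sim n k) y)) \<subseteq> lower n l"
      using k by (force simp: lower_def)
  qed
  finally show ?thesis .
qed

text \<open>\<open>b\<close> is idempotent modulo the ideal, so every positive power of an element
  congruent to \<open>b\<close> stays congruent to \<open>b\<close>.\<close>

lemma power_mod_lower: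
  assumes a: "keys a \<subseteq> set_comps n" and b: "keys b \<subseteq> set_comps n"
    and ab: "keys (a - b) \<subseteq> lower n l" and bb: "keys (b * b - b) \<subseteq> lower n l"
  shows "keys (a ^ Suc j - b :: lexrel \<Rightarrow>\<^sub>0 'a::field) \<subseteq> lower n l"
proof (induction j)
  case (Suc j)
  have "a ^ Suc (Suc j) - b = (a ^ Suc j - b) * a + (b * (a - b) + (b * b - b))"
    unfolding power_Suc2[of a "Suc j"] by (simp add: algebra_simps)
  also have "keys \<dots> \<subseteq> lower n l"
    by (intro keys_add_subset lower_mult_right[OF Suc a] lower_mult_left[OF ab b] bb)
  finally show ?case .
qed (use ab in simp)

definition leading :: "nat \<Rightarrow> nat list \<Rightarrow> (lexrel \<Rightarrow>\<^sub>0 'a::field)" where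
  "leading n l = scale (1 / of_nat (brfact l)) (type_sum n l)"

lemma leading_invariant: "leading n l \<in> invariants n"
  unfolding leading_def by (intro invariants_scale type_sum_invariant)

lemma keys_leading: "keys (leading n l) \<subseteq> of_type n l"
  unfolding leading_def using keys_scale keys_type_sum by blast

lemma leading_mult_mod_lower:
  fixes y :: "lexrel \<Rightarrow>\<^sub>0 'a::field"
  assumes y: "y \<in> invariants n"
  shows "keys (leading n l * y - scale (class_value n y l) (leading n l)) \<subseteq> lower n l"
proof -
  let ?c = "1 / of_nat (brfact l) :: 'a"
  have "leading n l * y - scale (class_value n y l) (leading n l)
    = scale ?c (type_sum n l * y - scale (class_value n y l) (type_sum n l))"
    unfolding leading_def scale_mult_left
    by (rule poly_mapping_eqI) (simp add: lookup_minus algebra_simps)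
  then show ?thesis using keys_scale type_sum_mult_mod_lower[OF y] by (metis subset_trans)
qed

text \<open>A term \<open>u\<close> of \<open>x\<close> has its blocks inside those of some
  \<open>b\<close> of type \<open>m\<close>. If \<open>u + v\<close> were no finer than
  \<open>v\<close>, the blocks of \<open>v\<close> would lie in those of \<open>b\<close>; the rank
  condition makes them equal, against \<open>m \<noteq> l\<close>.\<close>

lemma idempotent_mult_leading_lower:
  fixes x :: "lexrel \<Rightarrow>\<^sub>0 'a::field"
  assumes x: "keys (x - leading n m) \<subseteq> lower n m"
    and m: "m \<in> partitions n" and l: "l \<in> partitions n" and "m \<noteq> l" and rank: "type_rank n m \<le> type_rank n l"
  shows "keys (x * leading n l) \<subseteq> lower n l"
proof
  fix k assume "k \<in> keys (x * leading n l)"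
  then obtain u v where uv: "u \<in> keys x" "v \<in> of_type n l" "k = u + v"
    using keys_mult[of x "leading n l"] keys_leading by blast
  have "keys ((x - leading n m) + leading n m) \<subseteq> lower n m \<union> of_type n m"
    using x keys_leading by (intro keys_add_subset) blast+
  then have "u \<in> lower n m \<union> of_type n m" using uv(1) by auto
  then obtain b where b: "u \<in> set_comps n" "b \<in> of_type n m" "sim n u \<subseteq> sim n b"
    using of_type_subset by (fastforce simp: lower_def)
  have cards: "card (sim n c) = type_rank n q" if "c \<in> of_type n q" for c q
    using that by (auto simp: of_type_eq_orbit card_sim_act type_rank_def)
  have "\<not> sim n v \<subseteq> sim n u"
  proof
    assume "sim n v \<subseteq> sim n u"
    then have sub: "sim n v \<subseteq> sim n b" using b(3) by blast
    then have "sim n v = sim n b"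
      using rank cards[OF uv(2)] cards[OF b(2)] by (intro card_seteq) simp_all
    then have "mset l = mset m"
      using mset_eq_if_sim_eq[OF partitions_comps[OF l] partitions_comps[OF m] uv(2) b(2)] by simp
    then show False using partition_eq_if_mset_eq[OF l m] \<open>m \<noteq> l\<close> by simp
  qed
  then have "sim n k \<subset> sim n v" unfolding uv(3) sim_plus by blast
  moreover have "k \<in> set_comps n" unfolding uv(3) using b(1) uv(2) of_type_subset by (blast intro: plus_in_set_comps)
  ultimately show "k \<in> lower n l" using uv(2) by (auto simp: lower_def)
qed

lemma class_value_leading_self:
  assumes "prime p" "CHAR('a::field) = p" "l \<in> p_regular_partitions p n"
  shows "class_value n (leading n l) l = (1 :: 'a)"
proof -
  have "l \<in> comps n" using assms(3) partitions_comps p_regular_imp_partition by blast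
  then show ?thesis using of_nat_brfact_nonzero[OF assms]
    by (simp add: leading_def class_value_scale class_value_type_sum_self)
qed

section \<open>One step of the construction, and the induction\<close>

definition idempotent_for :: "nat \<Rightarrow> nat \<Rightarrow> nat list \<Rightarrow> (lexrel \<Rightarrow>\<^sub>0 'a::field) \<Rightarrow> bool" where
  "idempotent_for p n l x \<longleftrightarrow> x \<in> invariants n \<and> x * x = x \<and>
     (\<forall>\<nu>\<in>p_regular_partitions p n. class_value n x \<nu> = (if \<nu> = l then 1 else 0)) \<and>
     keys (x - leading n l) \<subseteq> lower n l"

context
  fixes p n :: nat
  assumes n: "n \<ge> 1" and p: "prime p" and char_p: "CHAR('a::field) = p"
begin

text \<open>\<open>above\<close> makes the product of the old idempotents with
  \<open>leading n l\<close> strictly finer than \<open>l\<close>; \<open>below\<close> makes the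
  values of \<open>leading n l\<close> vanish at every regular partition other than \<open>l\<close>
  not yet treated.\<close>

lemma ex_next_idempotent:
  fixes e :: "nat list \<Rightarrow> lexrel \<Rightarrow>\<^sub>0 'a"
  assumes fin: "finite S" and S: "S \<subseteq> p_regular_partitions p n"
    and l: "l \<in> p_regular_partitions p n" "l \<notin> S"
    and above: "\<And>m. m \<in> S \<Longrightarrow> type_rank n m \<le> type_rank n l"
    and below: "\<And>\<nu>. \<nu> \<in> p_regular_partitions p n \<Longrightarrow> type_rank n \<nu> < type_rank n l \<Longrightarrow> \<nu> \<in> S"
    and e: "\<And>m. m \<in> S \<Longrightarrow> idempotent_for p n m (e m)"
    and orth: "\<And>m m'. m \<in> S \<Longrightarrow> m' \<in> S \<Longrightarrow> m \<noteq> m' \<Longrightarrow> e m * e m' = 0"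
  obtains x where "idempotent_for p n l x" "\<And>m. m \<in> S \<Longrightarrow> x * e m = 0" "\<And>m. m \<in> S \<Longrightarrow> e m * x = 0"
proof -
  let ?w = "leading n l :: lexrel \<Rightarrow>\<^sub>0 'a"
  define s where "s = (\<Sum>m\<in>S. e m)"
  define h where "h = (1 - s) * ?w * (1 - s)"
  have einv: "e m \<in> invariants n" if "m \<in> S" for m using e[OF that] by (simp add: idempotent_for_def)
  have sinv: "s \<in> invariants n" unfolding s_def using einv by (rule invariants_sum)
  have winv: "?w \<in> invariants n" by (rule leading_invariant)
  have hinv: "h \<in> invariants n" unfolding h_def
    by (intro invariants_mult invariants_diff invariants_one sinv winv)
  note sk = invariants_keys[OF sinv] and wk = invariants_keys[OF winv] and hk = invariants_keys[OF hinv]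
  have lp: "l \<in> partitions n" using l p_regular_imp_partition by blast
  have es: "e m * s = e m" "s * e m = e m" if m: "m \<in> S" for m
  proof -
    have mm: "e m * e m = e m" using e[OF m] by (simp add: idempotent_for_def)
    have "e m * s = (\<Sum>m'\<in>S. if m' = m then e m else 0)"
      unfolding s_def sum_distrib_left using orth m mm by (intro sum.cong) auto
    then show "e m * s = e m" using fin m by simp
    have "s * e m = (\<Sum>m'\<in>S. if m' = m then e m else 0)"
      unfolding s_def sum_distrib_right using orth m mm by (intro sum.cong) auto
    then show "s * e m = e m" using fin m by simp
  qed
  have sval: "class_value n s \<nu> = (if \<nu> \<in> S then 1 else 0)" if "\<nu> \<in> p_regular_partitions p n" for \<nu>
  proof -
    have "class_value n s \<nu> = (\<Sum>m\<in>S. if m = \<nu> then 1 else 0)"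
      unfolding s_def class_value_sum using e that by (intro sum.cong) (auto simp: idempotent_for_def)
    then show ?thesis using fin by simp
  qed
  have hval: "class_value n h \<nu> = (if \<nu> = l then 1 else 0)" if nu: "\<nu> \<in> p_regular_partitions p n" for \<nu>
  proof -
    have hv: "class_value n h \<nu> = (1 - class_value n s \<nu>) * class_value n ?w \<nu> * (1 - class_value n s \<nu>)"
      by (simp add: h_def class_value_mult class_value_diff class_value_one)
    consider "\<nu> \<in> S" | "\<nu> = l" | "\<nu> \<notin> S" "\<nu> \<noteq> l" by blast
    then show ?thesis
    proof cases
      case 1
      then show ?thesis using hv sval[OF nu] l by auto
    next
      case 2
      then show ?thesis using hv sval[OF nu] l class_value_leading_self[OF p char_p] by simp
    next
      case 3
      then have "\<not> type_rank n \<nu> < type_rank n l" using below[OF nu] by blast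
      then have "class_value n (type_sum n l) \<nu> = (0 :: 'a)"
        using class_value_type_sum_nonzero[OF lp p_regular_imp_partition[OF nu]] 3 by blast
      then have "class_value n ?w \<nu> = 0" by (simp add: leading_def class_value_scale)
      then show ?thesis using hv 3 by simp
    qed
  qed
  have sw: "keys (s * ?w) \<subseteq> lower n l"
    unfolding s_def sum_distrib_right
  proof (rule keys_sum_subset)
    fix m assume m: "m \<in> S"
    show "keys (e m * ?w) \<subseteq> lower n l"
    proof (rule idempotent_mult_leading_lower)
      show "keys (e m - leading n m) \<subseteq> lower n m" using e[OF m] by (simp add: idempotent_for_def)
      show "m \<in> partitions n" using m S p_regular_imp_partition by blast
      show "m \<noteq> l" using m l by blast
    qed (use lp above m in auto)
  qed
  have ws: "keys (?w * s) \<subseteq> lower n l"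
    using leading_mult_mod_lower[OF sinv, of l] sval[OF l(1)] l(2) by (simp add: scale_def)
  have hw: "keys (h - ?w) \<subseteq> lower n l"
  proof -
    have "h - ?w = s * ?w * s - (s * ?w + ?w * s)" by (simp add: h_def algebra_simps)
    also have "keys \<dots> \<subseteq> lower n l"
      by (intro keys_diff_subset keys_add_subset lower_mult_right[OF sw sk] sw ws)
    finally show ?thesis .
  qed
  have ww: "keys (?w * ?w - ?w) \<subseteq> lower n l"
    using leading_mult_mod_lower[OF winv, of l] class_value_leading_self[OF p char_p l(1)] by (simp add: scale_def)
  \<comment> \<open>The nilpotency bound for elements without class values;
    \<open>h * (1 - h)\<close> is one, since \<open>h\<close> takes only the values 0 and 1.\<close>
  define N where "N = Suc (n * n)"
  define u where "u = h ^ N"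
  define x where "x = 1 - (1 - u) ^ N"
  have "(h * (1 - h)) ^ N = 0" unfolding N_def
  proof (rule nilpotent_if_class_values_zero[OF n p char_p])
    show "h * (1 - h) \<in> invariants n" by (intro invariants_mult invariants_diff invariants_one hinv)
    show "class_value n (h * (1 - h)) \<nu> = 0" if "\<nu> \<in> p_regular_partitions p n" for \<nu>
      using hval[OF that] by (simp add: class_value_mult class_value_diff class_value_one)
  qed
  then have xx: "x * x = x" unfolding x_def u_def by (rule idempotent_lift)
  have xinv: "x \<in> invariants n" unfolding x_def u_def
    by (intro invariants_diff invariants_power invariants_one hinv)
  have uw: "keys (u - ?w) \<subseteq> lower n l" unfolding u_def N_def by (rule power_mod_lower[OF hk wk hw ww])
  have "keys ((1 - u) ^ N - (1 - ?w)) \<subseteq> lower n l" unfolding N_def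
  proof (rule power_mod_lower)
    show "keys (1 - u) \<subseteq> set_comps n" "keys (1 - ?w) \<subseteq> set_comps n"
      unfolding u_def by (intro invariants_keys invariants_diff invariants_power invariants_one hinv winv)+
    have "(1 - u) - (1 - ?w) = 0 - (u - ?w)" by simp
    then show "keys ((1 - u) - (1 - ?w)) \<subseteq> lower n l" using keys_diff_subset[OF _ uw, of 0] by (metis empty_subsetI keys_zero)
    have "(1 - ?w) * (1 - ?w) - (1 - ?w) = ?w * ?w - ?w" by (simp add: algebra_simps)
    then show "keys ((1 - ?w) * (1 - ?w) - (1 - ?w)) \<subseteq> lower n l" using ww by simp
  qed
  moreover have "x - ?w = 0 - ((1 - u) ^ N - (1 - ?w))" by (simp add: x_def)
  ultimately have xw: "keys (x - ?w) \<subseteq> lower n l"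
    using keys_diff_subset[of 0 "lower n l"] by (metis empty_subsetI keys_zero)
  have xval: "class_value n x \<nu> = (if \<nu> = l then 1 else 0)" if "\<nu> \<in> p_regular_partitions p n" for \<nu>
  proof -
    have "class_value n x \<nu> = 1 - (1 - class_value n h \<nu> ^ N) ^ N"
      by (simp add: x_def u_def class_value_diff class_value_power class_value_one)
    then show ?thesis using hval[OF that] by (simp add: N_def)
  qed
  \<comment> \<open>\<open>x\<close> is a multiple of \<open>h\<close> on both sides, and the
    factors \<open>1 - s\<close> of \<open>h\<close> annihilate every \<open>e m\<close>.\<close>
  obtain r where r: "x = u * r" "x = r * u" unfolding x_def by (rule one_diff_power_factor)
  have u: "u = h * h ^ (n * n)" "u = h ^ (n * n) * h" by (simp_all add: u_def N_def power_commutes)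
  have "e m * x = 0" "x * e m = 0" if m: "m \<in> S" for m
  proof -
    have "e m * (1 - s) = 0" "(1 - s) * e m = 0" using es[OF m] by (simp_all add: algebra_simps)
    then have "e m * h = 0" "h * e m = 0" unfolding h_def
      by (simp_all add: mult.assoc) (simp_all add: mult.assoc[symmetric])
    moreover have "e m * x = e m * h * (h ^ (n * n) * r)"
      unfolding r(1) u(1) by (simp only: mult.assoc)
    moreover have "x * e m = r * h ^ (n * n) * (h * e m)"
      unfolding r(2) u(2) by (simp only: mult.assoc)
    ultimately show "e m * x = 0" "x * e m = 0" by simp_all
  qed
  moreover have "idempotent_for p n l x" using xinv xx xval xw by (simp add: idempotent_for_def)
  ultimately show ?thesis using that by blast
qed

text \<open>\<open>S\<close> is required to be closed downwards in rank so that, with elements added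
  by increasing rank, each step finds all partitions of smaller rank treated.\<close>

lemma ex_orthogonal_idempotents:
  assumes "finite S" "S \<subseteq> p_regular_partitions p n"
    "\<And>l \<nu>. l \<in> S \<Longrightarrow> \<nu> \<in> p_regular_partitions p n \<Longrightarrow> type_rank n \<nu> < type_rank n l \<Longrightarrow> \<nu> \<in> S"
  shows "\<exists>e :: nat list \<Rightarrow> lexrel \<Rightarrow>\<^sub>0 'a. (\<forall>l\<in>S. idempotent_for p n l (e l)) \<and> (\<forall>l\<in>S. \<forall>m\<in>S. l \<noteq> m \<longrightarrow> e l * e m = 0)"
  using assms
proof (induction S rule: finite_ranking_induct[where f = "type_rank n"])
  case (insert l S)
  show ?case
  proof (cases "l \<in> S")
    case True
    then show ?thesis using insert by (simp add: insert_absorb)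
  next
    case False
    have S: "S \<subseteq> p_regular_partitions p n" using insert.prems by blast
    have "\<exists>e :: nat list \<Rightarrow> lexrel \<Rightarrow>\<^sub>0 'a. (\<forall>l\<in>S. idempotent_for p n l (e l)) \<and> (\<forall>l\<in>S. \<forall>m\<in>S. l \<noteq> m \<longrightarrow> e l * e m = 0)"
    proof (rule insert.IH[OF S])
      fix m \<nu> assume m: "m \<in> S" "\<nu> \<in> p_regular_partitions p n" "type_rank n \<nu> < type_rank n m"
      then have "\<nu> \<in> insert l S" using insert.prems(2)[of m \<nu>] by blast
      \<comment> \<open>\<open>l\<close> is inserted last and has rank at least that of
        \<open>m\<close>, whereas \<open>\<nu>\<close> has smaller rank than
        \<open>m\<close>.\<close>
      moreover have "\<nu> \<noteq> l" using m insert.hyps(2)[OF m(1)] by auto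
      ultimately show "\<nu> \<in> S" by blast
    qed
    then obtain e :: "nat list \<Rightarrow> lexrel \<Rightarrow>\<^sub>0 'a" where e: "\<And>m. m \<in> S \<Longrightarrow> idempotent_for p n m (e m)"
      "\<And>m m'. m \<in> S \<Longrightarrow> m' \<in> S \<Longrightarrow> m \<noteq> m' \<Longrightarrow> e m * e m' = 0" by blast
    obtain x where x: "idempotent_for p n l x" "\<And>m. m \<in> S \<Longrightarrow> x * e m = 0" "\<And>m. m \<in> S \<Longrightarrow> e m * x = 0"
    proof (rule ex_next_idempotent[OF insert.hyps(1) S _ False insert.hyps(2) _ e])
      show "l \<in> p_regular_partitions p n" using insert.prems by blast
      show "\<nu> \<in> S" if "\<nu> \<in> p_regular_partitions p n" "type_rank n \<nu> < type_rank n l" for \<nu>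
        using insert.prems(2)[of l \<nu>] that by auto
    qed blast+
    show ?thesis
      by (intro exI[of _ "e(l := x)"]) (use e x False in auto)
  qed
qed simp

end

lemma lower_decomp:
  fixes z :: "lexrel \<Rightarrow>\<^sub>0 'a::field"
  assumes n: "n \<ge> 1" and z: "z \<in> invariants n" and low: "keys z \<subseteq> lower n l" and l: "l \<in> comps n"
  shows "z = (\<Sum>q\<in>{q \<in> comps n. strict_weak_refines q l}. scale (lookup z (std_rel n q)) (type_sum n q))"
proof -
  have "lookup z (std_rel n q) = 0" if q: "q \<in> comps n" "\<not> strict_weak_refines q l" for q
  proof (rule ccontr)
    assume "lookup z (std_rel n q) \<noteq> 0"
    then have "std_rel n q \<in> lower n l" using low by (auto simp: in_keys_iff)
    then obtain b where "b \<in> of_type n l" "sim n (std_rel n q) \<subset> sim n b" by (auto simp: lower_def)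
    then have "strict_weak_refines q l"
      using strict_weak_refines_if_sim_psubset[OF q(1) l std_rel_in_of_type] by blast
    then show False using q by simp
  qed
  then have "(\<Sum>q\<in>comps n. scale (lookup z (std_rel n q)) (type_sum n q))
    = (\<Sum>q\<in>{q \<in> comps n. strict_weak_refines q l}. scale (lookup z (std_rel n q)) (type_sum n q))"
    by (intro sum.mono_neutral_right) (auto simp: scale_def)
  then show ?thesis using invariants_decomp[OF n z] by simp
qed

theorem mainTheorem1:
  fixes p n :: nat
  assumes "infinite (UNIV :: 'a::field set)"
    and "CHAR('a) = p" and "p > 0" and "n \<ge> 1"
  shows "\<exists>e :: nat list \<Rightarrow> 'a grpalg.
    (\<forall>l\<in>p_regular_partitions p n. primitive_idem n (e l)) \<and>
    (\<forall>l\<in>p_regular_partitions p n. \<forall>m\<in>p_regular_partitions p n.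
        l \<noteq> m \<longrightarrow> ga_mult n (e l) (e m) = 0) \<and>
    (\<Sum>l\<in>p_regular_partitions p n. e l) = ga_one n \<and>
    (\<forall>l\<in>p_regular_partitions p n. solomon n (e l) = char_fun p n l) \<and>
    (\<forall>l\<in>p_regular_partitions p n. \<exists>c.
        e l = smul (1 / of_nat (brfact l)) (Xi n l)
              + (\<Sum>\<xi>\<in>{\<xi> \<in> comps n. strict_weak_refines \<xi> l}. smul (c \<xi>) (Xi n \<xi>)))"
proof -
  note char_p = assms(2) and n = assms(4)
  have p: "prime p" using prime_CHAR_semidom[where ?'a = 'a] assms(2,3) by simp
  let ?R = "p_regular_partitions p n" and ?P = "to_grpalg n :: (lexrel \<Rightarrow>\<^sub>0 'a) \<Rightarrow> 'a grpalg"
  have fin: "finite ?R"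
    by (rule finite_subset[OF _ finite_comps[of n]]) (auto simp: p_regular_partitions_def partitions_def)
  have "\<exists>e :: nat list \<Rightarrow> lexrel \<Rightarrow>\<^sub>0 'a. (\<forall>l\<in>?R. idempotent_for p n l (e l)) \<and>
      (\<forall>l\<in>?R. \<forall>m\<in>?R. l \<noteq> m \<longrightarrow> e l * e m = 0)"
    by (rule ex_orthogonal_idempotents[OF n p char_p fin]) auto
  then obtain e :: "nat list \<Rightarrow> lexrel \<Rightarrow>\<^sub>0 'a" where e: "\<And>l. l \<in> ?R \<Longrightarrow> idempotent_for p n l (e l)"
    and orth: "\<And>l m. l \<in> ?R \<Longrightarrow> m \<in> ?R \<Longrightarrow> l \<noteq> m \<Longrightarrow> e l * e m = 0" by blast
  have inv: "e l \<in> invariants n" and idem: "e l * e l = e l"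
    and val: "\<And>\<nu>. \<nu> \<in> ?R \<Longrightarrow> class_value n (e l) \<nu> = (if \<nu> = l then 1 else 0)"
    and lead: "keys (e l - leading n l) \<subseteq> lower n l" if "l \<in> ?R" for l
    using e[OF that] by (simp_all add: idempotent_for_def)
  have "primitive_idem n (?P (e l))" if "l \<in> ?R" for l
    using primitive_idem_to_grpalg[OF n p char_p inv[OF that] idem[OF that] that val[OF that]] .
  moreover have "ga_mult n (?P (e l)) (?P (e m)) = 0" if "l \<in> ?R" "m \<in> ?R" "l \<noteq> m" for l m
    using to_grpalg_mult[OF inv[OF that(1)] invariants_keys[OF inv[OF that(2)]]] orth[OF that] by simp
  moreover have "(\<Sum>l\<in>?R. ?P (e l)) = ga_one n"
  proof -
    define E where "E = (\<Sum>l\<in>?R. e l)"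
    \<comment> \<open>\<open>1 - E\<close> is an idempotent invariant with value 0 at every regular
      partition, hence zero.\<close>
    have Einv: "1 - E \<in> invariants n"
      unfolding E_def by (intro invariants_diff invariants_one invariants_sum inv)
    have "E * E = (\<Sum>l\<in>?R. \<Sum>m\<in>?R. if m = l then e l else 0)"
      unfolding E_def sum_product by (intro sum.cong refl) (auto simp: idem orth)
    also have "\<dots> = E" unfolding E_def using fin by (intro sum.cong refl) simp
    finally have "(1 - E) * (1 - E) = 1 - E" by (simp add: algebra_simps)
    moreover have "class_value n (1 - E) \<nu> = 0" if "\<nu> \<in> ?R" for \<nu>
    proof -
      have "class_value n E \<nu> = (\<Sum>l\<in>?R. if l = \<nu> then 1 else 0)"
        unfolding E_def class_value_sum using val that by (intro sum.cong refl) auto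
      then show ?thesis using fin that by (simp add: class_value_diff class_value_one)
    qed
    ultimately have "1 - E = 0" by (rule idempotent_eq_zero[OF n p char_p Einv])
    then have "?P E = ga_one n" by (simp add: to_grpalg_one)
    then show ?thesis by (simp add: E_def to_grpalg_sum)
  qed
  moreover have "solomon n (?P (e l)) = char_fun p n l" if "l \<in> ?R" for l
    using solomon_eq_char_fun[OF n p char_p inv[OF that] that val[OF that]] .
  moreover have "\<exists>c. ?P (e l) = smul (1 / of_nat (brfact l)) (Xi n l)
      + (\<Sum>\<xi>\<in>{\<xi> \<in> comps n. strict_weak_refines \<xi> l}. smul (c \<xi>) (Xi n \<xi>))" if l: "l \<in> ?R" for l
  proof -
    let ?z = "e l - leading n l"
    have lc: "l \<in> comps n" using l partitions_comps p_regular_imp_partition by blast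
    have "?z \<in> invariants n" using inv[OF l] leading_invariant by (rule invariants_diff)
    from lower_decomp[OF n this lead[OF l] lc]
    have "?P ?z = ?P (\<Sum>\<xi>\<in>{\<xi> \<in> comps n. strict_weak_refines \<xi> l}.
        scale (lookup ?z (std_rel n \<xi>)) (type_sum n \<xi>))"
      by (rule arg_cong)
    also have "\<dots> = (\<Sum>\<xi>\<in>{\<xi> \<in> comps n. strict_weak_refines \<xi> l}. smul (lookup ?z (std_rel n \<xi>)) (Xi n \<xi>))"
      by (rule to_grpalg_comps_sum)
    finally have "?P ?z = (\<Sum>\<xi>\<in>{\<xi> \<in> comps n. strict_weak_refines \<xi> l}. smul (lookup ?z (std_rel n \<xi>)) (Xi n \<xi>))" .
    moreover have "?P (leading n l) = smul (1 / of_nat (brfact l)) (Xi n l)"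
      by (simp add: leading_def to_grpalg_scale to_grpalg_type_sum)
    moreover have "?P (e l) = ?P (leading n l) + ?P ?z" by (simp flip: to_grpalg_add)
    ultimately have "?P (e l) = smul (1 / of_nat (brfact l)) (Xi n l)
      + (\<Sum>\<xi>\<in>{\<xi> \<in> comps n. strict_weak_refines \<xi> l}. smul (lookup ?z (std_rel n \<xi>)) (Xi n \<xi>))" by simp
    then show ?thesis by (intro exI[of _ "\<lambda>\<xi>. lookup ?z (std_rel n \<xi>)"])
  qed
  ultimately show ?thesis by (intro exI[of _ "\<lambda>l. ?P (e l)"]) simp
qed

end
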